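(* Let $f\in\mathbb{R}[x]$, and let $h=(h_1,\ldots,h_{m_1})$ and $g=(g_1,\ldots,g_{m_2})$ be tuples of polynomials in $\mathbb{R}[x]$, $x=(x_1,\ldots,x_n)$. Let $K=\{x\in\mathbb{R}^n: h(x)=0,\ g_j(x)\ge 0\ (j=1,\ldots,m_2)\}$ and let $f_{min}$ be the optimal value of $\min f(x)$ subject to $x\in K$. Let $h'=(h'_1,\ldots,h'_r)$ be a tuple of polynomials in $\mathbb{R}[x]$ such that $V_{\mathbb{R}}(h)=V_{\mathbb{R}}(h')$. For $k\in\mathbb{N}$, let $f_k$ be the optimal value of $$\max\ \gamma\quad\text{s.t.}\quad f-\gamma\in\langle h\rangle_{2k}+Q_k(g),$$ and let $f'_k$ be the optimal value of $$\max\ \gamma\quad\text{s.t.}\quad f-\gamma\in\langle h'\rangle_{2k}+Q_k(g).$$ Suppose $I(K)=I(V_{\mathbb{R}}(h))$. Then the sequence $\{f_k\}$ has finite convergence to $f_{min}$ if and only if the sequence $\{f'_k\}$ has finite convergence to $f_{min}$.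
   Context: $\mathbb{R}[x]$ is the ring of real polynomials in $x=(x_1,\ldots,x_n)$, and $\mathbb{N}$ is the set of nonnegative integers. $\Sigma\mathbb{R}[x]^2$ denotes the set of sums of squares of polynomials in $\mathbb{R}[x]$. For a polynomial tuple $p=(p_1,\ldots,p_m)$, $V_{\mathbb{R}}(p)=\{x\in\mathbb{R}^n: p(x)=0\}$ and $$\langle p\rangle_{2k}=\Big\{\sum_{i=1}^{m}\phi_i p_i:\ \phi_i\in\mathbb{R}[x],\ \deg(\phi_i p_i)\le 2k\text{ for each } i\Big\}.$$ With $g_0=1$, $$Q_k(g)=\Big\{\sum_{j=0}^{m_2}\sigma_j g_j:\ \sigma_j\in\Sigma\mathbb{R}[x]^2,\ \deg(\sigma_j g_j)\le 2k\text{ for each } j\Big\}.$$ For $S\subseteq\mathbb{R}^n$, $I(S)=\{p\in\mathbb{R}[x]: p(u)=0\ \forall u\in S\}$ is its vanishing ideal. Optimal values are understood as an infimum (for $f_{min}$) and suprema (for $f_k,f'_k$) in $\mathbb{R}\cup\{\pm\infty\}$, not necessarily attained; $f_{min}=+\infty$ if $K=\emptyset$, and the optimal value of a maximization problem with no feasible $\gamma$ is $-\infty$. A sequence $\{a_k\}$ of such optimal values (which is monotonically increasing and bounded above by $f_{min}$) has finite convergence to $f_{min}$ if $a_k=f_{min}$ for some $k$. *)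

theory Defs
  imports
    "HOL-Analysis.Analysis"
    "HOL-Library.Poly_Mapping"
    "HOL-Library.Set_Algebras"
begin

text \<open>
  The variables are indexed by a finite type \<open>'n\<close>, and points of the affine space are vectors
  in \<open>real ^ 'n\<close>. A polynomial is a finitely supported function from exponent vectors to
  coefficients; \<^theory>\<open>HOL-Library.Poly_Mapping\<close> provides the convolution product.
\<close>

type_synonym 'n rpoly = "('n \<Rightarrow>\<^sub>0 nat) \<Rightarrow>\<^sub>0 real"

definition const_poly :: "real \<Rightarrow> 'n::finite rpoly" where
  "const_poly c = Poly_Mapping.single 0 c"

definition eval_poly :: "'n::finite rpoly \<Rightarrow> real ^ 'n \<Rightarrow> real" where
  "eval_poly p x =
     (\<Sum>a\<in>Poly_Mapping.keys p. Poly_Mapping.lookup p a * (\<Prod>i\<in>UNIV. (x $ i) ^ Poly_Mapping.lookup a i))"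

text \<open>
  The zero polynomial gets degree 0. This agrees with the convention \<open>-\<infinity>\<close> for all the
  bounds \<open>total_degree p \<le> 2 * k\<close> used below.
\<close>

definition total_degree :: "'n::finite rpoly \<Rightarrow> nat" where
  "total_degree p = Max (insert 0 ((\<lambda>a. \<Sum>i\<in>UNIV. Poly_Mapping.lookup a i) ` Poly_Mapping.keys p))"

definition sos_polys :: "'n::finite rpoly set" where
  "sos_polys = {s. \<exists>qs. s = (\<Sum>q\<leftarrow>qs. q ^ 2)}"

definition real_variety :: "'n::finite rpoly list \<Rightarrow> (real ^ 'n) set" where
  "real_variety p = {x. \<forall>i<length p. eval_poly (p ! i) x = 0}"

definition vanishing_ideal :: "(real ^ 'n) set \<Rightarrow> 'n::finite rpoly set" where
  "vanishing_ideal S = {p. \<forall>u\<in>S. eval_poly p u = 0}"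

definition truncated_ideal :: "'n::finite rpoly list \<Rightarrow> nat \<Rightarrow> 'n rpoly set" where
  "truncated_ideal p k =
     {(\<Sum>i<length p. \<phi> i * p ! i) | \<phi>. \<forall>i<length p. total_degree (\<phi> i * p ! i) \<le> 2 * k}"

text \<open>The entry \<open>g\<^sub>0 = 1\<close> is prepended to the tuple, so \<open>(1 # g) ! j\<close> is \<open>g\<^sub>j\<close> for \<open>j \<le> length g\<close>.\<close>

definition truncated_quadratic_module :: "'n::finite rpoly list \<Rightarrow> nat \<Rightarrow> 'n rpoly set" where
  "truncated_quadratic_module g k =
     {(\<Sum>j\<le>length g. \<sigma> j * (1 # g) ! j) | \<sigma>.
        \<forall>j\<le>length g. \<sigma> j \<in> sos_polys \<and> total_degree (\<sigma> j * (1 # g) ! j) \<le> 2 * k}"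

definition feasible_set :: "'n::finite rpoly list \<Rightarrow> 'n rpoly list \<Rightarrow> (real ^ 'n) set" where
  "feasible_set h g = {x \<in> real_variety h. \<forall>j<length g. eval_poly (g ! j) x \<ge> 0}"

text \<open>
  Optimal values are extended reals: on \<^typ>\<open>ereal\<close> the infimum of the empty set is \<open>\<infinity>\<close> and
  the supremum of the empty set is \<open>-\<infinity>\<close>.
\<close>

definition min_value :: "'n::finite rpoly \<Rightarrow> 'n rpoly list \<Rightarrow> 'n rpoly list \<Rightarrow> ereal" where
  "min_value f h g = (INF x\<in>feasible_set h g. ereal (eval_poly f x))"

definition sos_relaxation_value ::
    "'n::finite rpoly \<Rightarrow> 'n rpoly list \<Rightarrow> 'n rpoly list \<Rightarrow> nat \<Rightarrow> ereal" where
  "sos_relaxation_value f h g k =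
     (SUP \<gamma>\<in>{\<gamma>. f - const_poly \<gamma> \<in> truncated_ideal h k + truncated_quadratic_module g k}. ereal \<gamma>)"

definition finite_convergence :: "(nat \<Rightarrow> ereal) \<Rightarrow> ereal \<Rightarrow> bool" where
  "finite_convergence a L \<longleftrightarrow> (\<exists>k. a k = L)"

end

theory Submission
  imports "HOL-Algebra.Algebraic_Closure_Type" Defs
begin

text \<open>
Suppose \<open>f - \<gamma> = p + u\<close> with \<open>p\<close> in the truncated ideal of \<open>h\<close> and \<open>u\<close> in the truncated quadratic
module of \<open>g\<close>. The polynomial \<open>p\<close> vanishes on the real variety of \<open>h\<close>, hence on that of \<open>h'\<close>, but
it need not lie in the ideal of \<open>h'\<close>. By the real Nullstellensatz (\<open>real_nullstellensatz\<close>), every \<open>b\<close>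
that vanishes on the variety satisfies \<open>b\<^sup>2\<^sup>l + s \<in> \<langle>h'\<rangle>\<close> for some \<open>l\<close> and some sum of squares \<open>s\<close>.
For every real \<open>c\<close> and every \<open>\<epsilon> > 0\<close> there is a large \<open>M\<close> for which \<open>\<epsilon> + c b + M b\<^sup>N\<close> is a sum of
squares, \<open>N\<close> being a power of two above \<open>2l\<close>. So \<open>c b + \<epsilon>\<close> is a sum of squares modulo \<open>\<langle>h'\<rangle>\<close>, and the degrees
in this identity depend on \<open>b\<close> but neither on \<open>c\<close> nor on \<open>\<epsilon>\<close>. The vanishing polynomials of degree at most
\<open>2k\<close> form a finite-dimensional space; applying this to the members of a basis gives one truncation order that serves
every \<open>p\<close> and every \<open>\<epsilon>\<close> (\<open>vanishing_in_ideal_plus_squares\<close>). Therefore \<open>\<gamma> - \<epsilon>\<close> is feasible for \<open>h'\<close> at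
a fixed order for all \<open>\<epsilon> > 0\<close>, so every value \<open>f\<^sub>k\<close> of the first hierarchy is dominated by some value of the
second (\<open>sos_relaxation_dominates\<close>). Both hierarchies stay below the common minimum, and the claim
follows by symmetry. The argument takes place in the extended reals and includes the infinite values.

The bulk of the development proves the real Nullstellensatz. The polynomials \<open>q\<^sup>2\<^sup>l + s\<close> form a multiplicative
set; if it misses an ideal, an ideal maximal among those that contain the given one and miss the set is prime
and real. So it suffices to show that a real prime ideal \<open>I\<close> contains every \<open>q\<close> that vanishes at the common
zeros of finitely many members of \<open>I\<close>. The residue ring of \<open>I\<close> embeds into an algebraically closed field,
and inside it a maximal real cone that contains the sums of squares of residues serves as the set of nonnegative elements and
spans a real closed field \<open>K\<close> (\<open>real_closure\<close>); the decisive algebraic fact is the Artin-Schreier argument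
\<open>irreducible_dvd_weighted_squares\<close>. The residues of the variables are a point over \<open>K\<close> at which the
members of \<open>I\<close>, and no other polynomials, vanish. The theorem of Artin and Lang (\<open>Artin_Lang\<close>) moves this point,
with any finite set of sign conditions, to a real point. It rests on the elimination of one variable
(\<open>eliminate_variable\<close>) by the method of Cohen and Hoermander, formulated as a back-and-forth argument between two
real closed fields.
\<close>

section \<open>Real closed fields\<close>

text \<open>
Real closedness is expressed by the intermediate value property for polynomials. Inside the class
specification polynomials over the type are not yet available, so the axiom speaks of coefficient sums.
\<close>

class real_closed_field = linordered_field +
  assumes ivt_sum: "a < b \<Longrightarrow> (\<Sum>k\<le>n. f k * a ^ k) < 0 \<Longrightarrow> 0 < (\<Sum>k\<le>n. f k * b ^ k)
    \<Longrightarrow> \<exists>x. a < x \<and> x < b \<and> (\<Sum>k\<le>n. f k * x ^ k) = 0"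

lemma poly_ivt_up:
  fixes p :: "'a::real_closed_field poly"
  assumes "a < b" "poly p a < 0" "0 < poly p b"
  obtains x where "a < x" "x < b" "poly p x = 0"
  using ivt_sum[of a b "coeff p" "degree p"] assms by (auto simp: poly_altdef)

lemma poly_ivt:
  fixes p :: "'a::real_closed_field poly"
  assumes "a < b" "poly p a * poly p b < 0"
  obtains x where "a < x" "x < b" "poly p x = 0"
proof (cases "poly p a < 0")
  case True
  then have "0 < poly p b" using assms by (auto simp: mult_less_0_iff)
  from poly_ivt_up[OF assms(1) True this] show ?thesis using that by blast
next
  case False
  then have "poly (-p) a < 0" "0 < poly (-p) b" using assms by (auto simp: mult_less_0_iff)
  from poly_ivt_up[OF assms(1) this] show ?thesis using that by auto
qed

instance real :: real_closed_field
proof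
  fix a b :: real and n :: nat and f :: "nat \<Rightarrow> real"
  assume ab: "a < b" and *: "(\<Sum>k\<le>n. f k * a ^ k) < 0" "0 < (\<Sum>k\<le>n. f k * b ^ k)"
  have "\<exists>x\<ge>a. x \<le> b \<and> (\<Sum>k\<le>n. f k * x ^ k) = 0"
    by (rule IVT') (use ab * in \<open>auto intro!: continuous_intros\<close>)
  then obtain x where "a \<le> x" "x \<le> b" "(\<Sum>k\<le>n. f k * x ^ k) = 0" by auto
  with * show "\<exists>x. a < x \<and> x < b \<and> (\<Sum>k\<le>n. f k * x ^ k) = 0"
    by (intro exI[of _ x]) (auto simp: less_le)
qed

lemma poly_split_root:
  fixes p :: "'a::idom poly"
  assumes "p \<noteq> 0" "poly p a = 0"
  obtains m q where "p = [:-a,1:] ^ Suc m * q" "poly q a \<noteq> 0"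
proof -
  obtain q where q: "p = [:-a,1:] ^ order a p * q" "\<not> [:-a,1:] dvd q"
    using order_decomp[OF \<open>p \<noteq> 0\<close>] by blast
  have "order a p > 0" using assms by (simp add: order_gt_0_iff)
  then obtain m where "order a p = Suc m" by (cases "order a p") auto
  then show ?thesis using that[of m q] q by (simp add: poly_eq_0_iff_dvd)
qed

text \<open>
If \<open>A\<close> and \<open>B\<close> are monic linear and \<open>g\<close> has the same sign at their roots, the last factor takes values of opposite
signs there. This is how Rolle's theorem finds its critical point.
\<close>

lemma pderiv_two_factors:
  assumes "pderiv A = 1" "pderiv B = 1"
  shows "pderiv (A ^ Suc m * (B ^ Suc n * g)) =
    A ^ m * B ^ n * (smult (of_nat (Suc m)) (B * g) + smult (of_nat (Suc n)) (A * g) + A * B * pderiv g)"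
  by (simp only: pderiv_mult pderiv_power_Suc assms mult_smult_left mult_smult_right mult_1_right)
    (simp add: algebra_simps del: of_nat_Suc)

text \<open>
Without suprema, a critical point cannot be found as a maximum. Instead, take \<open>b'\<close> to be the next root after
\<open>a\<close> and split off the full powers of both roots. The cofactor \<open>g\<close> keeps its sign on the interval, so the
nontrivial factor of the derivative changes sign there.
\<close>

lemma poly_rolle:
  fixes p :: "'a::real_closed_field poly"
  assumes ab: "a < b" and roots: "poly p a = 0" "poly p b = 0" and "p \<noteq> 0"
  obtains c where "a < c" "c < b" "poly (pderiv p) c = 0"
proof -
  define B where "B = {x. poly p x = 0 \<and> a < x}"
  have fin: "finite B" unfolding B_def using poly_roots_finite[OF \<open>p \<noteq> 0\<close>] by auto
  have "b \<in> B" using ab roots by (auto simp: B_def)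
  define b' where "b' = Min B"
  have b'B: "b' \<in> B" unfolding b'_def using fin \<open>b \<in> B\<close> by (intro Min_in) auto
  have b': "a < b'" "poly p b' = 0" using b'B by (auto simp: B_def)
  have "b' \<le> b" unfolding b'_def using fin \<open>b \<in> B\<close> by simp
  have nor: "poly p x \<noteq> 0" if "a < x" "x < b'" for x
    using that Min_le[OF fin, of x] by (auto simp: b'_def B_def)
  obtain m q where q: "p = [:-a,1:] ^ Suc m * q" "poly q a \<noteq> 0"
    using poly_split_root[OF \<open>p \<noteq> 0\<close> roots(1)] .
  have "q \<noteq> 0" using q(2) by auto
  have "poly q b' = 0" using b' by (simp add: q(1))
  then obtain n g where g: "q = [:-b',1:] ^ Suc n * g" "poly g b' \<noteq> 0"
    using poly_split_root[OF \<open>q \<noteq> 0\<close>] by metis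
  have peq: "p = [:-a,1:] ^ Suc m * ([:-b',1:] ^ Suc n * g)" unfolding q(1) g(1) ..
  have ga: "poly g a \<noteq> 0" using q(2) unfolding g(1) by auto
  have gb: "poly g b' \<noteq> 0" by (rule g)
  have same: "poly g a * poly g b' > 0"
  proof (rule ccontr)
    assume "\<not> ?thesis"
    then have "poly g a * poly g b' < 0" using ga gb by (simp add: not_less le_less)
    from poly_ivt[OF b'(1) this] obtain x where "a < x" "x < b'" "poly g x = 0" by blast
    then show False using nor[of x] by (simp add: peq)
  qed
  define g1 where "g1 = smult (of_nat (Suc m)) ([:-b',1:] * g) + smult (of_nat (Suc n)) ([:-a,1:] * g)
      + [:-a,1:] * [:-b',1:] * pderiv g"
  have der: "pderiv p = [:-a,1:] ^ m * [:-b',1:] ^ n * g1"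
    unfolding g1_def peq by (rule pderiv_two_factors) (simp_all add: pderiv_pCons)
  have "poly g1 a * poly g1 b' = - (of_nat (Suc m) * of_nat (Suc n) * (b' - a)\<^sup>2 * (poly g a * poly g b'))"
  proof -
    have 1: "poly g1 a = of_nat (Suc m) * (a - b') * poly g a" by (simp add: g1_def algebra_simps del: of_nat_Suc)
    have 2: "poly g1 b' = of_nat (Suc n) * (b' - a) * poly g b'" by (simp add: g1_def algebra_simps del: of_nat_Suc)
    show ?thesis unfolding 1 2 power2_eq_square by (simp only: minus_mult_left [symmetric] minus_mult_right [symmetric] ac_simps flip: minus_diff_eq[of b' a])
  qed
  also have "\<dots> < 0"
  proof -
    have "0 < of_nat (Suc m) * of_nat (Suc n) * (b' - a)\<^sup>2 * (poly g a * poly g b')"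
      by (intro mult_pos_pos[OF _ same] mult_pos_pos) (use b' in \<open>auto simp del: of_nat_Suc\<close>)
    then show ?thesis by simp
  qed
  finally obtain c where "a < c" "c < b'" "poly g1 c = 0" using poly_ivt[OF b'(1)] by blast
  then show ?thesis using that[of c] \<open>b' \<le> b\<close> by (auto simp: der)
qed

lemma poly_mean_value:
  fixes p :: "'a::real_closed_field poly"
  assumes ab: "a < b"
  obtains c where "a < c" "c < b" "poly p b - poly p a = (b - a) * poly (pderiv p) c"
proof -
  define s where "s = (poly p b - poly p a) / (b - a)"
  \<comment> \<open>\<open>q\<close> is the difference of \<open>p\<close> and the chord through the two points.\<close>
  define q where "q = p - [:poly p a - s * a, s:]"
  have s: "poly p b - poly p a = (b - a) * s" using ab by (simp add: s_def)
  have q0: "poly q a = 0" "poly q b = 0" using s by (auto simp: q_def algebra_simps)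
  have dq: "pderiv q = pderiv p - [:s:]" by (simp add: q_def pderiv_diff pderiv_pCons)
  show ?thesis
  proof (cases "q = 0")
    case True
    then have "pderiv p = [:s:]" using dq by simp
    then show ?thesis using that[of "(a+b)/2"] ab s by (simp add: field_simps)
  next
    case False
    from poly_rolle[OF ab q0 False] obtain c where "a < c" "c < b" "poly (pderiv q) c = 0" by blast
    then show ?thesis using that[of c] s by (simp add: dq)
  qed
qed

lemma poly_increasing:
  fixes p :: "'a::real_closed_field poly"
  assumes "a < b" "\<And>c. a < c \<Longrightarrow> c < b \<Longrightarrow> 0 < poly (pderiv p) c"
  shows "poly p a < poly p b"
proof -
  obtain c where "a < c" "c < b" "poly p b - poly p a = (b - a) * poly (pderiv p) c"
    using poly_mean_value[OF assms(1)] .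
  moreover have "0 < (b - a) * poly (pderiv p) c"
    using assms \<open>a < c\<close> \<open>c < b\<close> by (intro mult_pos_pos) auto
  ultimately show ?thesis by simp
qed

lemma poly_tends_to_infinity:
  fixes p :: "'a::linordered_field poly"
  assumes "degree p > 0" "lead_coeff p > 0"
  shows "\<exists>N. \<forall>x\<ge>N. C \<le> poly p x"
  using assms
proof (induction p arbitrary: C)
  case 0
  then show ?case by simp
next
  case (pCons a p)
  show ?case
  proof (cases "degree p = 0")
    case True
    then obtain d where d: "p = [:d:]" by (meson degree_eq_zeroE)
    with pCons.prems have "d > 0" by (auto split: if_splits)
    have "C \<le> poly (pCons a p) x" if "x \<ge> (C - a) / d" for x
      using that \<open>d > 0\<close> by (simp add: d field_simps)
    then show ?thesis by blast
  next
    case False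
    then have "lead_coeff p > 0" using pCons.prems by (auto split: if_splits)
    with pCons.IH[of "\<bar>C - a\<bar>"] False obtain N where N: "\<forall>x\<ge>N. \<bar>C - a\<bar> \<le> poly p x" by auto
    have "C \<le> poly (pCons a p) x" if "x \<ge> max N 1" for x
    proof -
      have "\<bar>C - a\<bar> \<le> poly p x" using N that by auto
      also have "\<dots> \<le> x * poly p x" using that calculation
        by (intro mult_right_mono[of 1 x, simplified]) auto
      finally show ?thesis by (simp add: algebra_simps abs_le_iff)
    qed
    then show ?thesis by blast
  qed
qed

text \<open>
The values lie in \<^typ>\<open>int\<close>, unlike those of \<^const>\<open>sgn\<close>, because signs in different fields are compared.
\<close>

definition sg :: "'a::linordered_idom \<Rightarrow> int" where
  "sg x = (if 0 < x then 1 else if x < 0 then -1 else 0)"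

lemma sg_simps [simp]: "sg x = 1 \<longleftrightarrow> 0 < x" "sg x = -1 \<longleftrightarrow> x < 0" "sg x = 0 \<longleftrightarrow> x = 0" "sg 0 = 0" "sg 1 = 1"
  by (auto simp: sg_def)

lemma sg_eq_iff: "sg x = sg y \<longleftrightarrow> (0 < x \<longleftrightarrow> 0 < y) \<and> (x < 0 \<longleftrightarrow> y < 0)"
  by (auto simp: sg_def)

lemma sg_mult: "sg (x * y) = sg x * sg y"
  by (auto simp: sg_def mult_less_0_iff zero_less_mult_iff)

lemma sg_power: "sg (x ^ n) = sg x ^ n"
  by (induction n) (auto simp: sg_mult)

lemma sg_minus: "sg (- x) = - sg x"
  by (auto simp: sg_def)

section \<open>Signs of a polynomial on a cell\<close>

text \<open>
A finite set \<open>Z\<close> cuts the line into points and open intervals. The cell of \<open>x\<close> is the piece that contains \<open>x\<close>.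
\<close>

definition cell :: "'a::linordered_idom set \<Rightarrow> 'a \<Rightarrow> 'a set" where
  "cell Z x = {y. \<forall>z\<in>Z. sg (y - z) = sg (x - z)}"

lemma self_in_cell: "x \<in> cell Z x"
  by (simp add: cell_def)

lemma cell_iff: "y \<in> cell Z x \<longleftrightarrow> (\<forall>z\<in>Z. (z < y \<longleftrightarrow> z < x) \<and> (y < z \<longleftrightarrow> x < z))"
  by (simp add: cell_def sg_eq_iff)

lemma cell_convex:
  assumes "y \<in> cell Z x" "y' \<in> cell Z x" "y \<le> c" "c \<le> y'"
  shows "c \<in> cell Z x"
  unfolding cell_iff
proof
  fix z assume "z \<in> Z"
  then have 1: "(z < y \<longleftrightarrow> z < x) \<and> (y < z \<longleftrightarrow> x < z)" and 2: "(z < y' \<longleftrightarrow> z < x) \<and> (y' < z \<longleftrightarrow> x < z)"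
    using assms by (auto simp: cell_iff)
  show "(z < c \<longleftrightarrow> z < x) \<and> (c < z \<longleftrightarrow> x < z)"
    using 1 2 assms(3,4) by (meson order_less_le_trans order_le_less_trans)
qed

lemma cell_above:
  assumes "x \<notin> Z" "\<And>z'. z' \<in> Z \<Longrightarrow> z' < x \<Longrightarrow> z' \<le> z" "z < c" "c \<le> x"
  shows "c \<in> cell Z x"
  unfolding cell_iff
proof
  fix z' assume "z' \<in> Z"
  show "(z' < c \<longleftrightarrow> z' < x) \<and> (c < z' \<longleftrightarrow> x < z')"
  proof (cases "z' < x")
    case True
    then have "z' < c" using assms(2)[OF \<open>z' \<in> Z\<close>] assms(3) by simp
    then show ?thesis using True by auto
  next
    case False
    then have "x < z'" using assms(1) \<open>z' \<in> Z\<close> by (cases "x = z'") auto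
    then show ?thesis using assms(4) by auto
  qed
qed

lemma cell_unbounded_below:
  assumes "\<And>z. z \<in> Z \<Longrightarrow> x < z" "c \<le> x"
  shows "c \<in> cell Z x"
  unfolding cell_iff using assms by (meson order_le_less_trans order_less_asym)

lemma exists_max_below:
  assumes "finite Z" "z0 \<in> Z" "z0 < (x::'a::linorder)"
  obtains z where "z \<in> Z" "z < x" "\<And>z'. z' \<in> Z \<Longrightarrow> z' < x \<Longrightarrow> z' \<le> z"
proof
  let ?L = "{z\<in>Z. z < x}"
  have fin: "finite ?L" "?L \<noteq> {}" using assms by auto
  show "Max ?L \<in> Z" "Max ?L < x" using Max_in[OF fin] by auto
  show "z' \<le> Max ?L" if "z' \<in> Z" "z' < x" for z' using that fin by simp
qed

lemma cell_extends_left: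
  fixes x :: "'a::linordered_field"
  assumes "finite Z" "x \<notin> Z"
  obtains u where "u < x" "u \<in> cell Z x"
proof (cases "\<exists>z\<in>Z. z < x")
  case True
  then obtain z where z: "z \<in> Z" "z < x" "\<And>z'. z' \<in> Z \<Longrightarrow> z' < x \<Longrightarrow> z' \<le> z"
    using exists_max_below[OF \<open>finite Z\<close>] by metis
  show ?thesis
    by (rule that[of "(z + x) / 2"], use z in simp, rule cell_above[OF assms(2) z(3)]) (use z in auto)
next
  case False
  show ?thesis
    by (rule that[of "x - 1"], simp, rule cell_unbounded_below) (use False assms in \<open>auto simp: not_less le_less\<close>)
qed

lemma uminus_in_cell_iff: "- c \<in> cell Z x \<longleftrightarrow> c \<in> cell (uminus ` Z) (- x)"
proof -
  have "sg (- c - z) = - sg (c - - z)" "sg (x - z) = - sg (- x - - z)" for z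
    using sg_minus[of "c - - z"] sg_minus[of "- x - - z"] by simp_all
  then show ?thesis unfolding cell_def by simp
qed

lemma cell_extends_right:
  fixes x :: "'a::linordered_field"
  assumes "finite Z" "x \<notin> Z"
  obtains v where "x < v" "v \<in> cell Z x"
proof -
  have "finite (uminus ` Z)" "- x \<notin> uminus ` Z" using assms by auto
  then obtain u where u: "u < - x" "u \<in> cell (uminus ` Z) (- x)" by (rule cell_extends_left)
  have "x < - u" using u(1) by (simp add: less_minus_iff)
  moreover have "- u \<in> cell Z x" using u(2) by (simp only: uminus_in_cell_iff)
  ultimately show ?thesis by (rule that)
qed

lemma infinite_cell:
  fixes x :: "'a::linordered_field"
  assumes "finite Z" "x \<notin> Z"
  shows "infinite (cell Z x)"
proof -
  obtain u where "u < x" "u \<in> cell Z x" using cell_extends_left[OF assms] .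
  then have "{u..x} \<subseteq> cell Z x" using self_in_cell[of x Z] cell_convex[of u Z x x] by auto
  moreover have "infinite {u..x}" using \<open>u < x\<close> by (simp add: infinite_Icc)
  ultimately show ?thesis using finite_subset by blast
qed

lemma increasing_poly_unbounded_below:
  fixes p :: "'a::real_closed_field poly"
  assumes "\<And>c. c \<le> x \<Longrightarrow> 0 < poly (pderiv p) c"
  shows "\<exists>y\<le>x. poly p y < 0"
proof (rule ccontr)
  assume neg: "\<not> ?thesis"
  then have nonneg: "poly p y \<ge> 0" if "y \<le> x" for y using that neg by (meson not_le)
  define q where "q = pcompose p [:0,-1:]"
  have q: "poly q t = poly p (- t)" for t by (simp add: q_def poly_pcompose)
  have "degree p > 0" using assms[of x] by (cases "degree p = 0") (auto dest: pderiv_eq_0_iff[THEN iffD2])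
  then have dq: "degree q > 0" by (simp add: q_def degree_pcompose)
  then have "lead_coeff q \<noteq> 0" by auto
  then have "lead_coeff q > 0 \<or> lead_coeff (-q) > 0"
    by (auto simp: neq_iff simp del: leading_coeff_0_iff)
  then show False
  proof
    assume "lead_coeff q > 0"
    from poly_tends_to_infinity[OF dq this, of "poly p x + 1"]
    obtain N where N: "\<forall>t\<ge>N. poly p x + 1 \<le> poly q t" by blast
    define t where "t = max N (1 - x)"
    have "poly p (- t) < poly p x" by (rule poly_increasing) (auto intro!: assms simp: t_def max_def not_le)
    moreover have "poly p x + 1 \<le> poly p (- t)" using N by (simp add: t_def flip: q)
    ultimately have "poly p x + 1 < poly p x" by (rule le_less_trans[rotated])
    then show False by simp
  next
    assume "lead_coeff (-q) > 0"
    from poly_tends_to_infinity[OF _ this, of 1] dq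
    obtain N where N: "\<forall>t\<ge>N. 1 \<le> poly (-q) t" by auto
    define t where "t = max N (- x)"
    have "1 \<le> poly (-q) t" using N by (simp add: t_def)
    moreover have "poly p (-t) \<ge> 0" by (rule nonneg) (simp add: t_def)
    ultimately have "(1::'a) \<le> 0" by (simp add: q)
    then show False by simp
  qed
qed

lemma increasing_on_cell:
  fixes p :: "'a::real_closed_field poly"
  assumes "\<And>c. c \<in> cell Z x \<Longrightarrow> 0 < poly (pderiv p) c"
    and "a \<in> cell Z x" "b \<in> cell Z x" "a < b"
  shows "poly p a < poly p b"
proof (rule poly_increasing[OF \<open>a < b\<close>])
  fix c assume "a < c" "c < b"
  then show "0 < poly (pderiv p) c"
    using assms(1) cell_convex[OF assms(2,3), of c] by simp
qed

text \<open>
On an open cell where the polynomial increases, its infimum is approached at the lower end. So negative values occur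
if and only if the value at the left neighbour in \<open>Z\<close> is negative or there is no left neighbour, in which case
the polynomial is unbounded below. This makes the sign pattern on a cell a matter of the signs at its end points.
\<close>

lemma neg_on_cell_iff:
  fixes p :: "'a::real_closed_field poly"
  assumes "finite Z" "x \<notin> Z" and inc: "\<And>c. c \<in> cell Z x \<Longrightarrow> 0 < poly (pderiv p) c"
  shows "(\<exists>c\<in>cell Z x. poly p c < 0) \<longleftrightarrow>
    (\<forall>z\<in>Z. z < x \<longrightarrow> (\<forall>z'\<in>Z. z' < x \<longrightarrow> z' \<le> z) \<longrightarrow> poly p z < 0)"
proof (cases "\<exists>z\<in>Z. z < x")
  case True
  then obtain z where z: "z \<in> Z" "z < x" "\<And>z'. z' \<in> Z \<Longrightarrow> z' < x \<Longrightarrow> z' \<le> z"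
    using exists_max_below[OF \<open>finite Z\<close>] by metis
  have above: "c \<in> cell Z x" if "z < c" "c \<le> x" for c by (rule cell_above[OF assms(2) z(3) that])
  have "(\<exists>c\<in>cell Z x. poly p c < 0) \<longleftrightarrow> poly p z < 0"
  proof
    assume "\<exists>c\<in>cell Z x. poly p c < 0"
    then obtain c where c: "c \<in> cell Z x" "poly p c < 0" by blast
    then have "z < c" using z by (auto simp: cell_iff)
    have "poly p z < poly p c"
    proof (rule poly_increasing[OF \<open>z < c\<close>])
      fix t assume t: "z < t" "t < c"
      show "0 < poly (pderiv p) t"
        by (rule inc, cases "t \<le> x", rule above)
          (use t c self_in_cell[of x Z] cell_convex[of x Z x c t] in auto)
    qed
    with c show "poly p z < 0" by simp
  next
    assume pz: "poly p z < 0"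
    show "\<exists>c\<in>cell Z x. poly p c < 0"
    proof (cases "poly p x < 0")
      case True
      then show ?thesis using self_in_cell by blast
    next
      case False
      have "\<exists>r. z < r \<and> r \<le> x \<and> poly p r = 0"
      proof (cases "poly p x = 0")
        case True then show ?thesis using z by auto
      next
        case F2: False
        then have "0 < poly p x" using False by simp
        from poly_ivt_up[OF z(2) pz this] show ?thesis by (metis less_imp_le)
      qed
      then obtain r where r: "z < r" "r \<le> x" "poly p r = 0" by blast
      have "poly p ((z + r) / 2) < poly p r"
        by (rule increasing_on_cell[OF inc]) (use r in \<open>auto intro!: above simp: field_simps\<close>)
      moreover have "(z + r) / 2 \<in> cell Z x" using r by (intro above) (auto simp: field_simps)
      ultimately show ?thesis using r by auto
    qed
  qed
  moreover have "(\<forall>w\<in>Z. w < x \<longrightarrow> (\<forall>z'\<in>Z. z' < x \<longrightarrow> z' \<le> w) \<longrightarrow> poly p w < 0) \<longleftrightarrow> poly p z < 0"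
    using z by (metis order_antisym)
  ultimately show ?thesis by simp
next
  case False
  have *: "\<And>z. z \<in> Z \<Longrightarrow> x < z" using False assms by (metis not_less_iff_gr_or_eq)
  obtain y where "y \<le> x" "poly p y < 0"
    using increasing_poly_unbounded_below[of x p] inc[OF cell_unbounded_below[OF *]] by blast
  then show ?thesis using cell_unbounded_below[OF *] False by blast
qed

text \<open>
This is the reflection of the preceding lemma under \<open>x \<mapsto> - x\<close>.
\<close>

lemma pos_on_cell_iff:
  fixes p :: "'a::real_closed_field poly"
  assumes "finite Z" "x \<notin> Z" and inc: "\<And>c. c \<in> cell Z x \<Longrightarrow> 0 < poly (pderiv p) c"
  shows "(\<exists>c\<in>cell Z x. 0 < poly p c) \<longleftrightarrow>
    (\<forall>z\<in>Z. x < z \<longrightarrow> (\<forall>z'\<in>Z. x < z' \<longrightarrow> z \<le> z') \<longrightarrow> 0 < poly p z)"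
proof -
  define q where "q = - pcompose p [:0,-1:]"
  have q: "poly q t = - poly p (- t)" for t by (simp add: q_def poly_pcompose)
  have dq: "poly (pderiv q) t = poly (pderiv p) (- t)" for t
    by (simp add: q_def pderiv_minus pderiv_pcompose pderiv_pCons poly_pcompose)
  have "(\<exists>c\<in>cell (uminus ` Z) (- x). poly q c < 0) \<longleftrightarrow>
    (\<forall>z\<in>uminus ` Z. z < - x \<longrightarrow> (\<forall>z'\<in>uminus ` Z. z' < - x \<longrightarrow> z' \<le> z) \<longrightarrow> poly q z < 0)"
  proof (rule neg_on_cell_iff)
    show "finite (uminus ` Z)" "- x \<notin> uminus ` Z" using assms by auto
    show "0 < poly (pderiv q) c" if "c \<in> cell (uminus ` Z) (- x)" for c
      unfolding dq using that by (intro inc) (simp only: uminus_in_cell_iff)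
  qed
  moreover have "(\<exists>c\<in>cell (uminus ` Z) (- x). poly q c < 0) \<longleftrightarrow> (\<exists>c\<in>cell Z x. 0 < poly p c)"
  proof
    assume "\<exists>c\<in>cell (uminus ` Z) (- x). poly q c < 0"
    then obtain c where "- c \<in> cell Z x" "poly q c < 0" unfolding uminus_in_cell_iff by blast
    then show "\<exists>c\<in>cell Z x. 0 < poly p c" by (auto simp: q)
  next
    assume "\<exists>c\<in>cell Z x. 0 < poly p c"
    then obtain c where c: "- (- c) \<in> cell Z x" "0 < poly p c" by auto
    have "- c \<in> cell (uminus ` Z) (- x)" using c(1) by (rule uminus_in_cell_iff[THEN iffD1])
    then show "\<exists>c\<in>cell (uminus ` Z) (- x). poly q c < 0"
      using c(2) by (intro bexI[of _ "- c"]) (auto simp: q)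
  qed
  ultimately show ?thesis by (simp add: q)
qed

section \<open>Matching the roots over two real closed fields\<close>

text \<open>
A finite set \<open>\<Theta>\<close> of pairs is meant as a partial order isomorphism between two fields; \<open>x\<close> and \<open>y\<close> are matched
if they lie in corresponding cells.
\<close>

definition matched :: "('a::linordered_idom \<times> 'b::linordered_idom) set \<Rightarrow> 'a \<Rightarrow> 'b \<Rightarrow> bool" where
  "matched \<Theta> x y \<longleftrightarrow> (\<forall>(z, w)\<in>\<Theta>. sg (x - z) = sg (y - w))"

definition order_matching :: "('a::linordered_idom \<times> 'b::linordered_idom) set \<Rightarrow> bool" where
  "order_matching \<Theta> \<longleftrightarrow> finite \<Theta> \<and> (\<forall>(z, w)\<in>\<Theta>. matched \<Theta> z w)"

lemma matched_iff: "matched \<Theta> x y \<longleftrightarrow> (\<forall>z w. (z, w) \<in> \<Theta> \<longrightarrow> sg (x - z) = sg (y - w))"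
  by (auto simp: matched_def)

lemma matched_converse: "matched (\<Theta>\<inverse>) y x \<longleftrightarrow> matched \<Theta> x y"
  unfolding matched_iff converse_iff by metis

lemma matched_left_iff: "matched \<Theta> x y \<Longrightarrow> matched \<Theta> x' y \<longleftrightarrow> x' \<in> cell (fst ` \<Theta>) x"
  by (fastforce simp: matched_def cell_def)

lemma matched_right_iff: "matched \<Theta> x y \<Longrightarrow> matched \<Theta> x y' \<longleftrightarrow> y' \<in> cell (snd ` \<Theta>) y"
  by (fastforce simp: matched_def cell_def)

lemma matched_both_iff:
  assumes "matched \<Theta> x y" "x' \<in> cell (fst ` \<Theta>) x" "y' \<in> cell (snd ` \<Theta>) y"
  shows "matched \<Theta> x' y'"
  using assms matched_left_iff matched_right_iff by blast

lemma matched_point_left: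
  assumes "matched \<Theta> x y" "(x, w) \<in> \<Theta>" shows "y = w"
proof -
  have "sg (x - x) = sg (y - w)" using assms unfolding matched_def by blast
  then show ?thesis by (simp del: sg_simps(3) add: sg_def split: if_splits)
qed

lemma matched_point_right:
  assumes "matched \<Theta> x y" "(z, y) \<in> \<Theta>" shows "x = z"
  using matched_point_left[of "\<Theta>\<inverse>" y x z] assms by (simp add: matched_converse)

lemma between_finite_sets:
  fixes A B :: "'a::linordered_field set"
  assumes "finite A" "finite B" "\<And>a b. a \<in> A \<Longrightarrow> b \<in> B \<Longrightarrow> a < b"
  shows "\<exists>x. (\<forall>a\<in>A. a < x) \<and> (\<forall>b\<in>B. x < b)"
proof -
  consider "A = {}" "B = {}" | "A = {}" "B \<noteq> {}" | "A \<noteq> {}" "B = {}" | "A \<noteq> {}" "B \<noteq> {}" by blast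
  then show ?thesis
  proof cases
    case 1 then show ?thesis by simp
  next
    case 2
    have "Min B - 1 < b" if "b \<in> B" for b
      using Min_le[OF assms(2) that] by (rule less_le_trans[rotated]) simp
    then show ?thesis using 2 by blast
  next
    case 3
    have "a < Max A + 1" if "a \<in> A" for a
      using Max_ge[OF assms(1) that] by (rule le_less_trans) simp
    then show ?thesis using 3 by blast
  next
    case 4
    then have "Max A < Min B" using assms by simp
    then obtain x where x: "Max A < x" "x < Min B" using dense by blast
    then show ?thesis using 4 assms(1,2) by (intro exI[of _ x]) auto
  qed
qed

text \<open>
This is the back-and-forth step: ordered fields are dense and unbounded, so no corresponding cell is empty.
\<close>

lemma partner_left:
  fixes \<Theta> :: "('a::linordered_field \<times> 'b::linordered_idom) set"
  assumes "order_matching \<Theta>"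
  shows "\<exists>x. matched \<Theta> x y"
proof (cases "y \<in> snd ` \<Theta>")
  case True
  then obtain z where "(z, y) \<in> \<Theta>" by auto
  then show ?thesis using assms unfolding order_matching_def by blast
next
  case False
  let ?A = "fst ` {(z, w)\<in>\<Theta>. w < y}" and ?B = "fst ` {(z, w)\<in>\<Theta>. y < w}"
  have "\<exists>x. (\<forall>a\<in>?A. a < x) \<and> (\<forall>b\<in>?B. x < b)"
  proof (rule between_finite_sets)
    have "finite \<Theta>" using assms by (simp add: order_matching_def)
    then show "finite ?A" "finite ?B" by (auto intro: finite_subset[of _ \<Theta>])
    fix a b assume "a \<in> ?A" "b \<in> ?B"
    then obtain w w' where w: "(a, w) \<in> \<Theta>" "w < y" "(b, w') \<in> \<Theta>" "y < w'" by auto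
    then have "sg (a - b) = sg (w - w')" using assms by (fastforce simp: order_matching_def matched_def)
    then show "a < b" using w by (auto simp: sg_eq_iff)
  qed
  then obtain x where x: "\<forall>a\<in>?A. a < x" "\<forall>b\<in>?B. x < b" by blast
  have "sg (x - z) = sg (y - w)" if "(z, w) \<in> \<Theta>" for z w
  proof (cases "w < y")
    case True
    then have "z < x" using x(1) that by force
    then show ?thesis using True by (simp add: sg_def)
  next
    case F: False
    then have "y < w" using False that by (metis image_eqI linorder_neqE_linordered_idom snd_conv)
    then have "x < z" using x(2) that by force
    then show ?thesis using \<open>y < w\<close> by (simp add: sg_def)
  qed
  then show ?thesis unfolding matched_def by blast
qed

text \<open>
An open cell is infinite, so a polynomial that vanishes on it is zero.
\<close>

lemma pderiv_nonzero_on_cell: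
  fixes p :: "'a::linordered_field poly"
  assumes "finite Z" "x \<notin> Z" "pderiv p \<noteq> 0"
    and const: "\<And>c. c \<in> cell Z x \<Longrightarrow> sg (poly (pderiv p) c) = sg (poly (pderiv p) x)"
  shows "sg (poly (pderiv p) x) \<noteq> 0"
proof
  assume "sg (poly (pderiv p) x) = 0"
  then have "cell Z x \<subseteq> {c. poly (pderiv p) c = 0}" using const by fastforce
  then have "finite (cell Z x)" using poly_roots_finite[OF assms(3)] finite_subset by blast
  then show False using infinite_cell[OF assms(1,2)] by blast
qed

lemma sg_on_cell_from_root:
  fixes p :: "'a::real_closed_field poly"
  assumes "s \<noteq> 0"
    and const: "\<And>c. c \<in> cell Z x \<Longrightarrow> sg (poly (pderiv p) c) = s"
    and "r \<in> cell Z x" "poly p r = 0" "c \<in> cell Z x"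
  shows "sg (poly p c) = s * sg (c - r)"
proof -
  have pos: "sg (poly q c) = sg (c - r)"
    if q: "\<And>c. c \<in> cell Z x \<Longrightarrow> 0 < poly (pderiv q) c" "poly q r = 0" for q
    using increasing_on_cell[OF q(1), of Z x r c] increasing_on_cell[OF q(1), of Z x c r] assms(3,5) q(2)
    by (cases r c rule: linorder_cases) (auto simp: sg_def)
  have "s = 1 \<or> s = -1" using const[OF assms(3)] \<open>s \<noteq> 0\<close> by (auto simp: sg_def split: if_splits)
  then show ?thesis
  proof
    assume s: "s = 1"
    show ?thesis using pos[of p] const s assms by simp
  next
    assume s: "s = -1"
    have "sg (poly (-p) c) = sg (c - r)"
      by (rule pos) (use const s assms in \<open>auto simp: pderiv_minus\<close>)
    then show ?thesis using s by (simp add: sg_minus)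
  qed
qed

text \<open>
The conditions at the ends of a cell that decide which signs occur on it are the same on both sides of a matching.
\<close>

lemma matched_cell_ends:
  assumes om: "order_matching \<Theta>" and xy: "matched \<Theta> x y"
    and PQ: "\<And>q. q \<in> \<Theta> \<Longrightarrow> P (fst q) \<longleftrightarrow> Q (snd q)"
  shows lower_end_transfer: "(\<forall>z\<in>fst ` \<Theta>. z < x \<longrightarrow> (\<forall>z'\<in>fst ` \<Theta>. z' < x \<longrightarrow> z' \<le> z) \<longrightarrow> P z) \<longleftrightarrow>
    (\<forall>z\<in>snd ` \<Theta>. z < y \<longrightarrow> (\<forall>z'\<in>snd ` \<Theta>. z' < y \<longrightarrow> z' \<le> z) \<longrightarrow> Q z)"
  and upper_end_transfer: "(\<forall>z\<in>fst ` \<Theta>. x < z \<longrightarrow> (\<forall>z'\<in>fst ` \<Theta>. x < z' \<longrightarrow> z \<le> z') \<longrightarrow> P z) \<longleftrightarrow>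
    (\<forall>z\<in>snd ` \<Theta>. y < z \<longrightarrow> (\<forall>z'\<in>snd ` \<Theta>. y < z' \<longrightarrow> z \<le> z') \<longrightarrow> Q z)"
proof -
  have 1: "fst q < x \<longleftrightarrow> snd q < y" and 2: "x < fst q \<longleftrightarrow> y < snd q" if "q \<in> \<Theta>" for q
  proof -
    have "sg (x - fst q) = sg (y - snd q)" using xy that by (auto simp: matched_def)
    then show "fst q < x \<longleftrightarrow> snd q < y" "x < fst q \<longleftrightarrow> y < snd q" by (simp_all add: sg_eq_iff)
  qed
  have 3: "fst q \<le> fst q' \<longleftrightarrow> snd q \<le> snd q'" if "q \<in> \<Theta>" "q' \<in> \<Theta>" for q q'
  proof -
    have "sg (fst q - fst q') = sg (snd q - snd q')"
      using om that by (fastforce simp: order_matching_def matched_def)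
    then show ?thesis by (auto simp: sg_eq_iff simp flip: not_less)
  qed
  show "(\<forall>z\<in>fst ` \<Theta>. z < x \<longrightarrow> (\<forall>z'\<in>fst ` \<Theta>. z' < x \<longrightarrow> z' \<le> z) \<longrightarrow> P z) \<longleftrightarrow>
    (\<forall>z\<in>snd ` \<Theta>. z < y \<longrightarrow> (\<forall>z'\<in>snd ` \<Theta>. z' < y \<longrightarrow> z' \<le> z) \<longrightarrow> Q z)"
    by (simp add: 1 3 PQ cong: ball_cong)
  show "(\<forall>z\<in>fst ` \<Theta>. x < z \<longrightarrow> (\<forall>z'\<in>fst ` \<Theta>. x < z' \<longrightarrow> z \<le> z') \<longrightarrow> P z) \<longleftrightarrow>
    (\<forall>z\<in>snd ` \<Theta>. y < z \<longrightarrow> (\<forall>z'\<in>snd ` \<Theta>. y < z' \<longrightarrow> z \<le> z') \<longrightarrow> Q z)"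
    by (simp add: 2 3 PQ cong: ball_cong)
qed

context
  fixes \<Theta> :: "('a::real_closed_field \<times> 'b::real_closed_field) set"
    and p1 :: "'a poly" and p2 :: "'b poly"
  assumes om: "order_matching \<Theta>"
    and nonconst: "pderiv p1 \<noteq> 0" "pderiv p2 \<noteq> 0"
    and deriv_agree: "\<And>x y. matched \<Theta> x y \<Longrightarrow> sg (poly (pderiv p1) x) = sg (poly (pderiv p2) y)"
    and points_agree: "\<And>z w. (z, w) \<in> \<Theta> \<Longrightarrow> sg (poly p1 z) = sg (poly p2 w)"
begin

lemma open_cell_slope:
  assumes xy: "matched \<Theta> x y" and open_cell: "x \<notin> fst ` \<Theta>"
  obtains s where "s = 1 \<or> s = -1"
    "\<And>c. c \<in> cell (fst ` \<Theta>) x \<Longrightarrow> sg (poly (pderiv p1) c) = s"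
    "\<And>c. c \<in> cell (snd ` \<Theta>) y \<Longrightarrow> sg (poly (pderiv p2) c) = s"
proof -
  define s where "s = sg (poly (pderiv p1) x)"
  have 1: "sg (poly (pderiv p1) c) = s" if "c \<in> cell (fst ` \<Theta>) x" for c
    using deriv_agree[OF xy] deriv_agree[of c y] matched_left_iff[OF xy, of c] that by (simp add: s_def)
  have 2: "sg (poly (pderiv p2) c) = s" if "c \<in> cell (snd ` \<Theta>) y" for c
    using deriv_agree[of x c] matched_right_iff[OF xy, of c] that by (simp add: s_def)
  have "finite (fst ` \<Theta>)" using om by (simp add: order_matching_def)
  then have "s \<noteq> 0" unfolding s_def
    by (rule pderiv_nonzero_on_cell[OF _ open_cell nonconst(1)]) (simp only: 1 self_in_cell)
  then have "s = 1 \<or> s = -1" by (auto simp: s_def sg_def)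
  from that[OF this 1 2] show ?thesis .
qed

text \<open>
On corresponding open cells \<open>p1\<close> and \<open>p2\<close> are strictly monotone in the same direction. Which signs they take there is
decided by their signs at the ends of the cells, where they agree.
\<close>

lemma open_cell_has_neg_iff:
  assumes xy: "matched \<Theta> x y" and open_cell: "x \<notin> fst ` \<Theta>"
  shows "(\<exists>c\<in>cell (fst ` \<Theta>) x. poly p1 c < 0) \<longleftrightarrow> (\<exists>c\<in>cell (snd ` \<Theta>) y. poly p2 c < 0)"
proof -
  have fin: "finite (fst ` \<Theta>)" "finite (snd ` \<Theta>)" using om by (auto simp: order_matching_def)
  have yopen: "y \<notin> snd ` \<Theta>"
    using open_cell matched_point_right[OF xy] by (auto simp: image_iff)
  have agree: "sg (poly p1 (fst q)) = sg (poly p2 (snd q))" if "q \<in> \<Theta>" for q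
    using points_agree[of "fst q" "snd q"] that by simp
  obtain s where s: "s = 1 \<or> s = -1"
    and s1: "\<And>c. c \<in> cell (fst ` \<Theta>) x \<Longrightarrow> sg (poly (pderiv p1) c) = s"
    and s2: "\<And>c. c \<in> cell (snd ` \<Theta>) y \<Longrightarrow> sg (poly (pderiv p2) c) = s"
    using open_cell_slope[OF xy open_cell] by blast
  from s show ?thesis
  proof
    assume "s = 1"
    have 1: "(\<exists>c\<in>cell (fst ` \<Theta>) x. poly p1 c < 0) \<longleftrightarrow>
      (\<forall>z\<in>fst ` \<Theta>. z < x \<longrightarrow> (\<forall>z'\<in>fst ` \<Theta>. z' < x \<longrightarrow> z' \<le> z) \<longrightarrow> poly p1 z < 0)"
      by (rule neg_on_cell_iff[OF fin(1) open_cell]) (use s1 \<open>s = 1\<close> in auto)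
    have 2: "(\<exists>c\<in>cell (snd ` \<Theta>) y. poly p2 c < 0) \<longleftrightarrow>
      (\<forall>z\<in>snd ` \<Theta>. z < y \<longrightarrow> (\<forall>z'\<in>snd ` \<Theta>. z' < y \<longrightarrow> z' \<le> z) \<longrightarrow> poly p2 z < 0)"
      by (rule neg_on_cell_iff[OF fin(2) yopen]) (use s2 \<open>s = 1\<close> in auto)
    show ?thesis unfolding 1 2
      by (rule lower_end_transfer[OF om xy]) (use agree in \<open>auto simp: sg_eq_iff\<close>)
  next
    assume "s = -1"
    have 1: "(\<exists>c\<in>cell (fst ` \<Theta>) x. 0 < poly (-p1) c) \<longleftrightarrow>
      (\<forall>z\<in>fst ` \<Theta>. x < z \<longrightarrow> (\<forall>z'\<in>fst ` \<Theta>. x < z' \<longrightarrow> z \<le> z') \<longrightarrow> 0 < poly (-p1) z)"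
      by (rule pos_on_cell_iff[OF fin(1) open_cell]) (use s1 \<open>s = -1\<close> in \<open>auto simp: pderiv_minus\<close>)
    have 2: "(\<exists>c\<in>cell (snd ` \<Theta>) y. 0 < poly (-p2) c) \<longleftrightarrow>
      (\<forall>z\<in>snd ` \<Theta>. y < z \<longrightarrow> (\<forall>z'\<in>snd ` \<Theta>. y < z' \<longrightarrow> z \<le> z') \<longrightarrow> 0 < poly (-p2) z)"
      by (rule pos_on_cell_iff[OF fin(2) yopen]) (use s2 \<open>s = -1\<close> in \<open>auto simp: pderiv_minus\<close>)
    have "(\<exists>c\<in>cell (fst ` \<Theta>) x. 0 < poly (-p1) c) \<longleftrightarrow> (\<exists>c\<in>cell (snd ` \<Theta>) y. 0 < poly (-p2) c)"
      unfolding 1 2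
      by (rule upper_end_transfer[OF om xy]) (use agree in \<open>auto simp: sg_eq_iff\<close>)
    then show ?thesis by simp
  qed
qed

end

lemma root_between_signs_in_cell:
  fixes p :: "'a::real_closed_field poly"
  assumes "c \<in> cell Z x" "poly p c < 0" "d \<in> cell Z x" "0 < poly p d"
  shows "\<exists>r\<in>cell Z x. poly p r = 0"
proof -
  have "c \<noteq> d" using assms by auto
  then consider "c < d" | "d < c" by fastforce
  then show ?thesis
  proof cases
    case 1
    from poly_ivt_up[OF this assms(2,4)] obtain r where "c < r" "r < d" "poly p r = 0" .
    then show ?thesis using cell_convex[OF assms(1,3), of r] by auto
  next
    case 2
    have "poly p d * poly p c < 0" using assms by (simp add: mult_pos_neg)
    from poly_ivt[OF 2 this] obtain r where "d < r" "r < c" "poly p r = 0" .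
    then show ?thesis using cell_convex[OF assms(3,1), of r] by auto
  qed
qed

lemma signs_around_root_in_cell:
  fixes p :: "'a::real_closed_field poly"
  assumes "finite Z" "x \<notin> Z" "s = 1 \<or> s = -1"
    and slope: "\<And>c. c \<in> cell Z x \<Longrightarrow> sg (poly (pderiv p) c) = s"
    and "poly p x = 0"
  shows "(\<exists>c\<in>cell Z x. poly p c < 0) \<and> (\<exists>c\<in>cell Z x. 0 < poly p c)"
proof -
  have s0: "s \<noteq> 0" using assms by auto
  obtain u where u: "u < x" "u \<in> cell Z x" using cell_extends_left[OF assms(1,2)] .
  have eps: "sg (poly p c) = s * sg (c - x)" if "c \<in> cell Z x" for c
    by (rule sg_on_cell_from_root[OF s0 slope self_in_cell \<open>poly p x = 0\<close> that])
  obtain v where v: "x < v" "v \<in> cell Z x" using cell_extends_right[OF assms(1,2)] .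
  have "sg (poly p u) = - s" "sg (poly p v) = s"
    using eps[OF u(2)] eps[OF v(2)] u v by (auto simp: sg_def)
  then have "poly p u < 0 \<and> 0 < poly p v \<or> 0 < poly p u \<and> poly p v < 0"
    using assms(3) by (metis add.inverse_inverse sg_simps(1,2))
  then show ?thesis using u v by blast
qed

text \<open>
If \<open>a\<close> and \<open>a'\<close> lie in different cells, their order is already visible from the cells.
\<close>

lemma sg_diff_separated:
  assumes "sg (a - z) = sg (b - w)" "sg (a' - z) = sg (b' - w)" "sg (a - z) \<noteq> sg (a' - z)"
  shows "sg (a - a') = sg (b - b')"
proof -
  have *: "sg (c - c') = (if sg (c - v) < sg (c' - v) then -1 else 1)"
    if "sg (c - v) \<noteq> sg (c' - v)" for c c' v :: "'x::linordered_idom"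
    using that unfolding sg_def by (auto split: if_splits)
  have 2: "sg (b - w) \<noteq> sg (b' - w)" using assms by simp
  show ?thesis unfolding *[OF assms(3)] *[OF 2] assms(1,2) ..
qed

context
  fixes \<Theta> :: "('a::real_closed_field \<times> 'b::real_closed_field) set"
    and p1 :: "'a poly" and p2 :: "'b poly"
  assumes om: "order_matching \<Theta>"
    and nonconst: "pderiv p1 \<noteq> 0" "pderiv p2 \<noteq> 0"
    and deriv_agree: "\<And>x y. matched \<Theta> x y \<Longrightarrow> sg (poly (pderiv p1) x) = sg (poly (pderiv p2) y)"
    and points_agree: "\<And>z w. (z, w) \<in> \<Theta> \<Longrightarrow> sg (poly p1 z) = sg (poly p2 w)"
begin

lemma open_cell_has_pos_iff:
  assumes xy: "matched \<Theta> x y" and open_cell: "x \<notin> fst ` \<Theta>"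
  shows "(\<exists>c\<in>cell (fst ` \<Theta>) x. 0 < poly p1 c) \<longleftrightarrow> (\<exists>c\<in>cell (snd ` \<Theta>) y. 0 < poly p2 c)"
proof -
  have "(\<exists>c\<in>cell (fst ` \<Theta>) x. poly (-p1) c < 0) \<longleftrightarrow> (\<exists>c\<in>cell (snd ` \<Theta>) y. poly (-p2) c < 0)"
    by (rule open_cell_has_neg_iff[OF om _ _ _ _ xy open_cell])
      (use nonconst deriv_agree points_agree in \<open>auto simp: pderiv_minus sg_minus\<close>)
  then show ?thesis by simp
qed

text \<open>
A polynomial has a root in an open cell if and only if it takes both signs there, and then the root is unique. So the roots of
\<open>p1\<close> and \<open>p2\<close> correspond, and pairing them refines the matching to one on which the signs of
\<open>p1\<close> and \<open>p2\<close> agree everywhere.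
\<close>

lemma matching_extended_by_roots:
  defines "\<Theta>' \<equiv> \<Theta> \<union> {(r, t). poly p1 r = 0 \<and> poly p2 t = 0 \<and> matched \<Theta> r t}"
  shows "order_matching \<Theta>'" and "\<And>x y. matched \<Theta>' x y \<Longrightarrow> sg (poly p1 x) = sg (poly p2 y)"
proof -
  have fin: "finite (fst ` \<Theta>)" "finite (snd ` \<Theta>)" "finite \<Theta>" using om by (auto simp: order_matching_def)
  have old: "matched \<Theta> r t" if "(r, t) \<in> \<Theta>'" for r t
    using that om by (auto simp: \<Theta>'_def order_matching_def)
  have new: "sg (r - r') = sg (t - t')"
    if rt: "(r, t) \<in> \<Theta>'" "(r, t) \<notin> \<Theta>" and rt': "(r', t') \<in> \<Theta>'" "(r', t') \<notin> \<Theta>" for r t r' t'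
  proof (cases "r' \<in> cell (fst ` \<Theta>) r")
    case True
    have m: "matched \<Theta> r t" "matched \<Theta> r' t'" using old rt rt' by blast+
    have "matched \<Theta> r' t" using matched_left_iff[OF m(1)] True by blast
    then have True': "t' \<in> cell (snd ` \<Theta>) t" using matched_right_iff m(2) by blast
    have "r \<notin> fst ` \<Theta>" using rt(2) matched_point_left[OF m(1)] by auto
    then obtain s where s: "s = 1 \<or> s = -1"
      and s1: "\<And>c. c \<in> cell (fst ` \<Theta>) r \<Longrightarrow> sg (poly (pderiv p1) c) = s"
      and s2: "\<And>c. c \<in> cell (snd ` \<Theta>) t \<Longrightarrow> sg (poly (pderiv p2) c) = s"
      using open_cell_slope[OF om nonconst deriv_agree points_agree m(1)] by blast
    have s0: "s \<noteq> 0" using s by auto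
    have roots: "poly p1 r = 0" "poly p2 t = 0" "poly p1 r' = 0" "poly p2 t' = 0"
      using rt rt' by (auto simp: \<Theta>'_def)
    have "sg (poly p1 r') = s * sg (r' - r)"
      by (rule sg_on_cell_from_root[OF s0 s1 self_in_cell roots(1) True])
    then have "r' = r" using s0 roots by simp
    have "sg (poly p2 t') = s * sg (t' - t)"
      by (rule sg_on_cell_from_root[OF s0 s2 self_in_cell roots(2) True'])
    then have "t' = t" using s0 roots by simp
    show ?thesis using \<open>r' = r\<close> \<open>t' = t\<close> by simp
  next
    case False
    then obtain z w where zw: "(z, w) \<in> \<Theta>" "sg (r' - z) \<noteq> sg (r - z)" by (auto simp: cell_def)
    have "sg (r - z) = sg (t - w)" "sg (r' - z) = sg (t' - w)"
      using old[OF rt(1)] old[OF rt'(1)] zw(1) unfolding matched_iff by blast+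
    then show ?thesis by (rule sg_diff_separated) (use zw(2) in auto)
  qed
  have "sg (r - r') = sg (t - t')" if "(r, t) \<in> \<Theta>'" "(r', t') \<in> \<Theta>'" for r t r' t'
  proof -
    consider "(r', t') \<in> \<Theta>" | "(r, t) \<in> \<Theta>" | "(r, t) \<notin> \<Theta>" "(r', t') \<notin> \<Theta>" by blast
    then show ?thesis
    proof cases
      case 1 then show ?thesis using old[OF that(1)] unfolding matched_iff by blast
    next
      case 2
      then have "sg (r' - r) = sg (t' - t)" using old[OF that(2)] unfolding matched_iff by blast
      then show ?thesis using sg_minus[of "r' - r"] sg_minus[of "t' - t"] by simp
    next
      case 3 then show ?thesis using new that by blast
    qed
  qed
  moreover have "finite \<Theta>'"
  proof -
    have "p1 \<noteq> 0" "p2 \<noteq> 0" using nonconst by auto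
    then have "finite ({r. poly p1 r = 0} \<times> {t. poly p2 t = 0})" by (simp add: poly_roots_finite)
    then show ?thesis unfolding \<Theta>'_def using fin(3) by (auto intro: finite_subset[rotated])
  qed
  ultimately show "order_matching \<Theta>'" unfolding order_matching_def matched_def by auto

  fix x y assume xy': "matched \<Theta>' x y"
  then have xy: "matched \<Theta> x y" by (auto simp: matched_def \<Theta>'_def)
  show "sg (poly p1 x) = sg (poly p2 y)"
  proof (cases "x \<in> fst ` \<Theta>")
    case True
    then obtain w where w: "(x, w) \<in> \<Theta>" by auto
    then show ?thesis using matched_point_left[OF xy w] points_agree by blast
  next
    case False
    have yopen: "y \<notin> snd ` \<Theta>" using False matched_point_right[OF xy] by (auto simp: image_iff)
    obtain s where s: "s = 1 \<or> s = -1"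
      and s1: "\<And>c. c \<in> cell (fst ` \<Theta>) x \<Longrightarrow> sg (poly (pderiv p1) c) = s"
      and s2: "\<And>c. c \<in> cell (snd ` \<Theta>) y \<Longrightarrow> sg (poly (pderiv p2) c) = s"
      using open_cell_slope[OF om nonconst deriv_agree points_agree xy False] by blast
    have s0: "s \<noteq> 0" using s by auto
    note neg = open_cell_has_neg_iff[OF om nonconst deriv_agree points_agree xy False]
    note pos = open_cell_has_pos_iff[OF xy False]
    note around1 = signs_around_root_in_cell[OF fin(1) False s s1]
    note around2 = signs_around_root_in_cell[OF fin(2) yopen s s2]
    have in1: "x \<in> cell (fst ` \<Theta>) x" and in2: "y \<in> cell (snd ` \<Theta>) y" by (rule self_in_cell)+
    show ?thesis
    proof (cases "(\<exists>c\<in>cell (fst ` \<Theta>) x. poly p1 c < 0) \<and> (\<exists>c\<in>cell (fst ` \<Theta>) x. 0 < poly p1 c)")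
      case True
      then obtain r where r: "r \<in> cell (fst ` \<Theta>) x" "poly p1 r = 0"
        using root_between_signs_in_cell by blast
      from True neg pos obtain t where t: "t \<in> cell (snd ` \<Theta>) y" "poly p2 t = 0"
        using root_between_signs_in_cell by blast
      have "(r, t) \<in> \<Theta>'" using r t matched_both_iff[OF xy r(1) t(1)] by (simp add: \<Theta>'_def)
      then have "sg (x - r) = sg (y - t)" using xy' unfolding matched_iff by blast
      then show ?thesis
        using sg_on_cell_from_root[OF s0 s1 r in1] sg_on_cell_from_root[OF s0 s2 t in2] by simp
    next
      case F: False
      then have "poly p1 x \<noteq> 0" using around1 by blast
      moreover have "poly p2 y \<noteq> 0" using F neg pos around2 by blast
      moreover have "\<not> (poly p1 x < 0 \<and> 0 < poly p2 y)" "\<not> (0 < poly p1 x \<and> poly p2 y < 0)"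
        using F neg pos in1 in2 by blast+
      ultimately show ?thesis by (auto simp: sg_def)
    qed
  qed
qed

end

section \<open>Elimination of one variable\<close>

definition ring_morphism :: "('a::comm_ring_1 \<Rightarrow> 'b::comm_ring_1) \<Rightarrow> bool" where
  "ring_morphism \<phi> \<longleftrightarrow> \<phi> 1 = 1 \<and> (\<forall>x y. \<phi> (x + y) = \<phi> x + \<phi> y) \<and> (\<forall>x y. \<phi> (x * y) = \<phi> x * \<phi> y)"

lemma ring_morphism_simps:
  assumes "ring_morphism \<phi>"
  shows "\<phi> 1 = 1" "\<phi> (x + y) = \<phi> x + \<phi> y" "\<phi> (x * y) = \<phi> x * \<phi> y"
    and "\<phi> 0 = 0" "\<phi> (- x) = - \<phi> x" "\<phi> (x - y) = \<phi> x - \<phi> y"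
    and "\<phi> (x ^ n) = \<phi> x ^ n" "\<phi> (of_nat n) = of_nat n" "\<phi> (sum f A) = (\<Sum>i\<in>A. \<phi> (f i))"
proof -
  show 1: "\<phi> 1 = 1" and add: "\<phi> (x + y) = \<phi> x + \<phi> y" and mult: "\<phi> (x * y) = \<phi> x * \<phi> y" for x y
    using assms by (auto simp: ring_morphism_def)
  have "\<phi> 0 + \<phi> 0 = \<phi> 0" using add[of 0 0] by simp
  then show z: "\<phi> 0 = 0" by simp
  show m: "\<phi> (- x) = - \<phi> x" for x
    using add[of x "- x"] z by (simp add: eq_neg_iff_add_eq_0 add.commute)
  show "\<phi> (x - y) = \<phi> x - \<phi> y" using add[of x "- y"] m[of y] by simp
  show "\<phi> (x ^ n) = \<phi> x ^ n" by (induction n) (auto simp: 1 mult)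
  show "\<phi> (of_nat n) = of_nat n" by (induction n) (auto simp: 1 add z)
  show "\<phi> (sum f A) = (\<Sum>i\<in>A. \<phi> (f i))"
    by (induction A rule: infinite_finite_induct) (auto simp: add z)
qed

text \<open>
\<^const>\<open>pderiv\<close> requires a coefficient ring without zero divisors; here the coefficients form an arbitrary
commutative ring.
\<close>

definition formal_deriv :: "'a::comm_ring_1 poly \<Rightarrow> 'a poly" where
  "formal_deriv p = (\<Sum>i<degree p. monom (of_nat (Suc i) * coeff p (Suc i)) i)"

lemma coeff_formal_deriv: "coeff (formal_deriv p) n = of_nat (Suc n) * coeff p (Suc n)"
proof -
  have "coeff (formal_deriv p) n = (\<Sum>i<degree p. if i = n then of_nat (Suc i) * coeff p (Suc i) else 0)"
    unfolding formal_deriv_def coeff_sum coeff_monom by (intro sum.cong) auto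
  also have "\<dots> = of_nat (Suc n) * coeff p (Suc n)"
    by (simp add: sum.delta' coeff_eq_0 del: of_nat_Suc)
  finally show ?thesis .
qed

lemma degree_formal_deriv_less: "0 < degree p \<Longrightarrow> degree (formal_deriv p) < degree p"
  by (rule le_less_trans[OF degree_le[of "degree p - 1"]]) (auto simp: coeff_formal_deriv coeff_eq_0)

lemma map_poly_ring_morphism:
  assumes \<phi>: "ring_morphism \<phi>"
  shows "map_poly \<phi> (p + q) = map_poly \<phi> p + map_poly \<phi> q"
    and "map_poly \<phi> (p - q) = map_poly \<phi> p - map_poly \<phi> q"
    and "map_poly \<phi> (p * q) = map_poly \<phi> p * map_poly \<phi> q"
    and "map_poly \<phi> (smult c p) = smult (\<phi> c) (map_poly \<phi> p)"
    and "map_poly \<phi> (monom c n) = monom (\<phi> c) n"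
    and "map_poly \<phi> (formal_deriv p) = pderiv (map_poly \<phi> p)"
  by (intro poly_eqI; simp add: coeff_map_poly ring_morphism_simps[OF \<phi>] coeff_mult coeff_pderiv coeff_formal_deriv del: of_nat_Suc)+

definition subring_set :: "'a::comm_ring_1 set \<Rightarrow> bool" where
  "subring_set B \<longleftrightarrow> 1 \<in> B \<and> (\<forall>x\<in>B. \<forall>y\<in>B. x - y \<in> B \<and> x * y \<in> B)"

lemma subring_set_closed:
  assumes "subring_set B"
  shows "1 \<in> B" "0 \<in> B" "x \<in> B \<Longrightarrow> y \<in> B \<Longrightarrow> x - y \<in> B" "x \<in> B \<Longrightarrow> y \<in> B \<Longrightarrow> x * y \<in> B"
    and "x \<in> B \<Longrightarrow> - x \<in> B" "x \<in> B \<Longrightarrow> y \<in> B \<Longrightarrow> x + y \<in> B" "of_nat n \<in> B" "x \<in> B \<Longrightarrow> x ^ n \<in> B"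
    and "(\<And>i. i \<in> I \<Longrightarrow> f i \<in> B) \<Longrightarrow> sum f I \<in> B"
proof -
  show 1: "1 \<in> B" and d: "\<And>x y. x \<in> B \<Longrightarrow> y \<in> B \<Longrightarrow> x - y \<in> B" and m: "\<And>x y. x \<in> B \<Longrightarrow> y \<in> B \<Longrightarrow> x * y \<in> B"
    using assms by (auto simp: subring_set_def)
  show 0: "0 \<in> B" using d[OF 1 1] by simp
  show neg: "- x \<in> B" if "x \<in> B" for x using d[OF 0 that] by simp
  show add: "x + y \<in> B" if "x \<in> B" "y \<in> B" for x y using d[OF that(1) neg[OF that(2)]] by simp
  show "of_nat n \<in> B" by (induction n) (auto intro: 0 1 add)
  show "x \<in> B \<Longrightarrow> x ^ n \<in> B" by (induction n) (auto intro: 1 m)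
  show "(\<And>i. i \<in> I \<Longrightarrow> f i \<in> B) \<Longrightarrow> sum f I \<in> B"
    by (induction I rule: infinite_finite_induct) (auto intro: 0 add)
qed

definition polys_over :: "'a::comm_ring_1 set \<Rightarrow> 'a poly set" where
  "polys_over B = {p. \<forall>i. coeff p i \<in> B}"

lemma polys_over_closed:
  assumes B: "subring_set B"
  shows "p \<in> polys_over B \<Longrightarrow> q \<in> polys_over B \<Longrightarrow> p - q \<in> polys_over B"
    and "p \<in> polys_over B \<Longrightarrow> q \<in> polys_over B \<Longrightarrow> p + q \<in> polys_over B"
    and "p \<in> polys_over B \<Longrightarrow> q \<in> polys_over B \<Longrightarrow> p * q \<in> polys_over B"
    and "c \<in> B \<Longrightarrow> p \<in> polys_over B \<Longrightarrow> smult c p \<in> polys_over B"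
    and "c \<in> B \<Longrightarrow> monom c n \<in> polys_over B"
    and "p \<in> polys_over B \<Longrightarrow> formal_deriv p \<in> polys_over B"
  unfolding polys_over_def
  by (auto simp: coeff_mult coeff_formal_deriv simp del: of_nat_Suc intro!: subring_set_closed[OF B])

definition pseudo_remainder :: "'a::comm_ring_1 poly \<Rightarrow> 'a poly \<Rightarrow> 'a poly \<Rightarrow> bool" where
  "pseudo_remainder p q r \<longleftrightarrow> degree r < degree q \<and> (\<exists>k m. smult (lead_coeff q ^ k) p = m * q + r)"

lemma degree_diff_less_top:
  fixes p q :: "'a::comm_ring_1 poly"
  assumes "degree p \<le> n" "degree q \<le> n" "coeff p n = coeff q n" "0 < n"
  shows "degree (p - q) < n"
proof -
  have "degree (p - q) \<le> n" using assms by (simp add: degree_diff_le)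
  moreover have "coeff (p - q) n = 0" using assms by simp
  ultimately show ?thesis
    using \<open>0 < n\<close> by (metis degree_0 leading_coeff_0_iff nat_less_le)
qed

text \<open>
At a root of \<open>q\<close> where the leading coefficient of \<open>q\<close> does not vanish, the sign of \<open>p\<close> is determined by the
signs of the pseudo-remainder and of this leading coefficient. The set \<open>B\<close> keeps track of the
coefficients: they stay polynomials in the remaining variables.
\<close>

lemma pseudo_remainder_exists:
  assumes B: "subring_set B" and "p \<in> polys_over B" "q \<in> polys_over B" "0 < degree q"
  shows "\<exists>r\<in>polys_over B. pseudo_remainder p q r"
  using \<open>p \<in> polys_over B\<close>
proof (induction "degree p" arbitrary: p rule: less_induct)
  case less
  show ?case
  proof (cases "degree p < degree q")
    case True
    have "smult (lead_coeff q ^ 0) p = 0 * q + p" by simp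
    then show ?thesis using less.prems True unfolding pseudo_remainder_def by blast
  next
    case False
    define m where "m = monom (lead_coeff p) (degree p - degree q)"
    define p' where "p' = smult (lead_coeff q) p - m * q"
    have co: "lead_coeff p \<in> B" "lead_coeff q \<in> B" using assms less.prems by (auto simp: polys_over_def)
    have p'B: "p' \<in> polys_over B"
      unfolding p'_def m_def by (intro polys_over_closed[OF B] co less.prems assms)
    have "degree p' < degree p" unfolding p'_def
    proof (rule degree_diff_less_top)
      show "degree (smult (lead_coeff q) p) \<le> degree p" by (rule degree_smult_le)
      have "degree (m * q) \<le> degree m + degree q" by (rule degree_mult_le)
      also have "\<dots> \<le> degree p" using False degree_monom_le[of "lead_coeff p" "degree p - degree q"]
        by (simp add: m_def)
      finally show "degree (m * q) \<le> degree p" .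
      show "coeff (smult (lead_coeff q) p) (degree p) = coeff (m * q) (degree p)"
        unfolding m_def coeff_monom_mult using False by (simp add: mult.commute)
    qed (use False assms in simp)
    from less.hyps[OF this p'B] obtain r k n where r: "r \<in> polys_over B" "degree r < degree q"
      "smult (lead_coeff q ^ k) p' = n * q + r" unfolding pseudo_remainder_def by blast
    have "smult (lead_coeff q ^ Suc k) p = (smult (lead_coeff q ^ k) m + n) * q + r"
    proof -
      have "smult (lead_coeff q ^ Suc k) p = smult (lead_coeff q ^ k) (m * q) + smult (lead_coeff q ^ k) p'"
        by (simp add: p'_def smult_diff_right mult.commute)
      then show ?thesis unfolding r(3) by (simp add: algebra_simps)
    qed
    then show ?thesis using r unfolding pseudo_remainder_def by blast
  qed
qed

text \<open>
The operations of the Cohen-Hoermander procedure: derivative, removal of the leading term (which may specialise to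
zero), and pseudo-remainder. The bound \<open>N\<close> restricts closedness to the degrees already treated.
\<close>

definition elimination_closed :: "nat \<Rightarrow> 'a::comm_ring_1 poly set \<Rightarrow> bool" where
  "elimination_closed N H \<longleftrightarrow> (\<forall>p\<in>H. N \<le> degree p \<longrightarrow> formal_deriv p \<in> H \<and> p - monom (lead_coeff p) (degree p) \<in> H) \<and>
     (\<forall>p\<in>H. \<forall>q\<in>H. N \<le> degree q \<longrightarrow> degree q \<le> degree p \<longrightarrow> (\<exists>r\<in>H. pseudo_remainder p q r))"

text \<open>
Each operation yields a polynomial of lower degree than the divisor or the polynomial it is applied to. Closing up
the elements of degree \<open>N\<close> therefore adds only elements of degree below \<open>N\<close> and preserves closedness above.
\<close>

lemma elimination_closed_step:
  assumes B: "subring_set B" and H: "finite H" "H \<subseteq> polys_over B" "elimination_closed (Suc N) H" and "0 < N"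
  shows "\<exists>H'. finite H' \<and> H \<subseteq> H' \<and> H' \<subseteq> polys_over B \<and> elimination_closed N H'"
proof -
  define R where "R p q = (SOME r. r \<in> polys_over B \<and> pseudo_remainder p q r)" for p q :: "'a poly"
  have R: "R p q \<in> polys_over B \<and> pseudo_remainder p q (R p q)" if "p \<in> H" "q \<in> H" "0 < degree q" for p q
    unfolding R_def by (rule someI_ex) (use pseudo_remainder_exists[OF B, of p q] that H(2) in blast)
  define HN where "HN = {p\<in>H. degree p = N}"
  define H' where "H' = H \<union> formal_deriv ` HN \<union> (\<lambda>p. p - monom (lead_coeff p) (degree p)) ` HN \<union> (\<lambda>(p, q). R p q) ` (H \<times> HN)"
  have new: "degree p < N" if "p \<in> H'" "p \<notin> H" for p
  proof -
    have "degree (formal_deriv p) < N" if "p \<in> HN" for p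
      using that \<open>0 < N\<close> degree_formal_deriv_less[of p] by (auto simp: HN_def)
    moreover have "degree (p - monom (lead_coeff p) (degree p)) < N" if "p \<in> HN" for p
      by (rule degree_diff_less_top) (use that \<open>0 < N\<close> in \<open>auto simp: HN_def intro: degree_monom_le\<close>)
    moreover have "degree (R p q) < N" if "p \<in> H" "q \<in> HN" for p q
      using R[of p q] that \<open>0 < N\<close> by (auto simp: HN_def pseudo_remainder_def)
    ultimately show ?thesis using that by (auto simp: H'_def)
  qed
  have "finite H'" using H(1) by (auto simp: H'_def HN_def)
  moreover have "H' \<subseteq> polys_over B"
  proof
    fix p assume "p \<in> H'"
    then consider "p \<in> H" | q where "q \<in> H" "p = formal_deriv q" | q where "q \<in> H" "p = q - monom (lead_coeff q) (degree q)"
      | q q' where "q \<in> H" "q' \<in> HN" "p = R q q'"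
      by (auto simp: H'_def HN_def)
    then show "p \<in> polys_over B"
    proof cases
      case 3
      then have "q \<in> polys_over B" "lead_coeff q \<in> B" using H(2) by (auto simp: polys_over_def)
      then show ?thesis using 3 by (auto intro!: polys_over_closed[OF B])
    qed (use H(2) R \<open>0 < N\<close> in \<open>auto simp: HN_def intro!: polys_over_closed[OF B]\<close>)
  qed
  moreover have "elimination_closed N H'"
    unfolding elimination_closed_def
  proof (intro conjI ballI impI)
    fix p assume p: "p \<in> H'" "N \<le> degree p"
    then have pH: "p \<in> H" using new by force
    show "formal_deriv p \<in> H'" "p - monom (lead_coeff p) (degree p) \<in> H'"
    proof -
      have "formal_deriv p \<in> H' \<and> p - monom (lead_coeff p) (degree p) \<in> H'"
      proof (cases "degree p = N")
        case True then show ?thesis using pH by (auto simp: H'_def HN_def)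
      next
        case False
        then have "Suc N \<le> degree p" using p by simp
        then show ?thesis using H(3) pH by (auto simp: H'_def elimination_closed_def)
      qed
      then show "formal_deriv p \<in> H'" "p - monom (lead_coeff p) (degree p) \<in> H'" by auto
    qed
  next
    fix p q assume pq: "p \<in> H'" "q \<in> H'" "N \<le> degree q" "degree q \<le> degree p"
    then have pqH: "p \<in> H" "q \<in> H" using new by force+
    show "\<exists>r\<in>H'. pseudo_remainder p q r"
    proof (cases "degree q = N")
      case True
      then have "R p q \<in> H'" using pqH by (auto simp: H'_def HN_def)
      then show ?thesis using R[OF pqH] True \<open>0 < N\<close> by auto
    next
      case False
      then have "Suc N \<le> degree q" using pq by simp
      then have "\<exists>r\<in>H. pseudo_remainder p q r"
        using H(3) pqH pq(4) unfolding elimination_closed_def by blast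
      then show ?thesis by (auto simp: H'_def)
    qed
  qed
  ultimately show ?thesis by (intro exI[of _ H']) (auto simp: H'_def)
qed

lemma elimination_closure_exists:
  assumes B: "subring_set B" and S: "finite S" "S \<subseteq> polys_over B"
  shows "\<exists>H. finite H \<and> S \<subseteq> H \<and> H \<subseteq> polys_over B \<and> elimination_closed 1 H"
proof -
  \<comment> \<open>Above all degrees there is nothing to close up; the bound is then lowered step by step to 1.\<close>
  define D where "D = Suc (Max (insert 0 (degree ` S)))"
  have D: "degree p < D" if "p \<in> S" for p
    using that S(1) by (auto simp: D_def less_Suc_eq_le intro!: Max_ge)
  have "1 \<le> D" by (simp add: D_def)
  then show ?thesis
  proof (induction rule: inc_induct)
    case base
    have "elimination_closed D S" unfolding elimination_closed_def using D by (meson not_le)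
    then show ?case using S by blast
  next
    case (step n)
    then obtain H where H: "finite H" "S \<subseteq> H" "H \<subseteq> polys_over B" "elimination_closed (Suc n) H" by blast
    from elimination_closed_step[OF B H(1,3,4)] step.hyps obtain H'
      where "finite H'" "H \<subseteq> H'" "H' \<subseteq> polys_over B" "elimination_closed n H'" by auto
    then show ?case using H(2) by blast
  qed
qed

text \<open>
The polynomials are added in the order of increasing degree. A new polynomial \<open>p\<close> meets a matching that already
controls its derivative, and whose points are roots of polynomials \<open>q\<close> of degree at most that of \<open>p\<close>; the
pseudo-remainder of \<open>p\<close> by \<open>q\<close>, which has been treated before, determines the sign of \<open>p\<close> at such a root.
If the leading coefficient of \<open>p\<close> specialises to zero, \<open>p\<close> is replaced by its truncation.
\<close>

lemma matching_exists:
  fixes \<phi> :: "'a::comm_ring_1 \<Rightarrow> 'k::real_closed_field" and \<psi> :: "'a \<Rightarrow> 'l::real_closed_field"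
  assumes \<phi>: "ring_morphism \<phi>" and \<psi>: "ring_morphism \<psi>"
    and H: "finite H" "elimination_closed 1 H"
    and agree: "\<And>p i. p \<in> H \<Longrightarrow> sg (\<phi> (coeff p i)) = sg (\<psi> (coeff p i))"
    and "G \<subseteq> H" "\<And>p q. p \<in> G \<Longrightarrow> q \<in> H \<Longrightarrow> degree q < degree p \<Longrightarrow> q \<in> G"
  shows "\<exists>\<Theta>. order_matching \<Theta> \<and>
    (\<forall>p\<in>G. \<forall>x y. matched \<Theta> x y \<longrightarrow> sg (poly (map_poly \<phi> p) x) = sg (poly (map_poly \<psi> p) y)) \<and>
    (\<forall>(z, w)\<in>\<Theta>. \<exists>q\<in>G. 0 < degree q \<and> \<phi> (lead_coeff q) \<noteq> 0 \<and> poly (map_poly \<phi> q) z = 0)"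
  using assms(6,7)
proof (induction "card G" arbitrary: G)
  case 0
  then have "G = {}" using H(1) finite_subset by (metis card_0_eq)
  then show ?case by (intro exI[of _ "{}"]) (simp add: order_matching_def)
next
  case (Suc n)
  note down = Suc.prems(2)
  have finG: "finite G" "G \<noteq> {}" using Suc.hyps(2) by (auto intro: card_ge_0_finite)
  then have "Max (degree ` G) \<in> degree ` G" by (intro Max_in) auto
  then obtain p where p: "p \<in> G" "degree p = Max (degree ` G)" by auto
  have p: "p \<in> G" "\<And>q. q \<in> G \<Longrightarrow> degree q \<le> degree p" using p finG by auto
  define G' where "G' = G - {p}"
  have G'_iff: "q \<in> G'" if "q \<in> H" "degree q < degree p" for q
    using down[OF p(1) that] that by (auto simp: G'_def)
  have "card G' = n" using Suc.hyps(2) p finG by (simp add: G'_def)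
  moreover have "G' \<subseteq> H" using Suc.prems by (auto simp: G'_def)
  moreover have "q \<in> G'" if "p' \<in> G'" "q \<in> H" "degree q < degree p'" for p' q
    using G'_iff[OF that(2)] that p by (auto simp: G'_def intro: less_le_trans)
  ultimately have "\<exists>\<Theta>. order_matching \<Theta> \<and>
    (\<forall>p\<in>G'. \<forall>x y. matched \<Theta> x y \<longrightarrow> sg (poly (map_poly \<phi> p) x) = sg (poly (map_poly \<psi> p) y)) \<and>
    (\<forall>(z, w)\<in>\<Theta>. \<exists>q\<in>G'. 0 < degree q \<and> \<phi> (lead_coeff q) \<noteq> 0 \<and> poly (map_poly \<phi> q) z = 0)"
    using Suc.hyps(1)[of G'] by blast
  then obtain \<Theta> where om: "order_matching \<Theta>"
    and IH: "\<And>q x y. q \<in> G' \<Longrightarrow> matched \<Theta> x y \<Longrightarrow> sg (poly (map_poly \<phi> q) x) = sg (poly (map_poly \<psi> q) y)"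
    and roots: "\<And>z w. (z, w) \<in> \<Theta> \<Longrightarrow>
      \<exists>q\<in>G'. 0 < degree q \<and> \<phi> (lead_coeff q) \<noteq> 0 \<and> poly (map_poly \<phi> q) z = 0"
    by fast
  have pH: "p \<in> H" using p Suc.prems by blast
  have sub: "G' \<subseteq> G" by (auto simp: G'_def)
  have keep: ?case
    if "\<And>x y. matched \<Theta> x y \<Longrightarrow> sg (poly (map_poly \<phi> p) x) = sg (poly (map_poly \<psi> p) y)"
  proof (intro exI[of _ \<Theta>] conjI ballI allI impI om)
    fix q x y assume "q \<in> G" "matched \<Theta> x y"
    then show "sg (poly (map_poly \<phi> q) x) = sg (poly (map_poly \<psi> q) y)"
      using IH that by (cases "q = p") (auto simp: G'_def)
  qed (use roots sub in fastforce)
  note rm = ring_morphism_simps[OF \<phi>] ring_morphism_simps[OF \<psi>]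
    map_poly_ring_morphism[OF \<phi>] map_poly_ring_morphism[OF \<psi>]
  show ?case
  proof (cases "degree p = 0 \<or> \<phi> (lead_coeff p) = 0")
    case True
    show ?thesis
    proof (rule keep)
      fix x y assume xy: "matched \<Theta> x y"
      show "sg (poly (map_poly \<phi> p) x) = sg (poly (map_poly \<psi> p) y)"
      proof (cases "degree p = 0")
        case True
        then obtain c where c: "p = [:c:]" by (meson degree_eq_zeroE)
        have "map_poly \<phi> [:c:] = [:\<phi> c:]" "map_poly \<psi> [:c:] = [:\<psi> c:]"
          by (simp_all add: map_poly_pCons rm)
        then show ?thesis using agree[OF pH, of 0] by (simp add: c)
      next
        case False
        define r where "r = p - monom (lead_coeff p) (degree p)"
        have "r \<in> H" using H(2) pH False unfolding elimination_closed_def r_def by force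
        moreover have "degree r < degree p" unfolding r_def
          by (rule degree_diff_less_top) (use False in \<open>auto intro: degree_monom_le\<close>)
        ultimately have "r \<in> G'" by (rule G'_iff)
        have lc: "\<phi> (lead_coeff p) = 0" "\<psi> (lead_coeff p) = 0"
          using True False agree[OF pH, of "degree p"] by auto
        have "map_poly \<phi> r = map_poly \<phi> p" "map_poly \<psi> r = map_poly \<psi> p"
          unfolding r_def by (simp_all add: rm lc)
        then show ?thesis using IH[OF \<open>r \<in> G'\<close> xy] by simp
      qed
    qed
  next
    case False
    then have dp: "0 < degree p" and lc: "\<phi> (lead_coeff p) \<noteq> 0" "\<psi> (lead_coeff p) \<noteq> 0"
      using agree[OF pH, of "degree p"] by (auto simp: sg_eq_iff)
    define p1 p2 where "p1 = map_poly \<phi> p" and "p2 = map_poly \<psi> p"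
    have "formal_deriv p \<in> H" using H(2) pH dp unfolding elimination_closed_def by force
    then have dG: "formal_deriv p \<in> G'" by (rule G'_iff) (rule degree_formal_deriv_less[OF dp])
    obtain n where n: "degree p = Suc n" using dp by (cases "degree p") auto
    have "coeff (pderiv p1) n \<noteq> 0" "coeff (pderiv p2) n \<noteq> 0"
      using lc n by (simp_all add: p1_def p2_def coeff_pderiv coeff_map_poly rm del: of_nat_Suc)
    then have nonconst: "pderiv p1 \<noteq> 0" "pderiv p2 \<noteq> 0" by auto
    have deriv_agree: "sg (poly (pderiv p1) x) = sg (poly (pderiv p2) y)" if "matched \<Theta> x y" for x y
      using IH[OF dG that] by (simp add: p1_def p2_def rm)
    have points_agree: "sg (poly p1 z) = sg (poly p2 w)" if zw: "(z, w) \<in> \<Theta>" for z w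
    proof -
      have m: "matched \<Theta> z w" using om zw by (auto simp: order_matching_def)
      obtain q where q: "q \<in> G'" "0 < degree q" "\<phi> (lead_coeff q) \<noteq> 0" "poly (map_poly \<phi> q) z = 0"
        using roots[OF zw] by blast
      have qH: "q \<in> H" and le: "degree q \<le> degree p" using q(1) \<open>G' \<subseteq> H\<close> p(2) sub by auto
      then obtain r where r: "r \<in> H" "pseudo_remainder p q r"
        using H(2) pH q(2) unfolding elimination_closed_def by force
      have "r \<in> G'" by (rule G'_iff[OF r(1)]) (use r(2) le in \<open>auto simp: pseudo_remainder_def\<close>)
      from r(2) obtain k m where km: "smult (lead_coeff q ^ k) p = m * q + r"
        unfolding pseudo_remainder_def by blast
      have qw: "poly (map_poly \<psi> q) w = 0" using IH[OF q(1) m] q(4) by simp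
      have "\<phi> (lead_coeff q) ^ k * poly p1 z = poly (map_poly \<phi> r) z"
        using arg_cong[OF km, of "\<lambda>f. poly (map_poly \<phi> f) z"] q(4) by (simp add: p1_def rm)
      then have 1: "sg (\<phi> (lead_coeff q)) ^ k * sg (poly p1 z) = sg (poly (map_poly \<phi> r) z)"
        by (metis sg_mult sg_power)
      have "\<psi> (lead_coeff q) ^ k * poly p2 w = poly (map_poly \<psi> r) w"
        using arg_cong[OF km, of "\<lambda>f. poly (map_poly \<psi> f) w"] qw by (simp add: p2_def rm)
      then have 2: "sg (\<psi> (lead_coeff q)) ^ k * sg (poly p2 w) = sg (poly (map_poly \<psi> r) w)"
        by (metis sg_mult sg_power)
      have "sg (\<phi> (lead_coeff q)) ^ k * sg (poly p1 z) = sg (\<phi> (lead_coeff q)) ^ k * sg (poly p2 w)"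
        using 1 2 IH[OF \<open>r \<in> G'\<close> m] agree[OF qH, of "degree q"] by simp
      then show ?thesis using q(3) by simp
    qed
    define \<Theta>' where "\<Theta>' = \<Theta> \<union> {(r, t). poly p1 r = 0 \<and> poly p2 t = 0 \<and> matched \<Theta> r t}"
    have om': "order_matching \<Theta>'" unfolding \<Theta>'_def
      by (rule matching_extended_by_roots(1)[OF om nonconst deriv_agree points_agree])
    have agree': "sg (poly p1 x) = sg (poly p2 y)" if "matched \<Theta>' x y" for x y
      using matching_extended_by_roots(2)[OF om nonconst deriv_agree points_agree] that
      unfolding \<Theta>'_def by blast
    show ?thesis
    proof (intro exI[of _ \<Theta>'] conjI ballI allI impI)
      show "order_matching \<Theta>'" by (rule om')
      fix q x y assume q: "q \<in> G" and xy: "matched \<Theta>' x y"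
      then have "matched \<Theta> x y" by (auto simp: matched_def \<Theta>'_def)
      then show "sg (poly (map_poly \<phi> q) x) = sg (poly (map_poly \<psi> q) y)"
        using IH[of q x y] agree'[OF xy] q by (cases "q = p") (auto simp: G'_def p1_def p2_def)
    next
      fix zw assume "zw \<in> \<Theta>'"
      then show "case zw of (z, w) \<Rightarrow> \<exists>q\<in>G. 0 < degree q \<and> \<phi> (lead_coeff q) \<noteq> 0 \<and> poly (map_poly \<phi> q) z = 0"
        using roots sub dp lc(1) p(1) unfolding \<Theta>'_def p1_def by fastforce
    qed
  qed
qed

text \<open>
The signs of finitely many elements of \<open>B\<close>, chosen independently of the specialisations \<open>\<phi>\<close> and \<open>\<psi>\<close>, decide which
sign patterns the polynomials in \<open>S\<close> realise. This is quantifier elimination in semantic form: no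
syntax of formulas is needed for the transfer from one real closed field to another.
\<close>

lemma eliminate_variable:
  fixes S :: "'a::comm_ring_1 poly set"
  assumes B: "subring_set B" and S: "finite S" "S \<subseteq> polys_over B"
  obtains S' where "finite S'" "S' \<subseteq> B"
    "\<And>(\<phi> :: 'a \<Rightarrow> 'k::real_closed_field) (\<psi> :: 'a \<Rightarrow> 'l::real_closed_field) y.
       ring_morphism \<phi> \<Longrightarrow> ring_morphism \<psi> \<Longrightarrow> (\<And>c. c \<in> S' \<Longrightarrow> sg (\<phi> c) = sg (\<psi> c)) \<Longrightarrow>
       \<exists>x. \<forall>p\<in>S. sg (poly (map_poly \<phi> p) x) = sg (poly (map_poly \<psi> p) y)"
proof -
  obtain H where H: "finite H" "S \<subseteq> H" "H \<subseteq> polys_over B" "elimination_closed 1 H"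
    using elimination_closure_exists[OF B S] by blast
  show ?thesis
  proof (rule that[of "\<Union>p\<in>H. coeff p ` {..degree p}"])
    show "finite (\<Union>p\<in>H. coeff p ` {..degree p})" using H(1) by simp
    show "(\<Union>p\<in>H. coeff p ` {..degree p}) \<subseteq> B" using H(3) by (auto simp: polys_over_def)
    fix \<phi> :: "'a \<Rightarrow> 'k::real_closed_field" and \<psi> :: "'a \<Rightarrow> 'l::real_closed_field" and y
    assume \<phi>: "ring_morphism \<phi>" and \<psi>: "ring_morphism \<psi>"
      and agree: "\<And>c. c \<in> (\<Union>p\<in>H. coeff p ` {..degree p}) \<Longrightarrow> sg (\<phi> c) = sg (\<psi> c)"
    have ag: "sg (\<phi> (coeff p i)) = sg (\<psi> (coeff p i))" if "p \<in> H" for p i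
    proof (cases "i \<le> degree p")
      case True then show ?thesis using agree that by blast
    next
      case False
      then show ?thesis by (simp add: coeff_eq_0 ring_morphism_simps[OF \<phi>] ring_morphism_simps[OF \<psi>])
    qed
    obtain \<Theta> :: "('k \<times> 'l) set" where \<Theta>: "order_matching \<Theta>"
      "\<And>p x y. p \<in> H \<Longrightarrow> matched \<Theta> x y \<Longrightarrow> sg (poly (map_poly \<phi> p) x) = sg (poly (map_poly \<psi> p) y)"
      using matching_exists[OF \<phi> \<psi> H(1,4) ag order_refl] by blast
    obtain x where "matched \<Theta> x y" using partner_left[OF \<Theta>(1)] by blast
    then show "\<exists>x. \<forall>p\<in>S. sg (poly (map_poly \<phi> p) x) = sg (poly (map_poly \<psi> p) y)"
      using \<Theta>(2) H(2) by blast
  qed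
qed

section \<open>Evaluation of polynomials in several variables\<close>

definition monomial_value :: "('n::finite \<Rightarrow>\<^sub>0 nat) \<Rightarrow> real ^ 'n \<Rightarrow> real" where
  "monomial_value a x = (\<Prod>i\<in>UNIV. (x $ i) ^ Poly_Mapping.lookup a i)"

lemma eval_poly_superset:
  assumes "finite F" "Poly_Mapping.keys p \<subseteq> F"
  shows "eval_poly p x = (\<Sum>a\<in>F. Poly_Mapping.lookup p a * monomial_value a x)"
  unfolding eval_poly_def monomial_value_def
  by (rule sum.mono_neutral_left) (use assms in \<open>auto simp: in_keys_iff\<close>)

lemma eval_poly_add: "eval_poly (p + q) x = eval_poly p x + eval_poly q x"
proof -
  let ?F = "Poly_Mapping.keys p \<union> Poly_Mapping.keys q"
  have "Poly_Mapping.keys (p + q) \<subseteq> ?F" by (rule Poly_Mapping.keys_add)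
  then show ?thesis
    using eval_poly_superset[of ?F p x] eval_poly_superset[of ?F q x] eval_poly_superset[of ?F "p + q" x]
    by (simp add: lookup_add algebra_simps sum.distrib)
qed

lemma eval_poly_single: "eval_poly (Poly_Mapping.single a c) x = c * monomial_value a x"
  using eval_poly_superset[of "{a}" "Poly_Mapping.single a c" x] by simp

lemma poly_mapping_sum_singles:
  fixes p :: "'a \<Rightarrow>\<^sub>0 'b::comm_monoid_add"
  shows "p = (\<Sum>a\<in>Poly_Mapping.keys p. Poly_Mapping.single a (Poly_Mapping.lookup p a))"
proof (rule poly_mapping_eqI)
  fix b
  show "Poly_Mapping.lookup p b =
    Poly_Mapping.lookup (\<Sum>a\<in>Poly_Mapping.keys p. Poly_Mapping.single a (Poly_Mapping.lookup p a)) b"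
    by (simp add: lookup_sum lookup_single when_def in_keys_iff)
qed

lemma poly_mapping_induct_add [case_names zero single_add]:
  fixes p :: "'a \<Rightarrow>\<^sub>0 'b::comm_monoid_add"
  assumes "P 0" "\<And>a c p. P p \<Longrightarrow> P (Poly_Mapping.single a c + p)"
  shows "P p"
proof -
  have "P (\<Sum>a\<in>F. Poly_Mapping.single a (Poly_Mapping.lookup p a))" if "finite F" for F
    using that by (induction F) (auto intro: assms)
  from this[of "Poly_Mapping.keys p"] show ?thesis using poly_mapping_sum_singles[of p] by simp
qed

lemma eval_poly_zero: "eval_poly 0 x = 0"
  by (simp add: eval_poly_def)

lemma eval_poly_const: "eval_poly (const_poly c) x = c"
  by (simp add: const_poly_def eval_poly_single monomial_value_def)

lemma eval_poly_mult: "eval_poly (p * q) x = eval_poly p x * eval_poly q x"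
proof (induction p rule: poly_mapping_induct_add)
  case zero then show ?case by (simp add: eval_poly_zero)
next
  case (single_add a c p)
  have "eval_poly (Poly_Mapping.single a c * q) x = c * monomial_value a x * eval_poly q x" for q
  proof (induction q rule: poly_mapping_induct_add)
    case zero then show ?case by (simp add: eval_poly_zero)
  next
    case (single_add b d q)
    then show ?case
      by (simp add: distrib_left eval_poly_add mult_single eval_poly_single monomial_value_def
          lookup_add power_add prod.distrib)
  qed
  with single_add show ?case by (simp add: distrib_right eval_poly_add eval_poly_single)
qed

lemma eval_poly_one: "eval_poly 1 x = 1"
  using eval_poly_const[of 1 x] by (simp add: const_poly_def)

lemma ring_morphism_eval_poly: "ring_morphism (\<lambda>p. eval_poly p x)"
  by (simp add: ring_morphism_def eval_poly_one eval_poly_add eval_poly_mult)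

section \<open>Sums of squares and real prime ideals\<close>

definition sums_of_squares :: "'a::comm_ring_1 set" where
  "sums_of_squares = {s. \<exists>qs. s = (\<Sum>q\<leftarrow>qs. q\<^sup>2)}"

lemma sums_of_squares_induct [consumes 1, case_names zero add]:
  assumes "s \<in> sums_of_squares" "P 0" "\<And>q s. s \<in> sums_of_squares \<Longrightarrow> P s \<Longrightarrow> P (q\<^sup>2 + s)"
  shows "P s"
proof -
  have "P (\<Sum>q\<leftarrow>qs. q\<^sup>2)" for qs
    by (induction qs) (use assms(2,3) in \<open>auto simp: sums_of_squares_def\<close>)
  then show ?thesis using assms(1) by (auto simp: sums_of_squares_def)
qed

lemma sums_of_squares_zero: "0 \<in> sums_of_squares"
  unfolding sums_of_squares_def by (auto intro: exI[of _ "[]"])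

lemma sums_of_squares_square_add: "s \<in> sums_of_squares \<Longrightarrow> q\<^sup>2 + s \<in> sums_of_squares"
  unfolding sums_of_squares_def by (auto intro: exI[of _ "q # _"])

lemma sums_of_squares_square: "q\<^sup>2 \<in> sums_of_squares"
  using sums_of_squares_square_add[OF sums_of_squares_zero, of q] by simp

lemma sums_of_squares_add: "s \<in> sums_of_squares \<Longrightarrow> t \<in> sums_of_squares \<Longrightarrow> s + t \<in> sums_of_squares"
  by (induction s rule: sums_of_squares_induct) (auto simp: add.assoc intro: sums_of_squares_square_add)

lemma sums_of_squares_square_mult: "t \<in> sums_of_squares \<Longrightarrow> q\<^sup>2 * t \<in> sums_of_squares"
  by (induction t rule: sums_of_squares_induct)
    (auto simp: distrib_left sums_of_squares_zero simp flip: power_mult_distrib intro: sums_of_squares_square_add)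

lemma sums_of_squares_mult: "s \<in> sums_of_squares \<Longrightarrow> t \<in> sums_of_squares \<Longrightarrow> s * t \<in> sums_of_squares"
  by (induction s rule: sums_of_squares_induct)
    (auto simp: distrib_right sums_of_squares_zero intro: sums_of_squares_add sums_of_squares_square_mult)

definition real_prime_ideal :: "'a::comm_ring_1 set \<Rightarrow> bool" where
  "real_prime_ideal I \<longleftrightarrow> 0 \<in> I \<and> 1 \<notin> I \<and> (\<forall>x\<in>I. \<forall>y\<in>I. x + y \<in> I) \<and> (\<forall>x\<in>I. \<forall>a. a * x \<in> I) \<and>
     (\<forall>x y. x * y \<in> I \<longrightarrow> x \<in> I \<or> y \<in> I) \<and> (\<forall>x. \<forall>s\<in>sums_of_squares. x\<^sup>2 + s \<in> I \<longrightarrow> x \<in> I)"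

section \<open>Maximal real cones\<close>

text \<open>
A real cone consists of the nonnegative elements of a partial ordering of the ring of differences of its members, and
it contains the squares of this ring. The ring in which \<open>T\<close> lives can be an algebraically closed field, whose own squares have
no such meaning.
\<close>

definition real_cone :: "'a::comm_ring_1 set \<Rightarrow> bool" where
  "real_cone T \<longleftrightarrow> 1 \<in> T \<and> (\<forall>x\<in>T. \<forall>y\<in>T. x + y \<in> T \<and> x * y \<in> T \<and> (x - y)\<^sup>2 \<in> T) \<and>
     (\<forall>x\<in>T. - x \<in> T \<longrightarrow> x = 0)"

definition maximal_real_cone :: "'a::comm_ring_1 set \<Rightarrow> bool" where
  "maximal_real_cone T \<longleftrightarrow> real_cone T \<and> (\<forall>T'. real_cone T' \<longrightarrow> T \<subseteq> T' \<longrightarrow> T' = T)"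

definition differences :: "'a::comm_ring_1 set \<Rightarrow> 'a set" where
  "differences T = {x - y | x y. x \<in> T \<and> y \<in> T}"

lemma maximal_real_cone_exists:
  assumes "real_cone T0"
  shows "\<exists>T. maximal_real_cone T \<and> T0 \<subseteq> T"
proof -
  define \<A> where "\<A> = {T. real_cone T \<and> T0 \<subseteq> T}"
  have "\<exists>M\<in>\<A>. \<forall>N\<in>\<A>. M \<subseteq> N \<longrightarrow> N = M"
  proof (rule subset_Zorn_nonempty)
    show "\<A> \<noteq> {}" using assms by (auto simp: \<A>_def)
    fix C assume C: "C \<noteq> {}" "subset.chain \<A> C"
    have cone: "real_cone T" "T0 \<subseteq> T" if "T \<in> C" for T using C(2) that by (auto simp: subset.chain_def \<A>_def)
    have common: "\<exists>T\<in>C. x \<in> T \<and> y \<in> T" if xy: "x \<in> \<Union>C" "y \<in> \<Union>C" for x y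
    proof -
      obtain N Y where "N \<in> C" "Y \<in> C" "x \<in> N" "y \<in> Y" using xy by blast
      moreover have "N \<subseteq> Y \<or> Y \<subseteq> N" using C(2) calculation by (auto simp: subset.chain_def)
      ultimately show ?thesis by blast
    qed
    obtain T where T: "T \<in> C" using C(1) by blast
    have "real_cone (\<Union>C)"
      unfolding real_cone_def
    proof (intro conjI ballI impI)
      show "1 \<in> \<Union>C" using T cone unfolding real_cone_def by blast
      show "x = 0" if "x \<in> \<Union>C" "- x \<in> \<Union>C" for x
        using common[OF that] cone unfolding real_cone_def by blast
      fix x y assume "x \<in> \<Union>C" "y \<in> \<Union>C"
      then obtain N where N: "N \<in> C" "x \<in> N" "y \<in> N" using common by blast
      then have "x + y \<in> N" "x * y \<in> N" "(x - y)\<^sup>2 \<in> N" using cone unfolding real_cone_def by blast+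
      then show "x + y \<in> \<Union>C" "x * y \<in> \<Union>C" "(x - y)\<^sup>2 \<in> \<Union>C" using N by blast+
    qed
    then show "\<Union>C \<in> \<A>" using T cone by (auto simp: \<A>_def)
  qed
  then show ?thesis unfolding maximal_real_cone_def \<A>_def by (auto 4 4)
qed

context
  fixes T :: "'a::comm_ring_1 set"
  assumes T: "real_cone T"
begin

lemma real_cone_closed:
  shows "1 \<in> T" "x \<in> T \<Longrightarrow> y \<in> T \<Longrightarrow> x + y \<in> T" "x \<in> T \<Longrightarrow> y \<in> T \<Longrightarrow> x * y \<in> T"
    "0 \<in> T" "k \<in> differences T \<Longrightarrow> k\<^sup>2 \<in> T" "x \<in> T \<Longrightarrow> - x \<in> T \<Longrightarrow> x = 0"
proof -
  show 1: "1 \<in> T" and "x \<in> T \<Longrightarrow> y \<in> T \<Longrightarrow> x + y \<in> T" "x \<in> T \<Longrightarrow> y \<in> T \<Longrightarrow> x * y \<in> T"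
    and 2: "k \<in> differences T \<Longrightarrow> k\<^sup>2 \<in> T" and "x \<in> T \<Longrightarrow> - x \<in> T \<Longrightarrow> x = 0" for k
    using T unfolding real_cone_def differences_def by blast+
  show "0 \<in> T" using 2[of 0] 1 unfolding differences_def by force
qed

lemma cone_subset_differences: "x \<in> T \<Longrightarrow> x \<in> differences T"
  unfolding differences_def using real_cone_closed(4) by force

lemma subring_set_differences: "subring_set (differences T)"
  unfolding subring_set_def
proof (intro conjI ballI)
  show "1 \<in> differences T" by (rule cone_subset_differences[OF real_cone_closed(1)])
  fix k l assume "k \<in> differences T" "l \<in> differences T"
  then obtain x y u v where k: "x \<in> T" "y \<in> T" "k = x - y" and l: "u \<in> T" "v \<in> T" "l = u - v"
    unfolding differences_def by blast
  have "k - l = (x + v) - (y + u)" using k l by simp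
  then show "k - l \<in> differences T"
    unfolding differences_def using k l real_cone_closed(2) by blast
  have "k * l = (x * u + y * v) - (x * v + y * u)" unfolding k(3) l(3) by (simp add: algebra_simps)
  then show "k * l \<in> differences T"
    unfolding differences_def using k l real_cone_closed(2,3) by blast
qed

end

lemma real_cone_adjoin_element:
  assumes T: "real_cone T" and a: "a \<in> differences T"
    and proper: "\<And>x. x \<in> {s + a * t | s t. s \<in> T \<and> t \<in> T} \<Longrightarrow> - x \<in> {s + a * t | s t. s \<in> T \<and> t \<in> T} \<Longrightarrow> x = 0"
  shows "real_cone {s + a * t | s t. s \<in> T \<and> t \<in> T}" (is "real_cone ?T1")
proof -
  note cl = real_cone_closed[OF T]
  note K = subring_set_closed[OF subring_set_differences[OF T]]
  have mem: "s + a * t \<in> ?T1" if "s \<in> T" "t \<in> T" for s t using that by blast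
  have TT1: "x \<in> ?T1" if "x \<in> T" for x using that cl(4) by force
  show ?thesis
    unfolding real_cone_def
  proof (intro conjI ballI impI)
    show "1 \<in> ?T1" by (rule TT1[OF cl(1)])
    show "x = 0" if "x \<in> ?T1" "- x \<in> ?T1" for x using proper that .
    fix x y assume "x \<in> ?T1" "y \<in> ?T1"
    then obtain s t s' t' where x: "s \<in> T" "t \<in> T" "x = s + a * t" and y: "s' \<in> T" "t' \<in> T" "y = s' + a * t'"
      by blast
    have "x + y = (s + s') + a * (t + t')" unfolding x(3) y(3) by (simp add: algebra_simps)
    then show "x + y \<in> ?T1" using mem[OF cl(2)[OF x(1) y(1)] cl(2)[OF x(2) y(2)]] by simp
    have "x * y = (s * s' + a\<^sup>2 * (t * t')) + a * (s * t' + t * s')"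
      unfolding x(3) y(3) by (simp add: algebra_simps power2_eq_square)
    moreover have "s * s' + a\<^sup>2 * (t * t') \<in> T" "s * t' + t * s' \<in> T"
      using x(1,2) y(1,2) by (auto intro!: cl(2,3) cl(5)[OF a])
    ultimately show "x * y \<in> ?T1" using mem by simp
    have "x - y \<in> differences T"
      unfolding x(3) y(3) using x(1,2) y(1,2) a
      by (auto intro!: K(3,4,6) dest: cone_subset_differences[OF T])
    then show "(x - y)\<^sup>2 \<in> ?T1" by (intro TT1 cl(5))
  qed
qed

text \<open>
If neither \<open>a\<close> nor \<open>- a\<close> could be adjoined to the cone, there would be relations \<open>S = - a U\<close> and \<open>S' = a U'\<close>
with \<open>S\<close>, \<open>U\<close>, \<open>S'\<close> and \<open>U'\<close> in the cone, and then \<open>S U' + S' U = 0\<close> forces \<open>a = 0\<close>.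
\<close>

lemma maximal_real_cone_total:
  fixes T :: "'a::idom set"
  assumes max: "maximal_real_cone T" and a: "a \<in> differences T"
  shows "a \<in> T \<or> - a \<in> T"
proof (rule ccontr)
  assume contra: "\<not> ?thesis"
  have T: "real_cone T" using max by (simp add: maximal_real_cone_def)
  note cl = real_cone_closed[OF T]
  have key: "\<exists>S\<in>T. \<exists>U\<in>T. S = - (b * U) \<and> U \<noteq> 0" if b: "b \<in> differences T" "b \<notin> T" for b
  proof -
    let ?T1 = "{s + b * t | s t. s \<in> T \<and> t \<in> T}"
    have "b = 0 + b * 1" by simp
    then have "b \<in> ?T1" using cl(1,4) by blast
    then have "?T1 \<noteq> T" using b(2) by blast
    moreover have "T \<subseteq> ?T1" using cl(4) by force
    ultimately have "\<not> real_cone ?T1" using max unfolding maximal_real_cone_def by blast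
    then obtain x where "x \<in> ?T1" "- x \<in> ?T1" "x \<noteq> 0" using real_cone_adjoin_element[OF T b(1)] by blast
    then obtain s t s' t' where st: "s \<in> T" "t \<in> T" "x = s + b * t" "s' \<in> T" "t' \<in> T" "- x = s' + b * t'"
      by blast
    have "(s + s') + b * (t + t') = x + - x" unfolding st(6) unfolding st(3) by (simp add: algebra_simps)
    then have "(s + s') + b * (t + t') = 0" by simp
    then have eq: "s + s' = - (b * (t + t'))" by (simp add: eq_neg_iff_add_eq_0)
    have "t + t' \<noteq> 0"
    proof
      assume tt: "t + t' = 0"
      then have "t' = - t" by (simp add: eq_neg_iff_add_eq_0 add.commute)
      then have t0: "t = 0" using st(2,5) cl(6) by blast
      have "s + s' = 0" using eq tt by simp
      then have "s' = - s" by (simp add: eq_neg_iff_add_eq_0 add.commute)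
      then have "s = 0" using st(1,4) cl(6) by blast
      then show False using t0 st(3) \<open>x \<noteq> 0\<close> by simp
    qed
    then show ?thesis using eq cl(2) st by blast
  qed
  have "- a \<in> differences T" using subring_set_closed(5)[OF subring_set_differences[OF T]] a .
  then obtain S U S' U' where SU: "S \<in> T" "U \<in> T" "S = - (a * U)" "U \<noteq> 0"
      "S' \<in> T" "U' \<in> T" "S' = - (- a * U')" "U' \<noteq> 0"
    using key[OF a] key[of "- a"] contra by blast
  have "S * U' = - (S' * U)" using SU by (simp add: algebra_simps)
  then have "S' * U = 0" using cl(3)[OF SU(5,2)] cl(3)[OF SU(1,6)] cl(6) by metis
  then have "S' = 0" using SU by simp
  then have "a = 0" using SU by simp
  then show False using contra cl(4) by simp
qed

text \<open>
The quotients of elements of the cone form a real cone as well.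
\<close>

lemma maximal_real_cone_inverse:
  fixes T :: "'a::field set"
  assumes max: "maximal_real_cone T" and a: "a \<in> T"
  shows "inverse a \<in> T"
proof (cases "a = 0")
  case True
  then show ?thesis using a by simp
next
  case False
  have T: "real_cone T" using max by (simp add: maximal_real_cone_def)
  note cl = real_cone_closed[OF T]
  let ?T1 = "{t / s | t s. t \<in> T \<and> s \<in> T \<and> s \<noteq> 0}"
  have mem: "t / s \<in> ?T1" if "t \<in> T" "s \<in> T" "s \<noteq> 0" for t s using that by blast
  have "real_cone ?T1"
    unfolding real_cone_def
  proof (intro conjI ballI impI)
    show "1 \<in> ?T1" using mem[OF cl(1) cl(1)] by simp
  next
    fix x y assume "x \<in> ?T1" "y \<in> ?T1"
    then obtain t s t' s' where x: "t \<in> T" "s \<in> T" "s \<noteq> 0" "x = t / s"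
      and y: "t' \<in> T" "s' \<in> T" "s' \<noteq> 0" "y = t' / s'" by blast
    have ss: "s * s' \<in> T" "s * s' \<noteq> 0" using x y cl(3) by auto
    have "x + y = (t * s' + t' * s) / (s * s')" using x y by (simp add: field_simps)
    moreover have "t * s' + t' * s \<in> T" using x(1,2) y(1,2) by (intro cl(2,3))
    ultimately show "x + y \<in> ?T1" using mem ss by simp
    have "x * y = (t * t') / (s * s')" using x y by simp
    then show "x * y \<in> ?T1" using mem[OF cl(3)[OF x(1) y(1)] ss] by simp
    have "x - y = (t * s' - t' * s) / (s * s')" unfolding x(4) y(4) by (rule diff_frac_eq[OF x(3) y(3)])
    then have "(x - y)\<^sup>2 = (t * s' - t' * s)\<^sup>2 / (s * s')\<^sup>2" by (simp only: power_divide)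
    moreover have "(t * s' - t' * s)\<^sup>2 \<in> T"
      by (rule cl(5)) (use x y cl(3) in \<open>auto simp: differences_def\<close>)
    moreover have "(s * s')\<^sup>2 \<in> T" using ss cl(3) by (simp add: power2_eq_square)
    ultimately show "(x - y)\<^sup>2 \<in> ?T1" using mem[of "(t * s' - t' * s)\<^sup>2" "(s * s')\<^sup>2"] ss(2) by simp
  next
    fix x assume "x \<in> ?T1" "- x \<in> ?T1"
    then obtain t s t' s' where x: "t \<in> T" "s \<in> T" "s \<noteq> 0" "x = t / s"
      and y: "t' \<in> T" "s' \<in> T" "s' \<noteq> 0" "- x = t' / s'" by blast
    have "t = s * x" using x by simp
    moreover have "t' = s' * - x" unfolding y(4) using y(3) by simp
    ultimately have "t * s' = - (t' * s)" by simp
    then have "- (t' * s) \<in> T" using cl(3)[OF x(1) y(2)] by simp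
    then have "t' * s = 0" using cl(3)[OF y(1) x(2)] cl(6) by blast
    then show "x = 0" using x y by simp
  qed
  moreover have "T \<subseteq> ?T1"
  proof
    fix x assume "x \<in> T"
    then show "x \<in> ?T1" using mem[OF _ cl(1), of x] by simp
  qed
  ultimately have "?T1 = T" using max by (simp add: maximal_real_cone_def)
  then show ?thesis using mem[OF cl(1) a False] by (simp add: divide_inverse)
qed

section \<open>Sign-changing irreducible divisors of weighted sums of squares\<close>

definition weighted_squares :: "('a::linordered_field \<times> 'a poly) list \<Rightarrow> 'a poly" where
  "weighted_squares xs = (\<Sum>(t, g)\<leftarrow>xs. smult t (g\<^sup>2))"

lemma weighted_squares_simps [simp]:
  "weighted_squares [] = 0"
  "weighted_squares ((t, g) # xs) = smult t (g\<^sup>2) + weighted_squares xs"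
  by (simp_all add: weighted_squares_def)

lemma weighted_squares_nonneg:
  assumes "\<forall>(t, g)\<in>set xs. 0 < t"
  shows "0 \<le> poly (weighted_squares xs) a"
    and "poly (weighted_squares xs) a = 0 \<Longrightarrow> \<forall>(t, g)\<in>set xs. poly g a = 0"
proof -
  have "0 \<le> poly (weighted_squares xs) a \<and>
    (poly (weighted_squares xs) a = 0 \<longrightarrow> (\<forall>(t, g)\<in>set xs. poly g a = 0))"
    using assms
  proof (induction xs)
    case Nil then show ?case by simp
  next
    case (Cons y xs)
    obtain t g where y: "y = (t, g)" by force
    have "0 \<le> t * (poly g a)\<^sup>2" using Cons.prems y by simp
    moreover have "t * (poly g a)\<^sup>2 = 0 \<longleftrightarrow> poly g a = 0" using Cons.prems y by simp
    ultimately show ?case using Cons y by (auto simp: add_nonneg_eq_0_iff)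
  qed
  then show "0 \<le> poly (weighted_squares xs) a"
    and "poly (weighted_squares xs) a = 0 \<Longrightarrow> \<forall>(t, g)\<in>set xs. poly g a = 0" by blast+
qed

lemma degree_weighted_squares:
  assumes "\<forall>(t, g)\<in>set xs. degree g \<le> n"
  shows "degree (weighted_squares xs) \<le> 2 * n"
  using assms
proof (induction xs)
  case Nil then show ?case by simp
next
  case (Cons y xs)
  obtain t g where y: "y = (t, g)" by force
  have "degree (smult t (g\<^sup>2)) \<le> 2 * degree g"
    by (rule order.trans[OF degree_smult_le]) (simp add: degree_power_le mult.commute)
  also have "\<dots> \<le> 2 * n" using Cons.prems y by simp
  finally show ?case using Cons y by (simp add: degree_add_le)
qed

lemma sign_changing_irreducible_factor:
  fixes h :: "'a::linordered_field poly"
  assumes "poly h a * poly h b < 0"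
  obtains h0 where "irreducible h0" "h0 dvd h" "poly h0 a * poly h0 b < 0"
proof -
  have "\<exists>h0. irreducible h0 \<and> h0 dvd h \<and> poly h0 a * poly h0 b < 0"
    using assms
  proof (induction "degree h" arbitrary: h rule: less_induct)
    case less
    show ?case
    proof (cases "irreducible h")
      case True then show ?thesis using less.prems by auto
    next
      case False
      have h0: "h \<noteq> 0" using less.prems by auto
      have "degree h \<noteq> 0"
      proof
        assume "degree h = 0"
        then obtain c where "h = [:c:]" by (meson degree_eq_zeroE)
        then show False using less.prems by (simp add: mult_less_0_iff)
      qed
      then have "\<not> h dvd 1" using h0 by (simp add: is_unit_iff_degree)
      then obtain u v where uv: "h = u * v" "\<not> u dvd 1" "\<not> v dvd 1"
        using False h0 unfolding irreducible_def by blast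
      have nz: "u \<noteq> 0" "v \<noteq> 0" using uv h0 by auto
      have deg: "degree u < degree h" "degree v < degree h"
        using uv nz by (auto simp: is_unit_iff_degree degree_mult_eq)
      have "(poly u a * poly u b) * (poly v a * poly v b) < 0"
        using less.prems uv by (simp add: algebra_simps)
      then have "poly u a * poly u b < 0 \<or> poly v a * poly v b < 0"
        by (meson mult_less_0_iff)
      then show ?thesis
      proof
        assume "poly u a * poly u b < 0"
        then show ?thesis using less.hyps[OF deg(1)] uv(1) by auto
      next
        assume "poly v a * poly v b < 0"
        then show ?thesis using less.hyps[OF deg(2)] uv(1) by auto
      qed
    qed
  qed
  then show ?thesis using that by blast
qed

lemma weighted_squares_divide:
  assumes "\<forall>(t, g)\<in>set xs. l dvd g"
  shows "weighted_squares xs = l\<^sup>2 * weighted_squares (map (\<lambda>(t, g). (t, g div l)) xs)"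
  using assms by (induction xs) (auto simp: algebra_simps power2_eq_square)

lemma weighted_squares_mod:
  "f dvd weighted_squares xs \<longleftrightarrow> f dvd weighted_squares (map (\<lambda>(t, g). (t, g mod f)) xs)"
proof -
  have "f dvd weighted_squares xs - weighted_squares (map (\<lambda>(t, g). (t, g mod f)) xs)"
  proof (induction xs)
    case Nil then show ?case by simp
  next
    case (Cons y xs)
    obtain t g where y: "y = (t, g)" by force
    have "f dvd g - g mod f" by (rule dvd_minus_mod)
    then have "f dvd smult t ((g - g mod f) * (g + g mod f))" by (intro dvd_smult dvd_mult2)
    also have "smult t ((g - g mod f) * (g + g mod f)) = smult t (g\<^sup>2) - smult t ((g mod f)\<^sup>2)"
      by (simp add: algebra_simps power2_eq_square smult_diff_right)
    finally show ?case using Cons y dvd_add by (fastforce simp: algebra_simps)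
  qed
  then show ?thesis using dvd_add_right_iff by (metis diff_add_cancel)
qed

text \<open>
This is the heart of the theorem of Artin and Schreier that an ordering extends to the field obtained by adjoining a root of
a sign-changing irreducible polynomial \<open>f\<close>. Reduce the \<open>g\<close> modulo \<open>f\<close> and write the sum of squares as \<open>f h\<close>;
then \<open>h\<close> has smaller degree than \<open>f\<close>. If the sum vanishes at \<open>a\<close> or at \<open>b\<close>, all \<open>g\<close> share the corresponding
linear factor. Otherwise it is positive at both points, so \<open>h\<close> changes sign there and has a sign-changing irreducible factor,
which divides all \<open>g\<close> by induction on the degree of \<open>f\<close>. In both cases a common factor prime to \<open>f\<close>
can be cancelled, and the degree of the sum drops.
\<close>

lemma irreducible_dvd_weighted_squares:
  fixes f :: "'a::linordered_field poly"
  assumes "irreducible f" "poly f a * poly f b < 0" "\<forall>(t, g)\<in>set xs. 0 < t" "f dvd weighted_squares xs"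
  shows "\<forall>(t, g)\<in>set xs. f dvd g"
  using assms
proof (induction "degree f" arbitrary: f xs rule: less_induct)
  case less
  note IH = less.hyps
  have f0: "f \<noteq> 0" and prime: "prime_elem f" and nu: "\<not> f dvd 1"
    using less.prems(1) field_poly_irreducible_imp_prime by (auto simp: irreducible_def)
  have df: "degree f > 0" using nu f0 by (simp add: is_unit_iff_degree)
  have reduced: "\<forall>(t, g)\<in>set ys. f dvd g"
    if "\<forall>(t, g)\<in>set ys. 0 < t \<and> degree g < degree f" "f dvd weighted_squares ys" for ys
    using that
  proof (induction "degree (weighted_squares ys)" arbitrary: ys rule: less_induct)
    case (less ys)
    have pos: "\<forall>(t, g)\<in>set ys. 0 < t" using less.prems by auto
    obtain h where h: "weighted_squares ys = f * h" using less.prems(2) by (elim dvdE)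
    show ?case
    proof (cases "weighted_squares ys = 0")
      case True
      have "g = 0" if "(t, g) \<in> set ys" for t g
        using weighted_squares_nonneg(2)[OF pos] that True by (intro poly_all_0_iff_0[THEN iffD1]) auto
      then show ?thesis by auto
    next
      case False
      then have h0: "h \<noteq> 0" using h by auto
      have "degree (weighted_squares ys) \<le> 2 * (degree f - 1)"
        by (rule degree_weighted_squares) (use less.prems in fastforce)
      then have dh: "degree h < degree f" using h f0 h0 df by (simp add: degree_mult_eq)
      have "\<exists>l. irreducible l \<and> \<not> l dvd f \<and> (\<forall>(t, g)\<in>set ys. l dvd g)"
      proof (cases "poly (weighted_squares ys) a = 0 \<or> poly (weighted_squares ys) b = 0")
        case True
        moreover have "poly f a \<noteq> 0" "poly f b \<noteq> 0" using \<open>poly f a * poly f b < 0\<close> by auto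
        ultimately obtain c where c: "poly (weighted_squares ys) c = 0" "poly f c \<noteq> 0" by blast
        then have "\<forall>(t, g)\<in>set ys. [:-c, 1:] dvd g"
          using weighted_squares_nonneg(2)[OF pos c(1)] by (simp add: poly_eq_0_iff_dvd)
        moreover have "\<not> [:-c, 1:] dvd f" using c(2) by (simp add: poly_eq_0_iff_dvd)
        moreover have "irreducible [:-c, 1:]" by (rule irreducible_linear_field_poly) simp
        ultimately show ?thesis by blast
      next
        case F: False
        then have "0 < poly (weighted_squares ys) a" "0 < poly (weighted_squares ys) b"
          using weighted_squares_nonneg(1)[OF pos, of a] weighted_squares_nonneg(1)[OF pos, of b] by auto
        then have "0 < (poly f a * poly h a) * (poly f b * poly h b)"
          unfolding h poly_mult by (rule mult_pos_pos)
        then have "0 < (poly f a * poly f b) * (poly h a * poly h b)" by (simp add: ac_simps)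
        then have "poly h a * poly h b < 0"
          using \<open>poly f a * poly f b < 0\<close> zero_less_mult_pos2 zero_less_mult_iff
          by (metis order_less_asym)
        then obtain l where l: "irreducible l" "l dvd h" "poly l a * poly l b < 0"
          by (rule sign_changing_irreducible_factor)
        have "degree l \<le> degree h" using l(2) h0 by (rule dvd_imp_degree_le)
        then have dl: "degree l < degree f" using dh by simp
        have "l dvd weighted_squares ys" using l(2) h by simp
        then have "\<forall>(t, g)\<in>set ys. l dvd g" using IH[OF dl l(1,3) pos] by blast
        moreover have "\<not> l dvd f"
        proof
          assume "l dvd f"
          then have "f dvd l"
            using \<open>irreducible f\<close> l(1) by (meson irreducible_altdef irreducible_not_unit)
          then have "degree f \<le> degree l" using l(1) by (intro dvd_imp_degree_le) auto
          then show False using dl by simp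
        qed
        ultimately show ?thesis using l(1) by blast
      qed
      then obtain l where l: "irreducible l" "\<not> l dvd f" "\<forall>(t, g)\<in>set ys. l dvd g" by blast
      define zs where "zs = map (\<lambda>(t, g). (t, g div l)) ys"
      have w: "weighted_squares ys = l\<^sup>2 * weighted_squares zs"
        unfolding zs_def by (rule weighted_squares_divide[OF l(3)])
      have "\<not> f dvd l"
        using l(1,2) nu by (meson irreducible_altdef)
      then have fz: "f dvd weighted_squares zs"
        using less.prems(2) prime unfolding w power2_eq_square
        by (metis prime_elem_dvd_mult_iff)
      have ln: "l \<noteq> 0" "0 < degree l" using l(1) by (auto simp: irreducible_def is_unit_iff_degree)
      have "degree (weighted_squares zs) < degree (weighted_squares ys)"
        using False ln unfolding w by (simp add: degree_mult_eq degree_power_eq)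
      moreover have "\<forall>(t, g)\<in>set zs. 0 < t \<and> degree g < degree f"
      proof (clarsimp simp: zs_def)
        fix t g assume "(t, g) \<in> set ys"
        then have *: "0 < t" "degree g < degree f" "l dvd g" using less.prems(1) l(3) by auto
        have "degree (g div l) \<le> degree g"
          using *(3) by (metis degree_0 div_0 dvd_div_mult_self dvd_imp_degree_le dvd_triv_left le_refl)
        then show "0 < t \<and> degree (g div l) < degree f" using * by simp
      qed
      ultimately have "\<forall>(t, g)\<in>set zs. f dvd g" using less.hyps fz by blast
      then show ?thesis using l(3) unfolding zs_def by (fastforce dest: dvd_div_mult_self[symmetric] intro: dvd_mult2)
    qed
  qed
  let ?ys = "map (\<lambda>(t, g). (t, g mod f)) xs"
  have "degree (g mod f) < degree f" for g
    using degree_mod_less[OF f0, of g] df by auto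
  then have "\<forall>(t, g)\<in>set ?ys. f dvd g"
    by (intro reduced) (use less.prems(3,4) weighted_squares_mod[of f xs] in auto)
  then show ?case by (auto simp: dvd_mod_iff)
qed

section \<open>The residue ring of a real prime ideal\<close>

text \<open>
An unrealised ideal is a counterexample to the real Nullstellensatz for real prime ideals.
\<close>

definition unrealised :: "'n::finite rpoly set \<Rightarrow> bool" where
  "unrealised I \<longleftrightarrow> real_prime_ideal I \<and> (\<exists>F q. finite F \<and> F \<subseteq> I \<and> q \<notin> I \<and>
     (\<forall>u. (\<forall>p\<in>F. eval_poly p u = 0) \<longrightarrow> eval_poly q u = 0))"

text \<open>
The residue ring and the real closed field over it are to be types, and a type cannot depend on a variable
ideal. The ideal is therefore fixed by choice, and it is a counterexample if there is any. The
ideal of a point shows that the choice is possible in either case.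
\<close>

definition chosen_ideal :: "'n::finite rpoly set" where
  "chosen_ideal = (SOME I. real_prime_ideal I \<and> ((\<exists>J :: 'n rpoly set. unrealised J) \<longrightarrow> unrealised I))"

lemma real_prime_ideal_of_point: "real_prime_ideal {p. eval_poly p u = 0}"
proof -
  have sos: "0 \<le> eval_poly s u" if "s \<in> sums_of_squares" for s
    using that by (induction s rule: sums_of_squares_induct)
      (auto simp: eval_poly_zero eval_poly_add power2_eq_square eval_poly_mult)
  have real: "eval_poly x u = 0" if "s \<in> sums_of_squares" "eval_poly (x\<^sup>2 + s) u = 0" for x s
    using sos[OF that(1)] that(2) by (simp add: eval_poly_add power2_eq_square eval_poly_mult add_nonneg_eq_0_iff)
  show ?thesis unfolding real_prime_ideal_def mem_Collect_eq
  proof (intro conjI ballI allI impI)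
    show "eval_poly x u = 0" if "s \<in> sums_of_squares" "eval_poly (x\<^sup>2 + s) u = 0" for x s
      by (rule real[OF that])
  qed (simp_all add: eval_poly_zero eval_poly_one eval_poly_add eval_poly_mult)
qed

lemma chosen_ideal:
  shows "real_prime_ideal (chosen_ideal :: 'n::finite rpoly set)"
    and "(\<exists>J :: 'n rpoly set. unrealised J) \<Longrightarrow> unrealised (chosen_ideal :: 'n::finite rpoly set)"
proof -
  have "\<exists>I :: 'n rpoly set. real_prime_ideal I \<and> ((\<exists>J :: 'n rpoly set. unrealised J) \<longrightarrow> unrealised I)"
    using real_prime_ideal_of_point unfolding unrealised_def by (metis (no_types, lifting))
  from someI_ex[OF this] show "real_prime_ideal (chosen_ideal :: 'n rpoly set)"
    and "(\<exists>J :: 'n rpoly set. unrealised J) \<Longrightarrow> unrealised (chosen_ideal :: 'n rpoly set)"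
    unfolding chosen_ideal_def by blast+
qed

lemma real_prime_ideal_closed:
  assumes "real_prime_ideal I"
  shows "0 \<in> I" "1 \<notin> I" "x \<in> I \<Longrightarrow> y \<in> I \<Longrightarrow> x + y \<in> I" "x \<in> I \<Longrightarrow> a * x \<in> I"
    "x \<in> I \<Longrightarrow> x * a \<in> I" "x \<in> I \<Longrightarrow> - x \<in> I" "x \<in> I \<Longrightarrow> y \<in> I \<Longrightarrow> x - y \<in> I" "x * y \<in> I \<Longrightarrow> x \<in> I \<or> y \<in> I"
    "s \<in> sums_of_squares \<Longrightarrow> x\<^sup>2 + s \<in> I \<Longrightarrow> x \<in> I"
proof -
  show 0: "0 \<in> I" "1 \<notin> I" and add: "\<And>x y. x \<in> I \<Longrightarrow> y \<in> I \<Longrightarrow> x + y \<in> I"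
    and m: "\<And>x a. x \<in> I \<Longrightarrow> a * x \<in> I"
    and "x * y \<in> I \<Longrightarrow> x \<in> I \<or> y \<in> I" "s \<in> sums_of_squares \<Longrightarrow> x\<^sup>2 + s \<in> I \<Longrightarrow> x \<in> I"
    using assms unfolding real_prime_ideal_def by blast+
  show "x \<in> I \<Longrightarrow> x * a \<in> I" using m[of x a] by (simp add: mult.commute)
  show minus: "- x \<in> I" if "x \<in> I" for x using m[OF that, of "- 1"] by simp
  show "x \<in> I \<Longrightarrow> y \<in> I \<Longrightarrow> x - y \<in> I" using add[of x "- y"] minus by simp
qed

lemma real_prime_ideal_sum_of_squares:
  assumes I: "real_prime_ideal I" and "s \<in> sums_of_squares" "t \<in> sums_of_squares" "s + t \<in> I"
  shows "s \<in> I"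
  using assms(2-)
proof (induction s arbitrary: t rule: sums_of_squares_induct)
  case zero
  then show ?case using real_prime_ideal_closed(1)[OF I] by simp
next
  case (add q s)
  note cl = real_prime_ideal_closed[OF I]
  have "q \<in> I" by (rule cl(9)[of "s + t"]) (use add in \<open>auto simp: add.assoc intro: sums_of_squares_add\<close>)
  then have q2: "q\<^sup>2 \<in> I" using cl(4) by (simp add: power2_eq_square)
  have "s + t \<in> I" using cl(7)[OF add.prems(2) q2] by simp
  then have "s \<in> I" using add.IH add.prems by blast
  then show ?case using q2 cl(3) by blast
qed

definition residue_rel :: "'n::finite rpoly \<Rightarrow> 'n rpoly \<Rightarrow> bool" where
  "residue_rel p q \<longleftrightarrow> p - q \<in> chosen_ideal"

lemma equivp_residue_rel: "equivp (residue_rel :: 'n::finite rpoly \<Rightarrow> 'n rpoly \<Rightarrow> bool)"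
proof (rule equivpI)
  note cl = real_prime_ideal_closed[OF chosen_ideal(1)]
  show "reflp (residue_rel :: 'n rpoly \<Rightarrow> 'n rpoly \<Rightarrow> bool)" by (rule reflpI) (simp add: residue_rel_def cl(1))
  show "symp (residue_rel :: 'n rpoly \<Rightarrow> 'n rpoly \<Rightarrow> bool)" by (rule sympI) (metis residue_rel_def cl(6) minus_diff_eq)
  show "transp (residue_rel :: 'n rpoly \<Rightarrow> 'n rpoly \<Rightarrow> bool)"
  proof (rule transpI)
    fix p q r :: "'n rpoly" assume "residue_rel p q" "residue_rel q r"
    then have "(p - q) + (q - r) \<in> chosen_ideal" unfolding residue_rel_def by (rule cl(3))
    then show "residue_rel p r" by (simp add: residue_rel_def)
  qed
qed

quotient_type (overloaded) 'n residue = "('n::finite \<Rightarrow>\<^sub>0 nat) \<Rightarrow>\<^sub>0 real" / residue_rel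
  by (rule equivp_residue_rel)

instantiation residue :: (finite) idom
begin

lift_definition zero_residue :: "'a residue" is "0" .
lift_definition one_residue :: "'a residue" is "1" .

lift_definition plus_residue :: "'a residue \<Rightarrow> 'a residue \<Rightarrow> 'a residue" is "(+)"
proof -
  fix p q r s :: "'a rpoly"
  assume "residue_rel p q" "residue_rel r s"
  then have "(p - q) + (r - s) \<in> chosen_ideal"
    unfolding residue_rel_def by (rule real_prime_ideal_closed(3)[OF chosen_ideal(1)])
  then show "residue_rel (p + r) (q + s)" by (simp add: residue_rel_def algebra_simps)
qed

lift_definition minus_residue :: "'a residue \<Rightarrow> 'a residue \<Rightarrow> 'a residue" is "(-)"
proof -
  fix p q r s :: "'a rpoly"
  assume "residue_rel p q" "residue_rel r s"
  then have "(p - q) - (r - s) \<in> chosen_ideal"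
    unfolding residue_rel_def by (rule real_prime_ideal_closed(7)[OF chosen_ideal(1)])
  then show "residue_rel (p - r) (q - s)" by (simp add: residue_rel_def algebra_simps)
qed

lift_definition uminus_residue :: "'a residue \<Rightarrow> 'a residue" is "uminus"
proof -
  fix p q :: "'a rpoly"
  assume "residue_rel p q"
  then have "- (p - q) \<in> chosen_ideal"
    unfolding residue_rel_def by (rule real_prime_ideal_closed(6)[OF chosen_ideal(1)])
  then show "residue_rel (- p) (- q)" by (simp add: residue_rel_def)
qed

lift_definition times_residue :: "'a residue \<Rightarrow> 'a residue \<Rightarrow> 'a residue" is "(*)"
proof -
  fix p q r s :: "'a rpoly"
  assume "residue_rel p q" "residue_rel r s"
  then have "r * (p - q) + q * (r - s) \<in> chosen_ideal"
    unfolding residue_rel_def by (intro real_prime_ideal_closed(3,4)[OF chosen_ideal(1)])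
  then show "residue_rel (p * r) (q * s)" by (simp add: residue_rel_def algebra_simps)
qed

instance
proof
  note refl = equivp_reflp[OF equivp_residue_rel]
  fix a b c :: "'a residue"
  show "a * b * c = a * (b * c)" by transfer (simp add: refl mult.assoc)
  show "a * b = b * a" by transfer (simp add: refl mult.commute)
  show "1 * a = a" by transfer (simp add: refl)
  show "a + b + c = a + (b + c)" by transfer (simp add: refl add.assoc)
  show "a + b = b + a" by transfer (simp add: refl add.commute)
  show "0 + a = a" by transfer (simp add: refl)
  show "- a + a = 0" by transfer (simp add: refl)
  show "a - b = a + - b" by transfer (simp add: refl)
  show "(a + b) * c = a * c + b * c" by transfer (simp add: refl distrib_right)
  show "a * (b + c) = a * b + a * c" by transfer (simp add: refl distrib_left)
  show "0 * a = 0" "a * 0 = 0" by (transfer; simp add: refl)+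
  show "(0::'a residue) \<noteq> 1"
  proof transfer
    have "- (1::'a rpoly) \<notin> chosen_ideal"
      using real_prime_ideal_closed(2,6)[OF chosen_ideal(1)] by (metis add.inverse_inverse)
    then show "\<not> residue_rel 0 (1::'a rpoly)" by (simp add: residue_rel_def)
  qed
  show "a \<noteq> 0 \<Longrightarrow> b \<noteq> 0 \<Longrightarrow> a * b \<noteq> 0"
    by transfer (use real_prime_ideal_closed(8)[OF chosen_ideal(1)] in \<open>auto simp: residue_rel_def\<close>)
qed

end

definition residue_embedding :: "'n::finite rpoly \<Rightarrow> 'n residue fract alg_closure" where
  "residue_embedding p = to_ac (Fract (abs_residue p) 1)"

lemma ring_morphism_residue_embedding: "ring_morphism residue_embedding"
  unfolding ring_morphism_def residue_embedding_def
  by (auto simp: One_fract_def to_ac_1[symmetric] one_residue_def[symmetric] plus_residue.abs_eq[symmetric] times_residue.abs_eq[symmetric]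
      simp flip: to_ac_add to_ac_mult)

lemma residue_embedding_eq_0_iff: "residue_embedding p = 0 \<longleftrightarrow> p \<in> chosen_ideal"
proof -
  have "residue_embedding p = 0 \<longleftrightarrow> abs_residue p = 0"
    by (simp add: residue_embedding_def Zero_fract_def eq_fract)
  also have "\<dots> \<longleftrightarrow> p \<in> chosen_ideal"
    by (simp add: zero_residue_def residue.abs_eq_iff residue_rel_def)
  finally show ?thesis .
qed

text \<open>
This uses that the ideal is real: if two sums of squares add up to a member of the ideal, both lie in it.
\<close>

lemma real_cone_residue_squares: "real_cone (residue_embedding ` (sums_of_squares :: 'n::finite rpoly set))"
  unfolding real_cone_def
proof (intro conjI ballI impI)
  note rm = ring_morphism_simps[OF ring_morphism_residue_embedding]
  have mem: "residue_embedding s \<in> residue_embedding ` (sums_of_squares :: 'n rpoly set)" if "s \<in> sums_of_squares" for s :: "'n rpoly"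
    using that by blast
  show "1 \<in> residue_embedding ` (sums_of_squares :: 'n rpoly set)"
    using mem[OF sums_of_squares_square[of 1]] by (simp add: rm)
  fix x assume "x \<in> residue_embedding ` (sums_of_squares :: 'n rpoly set)"
  then obtain s where s: "s \<in> sums_of_squares" "x = residue_embedding s" by blast
  show "x = 0" if neg: "- x \<in> residue_embedding ` (sums_of_squares :: 'n rpoly set)"
  proof -
    obtain t where t: "t \<in> sums_of_squares" "- x = residue_embedding t" using neg by blast
    have "residue_embedding (s + t) = 0" unfolding rm s(2)[symmetric] t(2)[symmetric] by simp
    then have "s \<in> chosen_ideal"
      unfolding residue_embedding_eq_0_iff
      using real_prime_ideal_sum_of_squares[OF chosen_ideal(1) s(1) t(1)] by blast
    then show ?thesis using s(2) residue_embedding_eq_0_iff by blast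
  qed
  fix y assume "y \<in> residue_embedding ` (sums_of_squares :: 'n rpoly set)"
  then obtain t where t: "t \<in> sums_of_squares" "y = residue_embedding t" by blast
  show "x + y \<in> residue_embedding ` (sums_of_squares :: 'n rpoly set)"
    using mem[OF sums_of_squares_add[OF s(1) t(1)]] by (simp add: rm s t)
  show "x * y \<in> residue_embedding ` (sums_of_squares :: 'n rpoly set)"
    using mem[OF sums_of_squares_mult[OF s(1) t(1)]] by (simp add: rm s t)
  show "(x - y)\<^sup>2 \<in> residue_embedding ` (sums_of_squares :: 'n rpoly set)"
    using mem[OF sums_of_squares_square[of "s - t"]] by (simp add: rm s t)
qed

definition closure_cone :: "'n::finite residue fract alg_closure set" where
  "closure_cone = (SOME T. maximal_real_cone T \<and> residue_embedding ` sums_of_squares \<subseteq> T)"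

lemma closure_cone:
  "maximal_real_cone (closure_cone :: 'n::finite residue fract alg_closure set)"
  "residue_embedding ` sums_of_squares \<subseteq> (closure_cone :: 'n residue fract alg_closure set)"
proof -
  from someI_ex[OF maximal_real_cone_exists[OF real_cone_residue_squares]]
  show "maximal_real_cone (closure_cone :: 'n residue fract alg_closure set)"
    "residue_embedding ` sums_of_squares \<subseteq> (closure_cone :: 'n residue fract alg_closure set)"
    unfolding closure_cone_def by blast+
qed

section \<open>A real closed field over the residue ring\<close>

lemma closure_cone_real: "real_cone closure_cone"
  by (rule closure_cone(1)[unfolded maximal_real_cone_def, THEN conjunct1])

lemmas closure_cone_closed = real_cone_closed[OF closure_cone_real]
lemmas closure_field_closed = subring_set_closed[OF subring_set_differences[OF closure_cone_real]]
lemmas closure_cone_subset = cone_subset_differences[OF closure_cone_real]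

lemma closure_field_inverse: "k \<in> differences closure_cone \<Longrightarrow> inverse k \<in> differences closure_cone"
proof -
  assume "k \<in> differences closure_cone"
  then have "k \<in> closure_cone \<or> - k \<in> closure_cone" by (rule maximal_real_cone_total[OF closure_cone(1)])
  then have "inverse k \<in> differences closure_cone \<or> - inverse k \<in> differences closure_cone"
    using maximal_real_cone_inverse[OF closure_cone(1), THEN closure_cone_subset] by (metis inverse_minus_eq)
  then show ?thesis using closure_field_closed(5) by (metis add.inverse_inverse)
qed

typedef (overloaded) 'n real_closure = "differences (closure_cone :: 'n::finite residue fract alg_closure set)"
  using closure_field_closed(2) by blast

setup_lifting type_definition_real_closure

instantiation real_closure :: (finite) linordered_field
begin

lift_definition zero_real_closure :: "'a real_closure" is 0 by (rule closure_field_closed)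
lift_definition one_real_closure :: "'a real_closure" is 1 by (rule closure_field_closed)
lift_definition plus_real_closure :: "'a real_closure \<Rightarrow> 'a real_closure \<Rightarrow> 'a real_closure" is "(+)"
  by (rule closure_field_closed)
lift_definition minus_real_closure :: "'a real_closure \<Rightarrow> 'a real_closure \<Rightarrow> 'a real_closure" is "(-)"
  by (rule closure_field_closed)
lift_definition uminus_real_closure :: "'a real_closure \<Rightarrow> 'a real_closure" is uminus
  by (rule closure_field_closed)
lift_definition times_real_closure :: "'a real_closure \<Rightarrow> 'a real_closure \<Rightarrow> 'a real_closure" is "(*)"
  by (rule closure_field_closed)
lift_definition inverse_real_closure :: "'a real_closure \<Rightarrow> 'a real_closure" is inverse
  by (rule closure_field_inverse)
lift_definition divide_real_closure :: "'a real_closure \<Rightarrow> 'a real_closure \<Rightarrow> 'a real_closure" is "(/)"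
  unfolding divide_inverse by (intro closure_field_closed closure_field_inverse)
lift_definition less_eq_real_closure :: "'a real_closure \<Rightarrow> 'a real_closure \<Rightarrow> bool"
  is "\<lambda>x y. y - x \<in> closure_cone" .

definition less_real_closure :: "'a real_closure \<Rightarrow> 'a real_closure \<Rightarrow> bool" where
  "less_real_closure x y \<longleftrightarrow> x \<le> y \<and> \<not> y \<le> x"
definition abs_real_closure :: "'a real_closure \<Rightarrow> 'a real_closure" where
  "abs_real_closure x = (if x < 0 then - x else x)"
definition sgn_real_closure :: "'a real_closure \<Rightarrow> 'a real_closure" where
  "sgn_real_closure x = (if x = 0 then 0 else if 0 < x then 1 else - 1)"

instance
proof
  fix a b c :: "'a real_closure"
  show "a * b * c = a * (b * c)" by transfer (simp add: mult.assoc)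
  show "a * b = b * a" by transfer (simp add: mult.commute)
  show "1 * a = a" by transfer simp
  show "a + b + c = a + (b + c)" by transfer (simp add: add.assoc)
  show "a + b = b + a" by transfer (simp add: add.commute)
  show "0 + a = a" by transfer simp
  show "- a + a = 0" by transfer simp
  show "a - b = a + - b" by transfer simp
  show "(a + b) * c = a * c + b * c" by transfer (simp add: distrib_right)
  show "(0::'a real_closure) \<noteq> 1" by transfer simp
  show "a \<noteq> 0 \<Longrightarrow> inverse a * a = 1" by transfer simp
  show "a div b = a * inverse b" by transfer (simp add: divide_inverse)
  show "inverse (0::'a real_closure) = 0" by transfer simp
  show "a < b \<longleftrightarrow> a \<le> b \<and> \<not> b \<le> a" by (rule less_real_closure_def)
  show "a \<le> a" by transfer (simp add: closure_cone_closed)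
  show "a \<le> c" if "a \<le> b" "b \<le> c" using that
  proof transfer
    fix a b c :: "'a residue fract alg_closure"
    assume "b - a \<in> closure_cone" "c - b \<in> closure_cone"
    then have "(b - a) + (c - b) \<in> closure_cone" by (rule closure_cone_closed)
    then show "c - a \<in> closure_cone" by simp
  qed
  show antisym: "a = b" if "a \<le> b" "b \<le> a" for a b :: "'a real_closure" using that
  proof transfer
    fix a b :: "'a residue fract alg_closure"
    assume "b - a \<in> closure_cone" "a - b \<in> closure_cone"
    then have "b - a = 0" using closure_cone_closed(6)[of "b - a"] by simp
    then show "a = b" by simp
  qed
  show "a \<le> b \<or> b \<le> a"
  proof transfer
    fix a b :: "'a residue fract alg_closure"
    assume "a \<in> differences closure_cone" "b \<in> differences closure_cone"
    then have "b - a \<in> differences closure_cone" by (intro closure_field_closed)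
    then have "b - a \<in> closure_cone \<or> - (b - a) \<in> closure_cone"
      by (rule maximal_real_cone_total[OF closure_cone(1)])
    then show "b - a \<in> closure_cone \<or> a - b \<in> closure_cone" by simp
  qed
  show "c + a \<le> c + b" if "a \<le> b" using that by transfer simp
  show "c * a < c * b" if ab: "a < b" and c: "0 < c"
  proof -
    have le: "a \<le> b" "0 \<le> c" and ne: "a \<noteq> b" "c \<noteq> 0" using ab c by (auto simp: less_real_closure_def)
    have "c * a \<le> c * b" using le
    proof transfer
      fix a b c :: "'a residue fract alg_closure"
      assume "b - a \<in> closure_cone" "c - 0 \<in> closure_cone"
      then have "(c - 0) * (b - a) \<in> closure_cone" by (intro closure_cone_closed)
      then show "c * b - c * a \<in> closure_cone" by (simp add: algebra_simps)
    qed
    moreover have "c * a \<noteq> c * b" using ne by transfer simp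
    ultimately show ?thesis using antisym unfolding less_real_closure_def by blast
  qed
  show "a + b - a = b" "a - b - c = a - (b + c)" "0 * a = 0" "a * 0 = 0" by (transfer; simp)+
  show "\<bar>a\<bar> = (if a < 0 then - a else a)" by (rule abs_real_closure_def)
  show "sgn a = (if a = 0 then 0 else if 0 < a then 1 else - 1)" by (rule sgn_real_closure_def)
qed

end

lemma ring_morphism_Rep_real_closure: "ring_morphism Rep_real_closure"
  by (simp add: ring_morphism_def one_real_closure.rep_eq plus_real_closure.rep_eq times_real_closure.rep_eq)

lemma Rep_real_closure_eq_0_iff: "Rep_real_closure x = 0 \<longleftrightarrow> x = 0"
  by (metis Rep_real_closure_inject zero_real_closure.rep_eq)

lemma Rep_real_closure_cone: "Rep_real_closure x \<in> closure_cone \<longleftrightarrow> 0 \<le> x"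
  by transfer simp

lemma weighted_squares_append: "weighted_squares (xs @ ys) = weighted_squares xs + weighted_squares ys"
  by (simp add: weighted_squares_def)

lemma weighted_squares_mult:
  assumes "\<forall>(t, g)\<in>set xs. 0 < t" "\<forall>(t, g)\<in>set ys. 0 < t"
  shows "\<exists>zs. (\<forall>(t, g)\<in>set zs. 0 < t) \<and> weighted_squares xs * weighted_squares ys = weighted_squares zs"
  using assms(1)
proof (induction xs)
  case Nil
  then show ?case by (intro exI[of _ "[]"]) simp
next
  case (Cons y xs)
  obtain t g where y: "y = (t, g)" by force
  obtain zs where zs: "\<forall>(t, g)\<in>set zs. 0 < t" "weighted_squares xs * weighted_squares ys = weighted_squares zs"
    using Cons by auto
  have "smult t (g\<^sup>2) * weighted_squares us = weighted_squares (map (\<lambda>(s, f). (t * s, g * f)) us)" for us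
    by (induction us) (auto simp: distrib_left smult_add_right power_mult_distrib)
  then have "weighted_squares (y # xs) * weighted_squares ys =
      weighted_squares (map (\<lambda>(s, f). (t * s, g * f)) ys @ zs)"
    using zs(2) by (simp add: y distrib_right weighted_squares_append)
  moreover have "\<forall>(t, g)\<in>set (map (\<lambda>(s, f). (t * s, g * f)) ys @ zs). 0 < t"
    using Cons.prems y zs(1) assms(2) by (fastforce intro: mult_pos_pos)
  ultimately show ?case by blast
qed

text \<open>
The minimal polynomial argument, with a nonzero polynomial \<open>d\<close> of least degree in the kernel of \<open>e\<close>. The
hypothesis on constants says that \<open>e\<close> is injective on the coefficient field.
\<close>

lemma irreducible_dvd_if_common_root:
  fixes f w :: "'a::field poly"
  assumes e: "ring_morphism e" "\<And>c. c \<noteq> 0 \<Longrightarrow> e [:c:] \<noteq> (0::'b::field)"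
    and "irreducible f" "e f = 0" "e w = 0"
  shows "f dvd w"
proof -
  note rm = ring_morphism_simps[OF e(1)]
  have f0: "f \<noteq> 0" using assms by auto
  \<comment> \<open>The minimal polynomial, up to a constant factor.\<close>
  define d where "d = (ARG_MIN degree d. d \<noteq> 0 \<and> e d = 0)"
  have d: "d \<noteq> 0" "e d = 0" and dmin: "\<And>q. q \<noteq> 0 \<Longrightarrow> e q = 0 \<Longrightarrow> degree d \<le> degree q"
    using arg_min_natI[of "\<lambda>d. d \<noteq> 0 \<and> e d = 0" f degree] arg_min_nat_le[of "\<lambda>d. d \<noteq> 0 \<and> e d = 0" _ degree]
      f0 \<open>e f = 0\<close> by (auto simp: d_def)
  have ddvd: "d dvd q" if "e q = 0" for q
  proof (rule ccontr)
    assume "\<not> d dvd q"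
    then have nz: "q mod d \<noteq> 0" by (simp add: dvd_eq_mod_eq_0)
    have "e (q mod d) = 0"
      using that d(2) by (simp add: minus_mult_div_eq_mod[symmetric] rm)
    then have "degree d \<le> degree (q mod d)" by (rule dmin[OF nz])
    then show False using degree_mod_less[OF d(1), of q] nz by simp
  qed
  have "\<not> d dvd 1"
  proof
    assume "d dvd 1"
    then obtain c where "d = [:c:]" using d(1) by (auto simp: is_unit_iff_degree elim: degree_eq_zeroE)
    then show False using d e(2)[of c] by auto
  qed
  then have "f dvd d" using ddvd[OF \<open>e f = 0\<close>] \<open>irreducible f\<close> by (meson irreducible_altdef)
  then show ?thesis using ddvd[OF \<open>e w = 0\<close>] by (rule dvd_trans)
qed

text \<open>
Let \<open>\<alpha>\<close> be a root of \<open>f\<close> in the surrounding algebraically closed field. The values at \<open>\<alpha>\<close> of the weighted sums of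
squares form a real cone, because \<open>f\<close> changes sign. By maximality it is the given cone. It contains the squares of
\<open>\<alpha> + 1\<close> and \<open>\<alpha> - 1\<close>, and their difference \<open>4 \<alpha>\<close> shows that \<open>\<alpha>\<close> belongs to the field.
\<close>

lemma real_closure_irreducible_root:
  fixes f :: "'n::finite real_closure poly"
  assumes irr: "irreducible f" and sign: "poly f a * poly f b < 0"
  shows "\<exists>r. poly f r = 0"
proof -
  let ?\<iota> = "Rep_real_closure :: 'n real_closure \<Rightarrow> _"
  note \<iota> = ring_morphism_Rep_real_closure
  note rm\<iota> = ring_morphism_simps[OF \<iota>]
  have "degree (map_poly ?\<iota> f) = degree f"
    by (rule degree_map_poly) (simp add: Rep_real_closure_eq_0_iff)
  moreover have "degree f > 0"
    using irr by (auto simp: irreducible_def is_unit_iff_degree)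
  ultimately obtain \<alpha> where \<alpha>: "poly (map_poly ?\<iota> f) \<alpha> = 0"
    using alg_closed_imp_poly_has_root[of "map_poly ?\<iota> f"] by auto
  define e where "e g = poly (map_poly ?\<iota> g) \<alpha>" for g
  have e: "ring_morphism e"
    by (simp add: ring_morphism_def e_def map_poly_ring_morphism[OF \<iota>] map_poly_1 rm\<iota>)
  note rm = ring_morphism_simps[OF e]
  have e_const: "e [:c:] = ?\<iota> c" for c by (simp add: e_def map_poly_pCons rm\<iota>)
  have dvd: "f dvd w" if "e w = 0" for w
    by (rule irreducible_dvd_if_common_root[OF e _ irr _ that])
      (use \<alpha> in \<open>auto simp: e_const e_def[symmetric] Rep_real_closure_eq_0_iff\<close>)
  define W where "W = {weighted_squares xs | xs. \<forall>(t, g)\<in>set xs. 0 < (t :: 'n real_closure)}"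
  have W1: "smult t (g\<^sup>2) \<in> W" if "0 < t" for t g
    unfolding W_def by (rule CollectI, rule exI[of _ "[(t, g)]"]) (use that in simp)
  have Wadd: "v + w \<in> W" if "v \<in> W" "w \<in> W" for v w
    using that unfolding W_def
    by clarify (rule exI[of _ "_ @ _"], auto simp: weighted_squares_append)
  have Wmult: "v * w \<in> W" if "v \<in> W" "w \<in> W" for v w
    using that weighted_squares_mult unfolding W_def by fast
  have Wzero: "e v = 0" if vw: "v \<in> W" "w \<in> W" "e (v + w) = 0" for v w
  proof -
    obtain xs ys where xs: "v = weighted_squares xs" "\<forall>(t, g)\<in>set xs. 0 < t"
      and ys: "w = weighted_squares ys" "\<forall>(t, g)\<in>set ys. 0 < t"
      using vw(1,2) unfolding W_def by blast
    have "f dvd weighted_squares (xs @ ys)"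
      using dvd[OF vw(3)] by (simp add: xs ys weighted_squares_append)
    then have "\<forall>(t, g)\<in>set (xs @ ys). f dvd g"
      by (intro irreducible_dvd_weighted_squares[OF irr sign]) (use xs ys in auto)
    then have "\<forall>(t, g)\<in>set xs. f dvd g" by auto
    from weighted_squares_divide[OF this] have "f dvd v" unfolding xs(1) power2_eq_square by (metis dvd_mult2 dvd_triv_left)
    then show ?thesis using \<alpha> by (auto elim!: dvdE simp: rm e_def[symmetric])
  qed
  have cone: "real_cone (e ` W)"
    unfolding real_cone_def
  proof (intro conjI ballI impI)
    show "1 \<in> e ` W" using W1[of 1 1] rm(1) by (metis image_eqI one_power2 smult_1_left zero_less_one)
    fix x assume "x \<in> e ` W"
    then obtain v where v: "v \<in> W" "x = e v" by blast
    show "x = 0" if neg: "- x \<in> e ` W"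
    proof -
      obtain w where w: "w \<in> W" "- x = e w" using neg by blast
      have "e (v + w) = 0" unfolding rm v(2)[symmetric] w(2)[symmetric] by simp
      then show ?thesis using Wzero v w by blast
    qed
    fix y assume "y \<in> e ` W"
    then obtain w where w: "w \<in> W" "y = e w" by blast
    show "x + y \<in> e ` W" using Wadd[OF v(1) w(1)] v w by (metis image_eqI rm(2))
    show "x * y \<in> e ` W" using Wmult[OF v(1) w(1)] v w by (metis image_eqI rm(3))
    have "smult 1 ((v - w)\<^sup>2) \<in> W" by (rule W1) simp
    then have "e ((v - w)\<^sup>2) \<in> e ` W" by simp
    then show "(x - y)\<^sup>2 \<in> e ` W" by (simp add: v w rm)
  qed
  have "closure_cone \<subseteq> e ` W"
  proof
    fix x :: "'n residue fract alg_closure" assume x: "x \<in> closure_cone"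
    then obtain t :: "'n real_closure" where t: "x = ?\<iota> t"
      using closure_cone_subset[OF x] by (metis Abs_real_closure_inverse)
    then have "0 \<le> t" using x Rep_real_closure_cone by blast
    show "x \<in> e ` W"
    proof (cases "t = 0")
      case True
      have "0 \<in> W" unfolding W_def by (rule CollectI, rule exI[of _ "[]"]) simp
      then show ?thesis using True t by (metis e_const image_eqI pCons_0_0)
    next
      case False
      then have "[:t:] \<in> W" using W1[of t 1] \<open>0 \<le> t\<close> by simp
      then show ?thesis using t e_const by (metis image_eqI)
    qed
  qed
  then have eW: "e ` W = closure_cone"
    using closure_cone(1) cone unfolding maximal_real_cone_def by blast
  have sq: "(e g)\<^sup>2 \<in> differences closure_cone" for g
  proof -
    have "e (smult 1 (g\<^sup>2)) \<in> closure_cone" unfolding eW[symmetric] by (intro imageI W1) simp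
    then show ?thesis by (intro closure_cone_subset) (simp add: rm)
  qed
  have ex: "e [:0, 1:] = \<alpha>" by (simp add: e_def map_poly_pCons rm\<iota>)
  obtain u v :: "'n real_closure" where uv: "(\<alpha> + 1)\<^sup>2 = ?\<iota> u" "(\<alpha> - 1)\<^sup>2 = ?\<iota> v"
    using sq[of "[:0, 1:] + 1"] sq[of "[:0, 1:] - 1"] unfolding rm ex by (metis Abs_real_closure_inverse)
  have "?\<iota> (u - v) = ?\<iota> 4 * \<alpha>"
  proof -
    have "?\<iota> 4 = 4" using rm\<iota>(8)[of 4] by simp
    moreover have "(\<alpha> + 1)\<^sup>2 - (\<alpha> - 1)\<^sup>2 = 4 * \<alpha>" by (simp add: power2_eq_square algebra_simps)
    ultimately show ?thesis by (simp add: rm\<iota> uv)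
  qed
  then have "?\<iota> ((u - v) / 4) = \<alpha>"
  proof -
    have "4 * (x / 4) = x" for x :: "'n real_closure" by simp
    then have "?\<iota> 4 * ?\<iota> ((u - v) / 4) = ?\<iota> (u - v)" using rm\<iota>(3)[of 4 "(u - v) / 4"] by metis
    moreover have "?\<iota> 4 \<noteq> 0" by (simp add: Rep_real_closure_eq_0_iff)
    ultimately show ?thesis using \<open>?\<iota> (u - v) = ?\<iota> 4 * \<alpha>\<close> by (metis mult_left_cancel)
  qed
  moreover have "?\<iota> (poly f r) = poly (map_poly ?\<iota> f) (?\<iota> r)" for r
    by (induction f) (simp_all add: rm\<iota> map_poly_pCons)
  ultimately have "?\<iota> (poly f ((u - v) / 4)) = 0" using \<alpha> by simp
  then show ?thesis unfolding Rep_real_closure_eq_0_iff by blast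
qed

text \<open>
Among the irreducible factors of a sign-changing polynomial one changes sign as well. It has a root, hence is
linear, and its root lies between the two points.
\<close>

instance real_closure :: (finite) real_closed_field
proof
  fix a b :: "'a real_closure" and f :: "nat \<Rightarrow> 'a real_closure" and n
  assume ab: "a < b" and sign: "(\<Sum>k\<le>n. f k * a ^ k) < 0" "0 < (\<Sum>k\<le>n. f k * b ^ k)"
  define p where "p = (\<Sum>k\<le>n. monom (f k) k)"
  have p: "poly p x = (\<Sum>k\<le>n. f k * x ^ k)" for x by (simp add: p_def poly_sum poly_monom)
  have "poly p a * poly p b < 0" using sign unfolding p by (rule mult_neg_pos)
  then obtain g where g: "irreducible g" "g dvd p" "poly g a * poly g b < 0"
    by (rule sign_changing_irreducible_factor)
  obtain r where r: "poly g r = 0" using real_closure_irreducible_root[OF g(1,3)] by blast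
  then obtain u where u: "g = [:-r, 1:] * u" by (auto simp: poly_eq_0_iff_dvd)
  have "\<not> [:-r, 1:] dvd 1" by (simp add: is_unit_iff_degree)
  then have "u dvd 1" using g(1) u unfolding irreducible_def by blast
  moreover have "u \<noteq> 0" using u g(1) by auto
  ultimately obtain c where "u = [:c:]" by (auto simp: is_unit_iff_degree elim: degree_eq_zeroE)
  then have "c\<^sup>2 * ((a - r) * (b - r)) < 0"
    using g(3) u by (simp add: power2_eq_square algebra_simps)
  then have neg: "(a - r) * (b - r) < 0" by (simp add: mult_less_0_iff)
  have "a < r" "r < b" using neg ab by (auto simp: mult_less_0_iff)
  moreover have "poly p r = 0" using g(2) r by auto
  ultimately show "\<exists>x. a < x \<and> x < b \<and> (\<Sum>k\<le>n. f k * x ^ k) = 0" unfolding p by blast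
qed

section \<open>The Artin-Lang theorem\<close>

definition variable :: "'n \<Rightarrow> 'n::finite rpoly" where
  "variable i = Poly_Mapping.single (Poly_Mapping.single i 1) 1"

lemma variable_power: "variable i ^ k = Poly_Mapping.single (Poly_Mapping.single i k) 1"
  by (induction k) (simp_all add: variable_def mult_single flip: single_add)

definition polys_in :: "'n set \<Rightarrow> 'n::finite rpoly set" where
  "polys_in V = {p. \<forall>a\<in>Poly_Mapping.keys p. \<forall>i. i \<notin> V \<longrightarrow> Poly_Mapping.lookup a i = 0}"

lemma subring_set_polys_in: "subring_set (polys_in V)"
  unfolding subring_set_def
proof (intro conjI ballI)
  have "Poly_Mapping.keys (1 :: 'a rpoly) \<subseteq> {0}" by (metis keys_single single_one subset_insertI2 order_refl empty_subsetI)
  then show "1 \<in> polys_in V" by (auto simp: polys_in_def)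
  fix p q :: "'a rpoly" assume pq: "p \<in> polys_in V" "q \<in> polys_in V"
  have "Poly_Mapping.keys (p - q) \<subseteq> Poly_Mapping.keys p \<union> Poly_Mapping.keys q" by (rule keys_diff)
  then show "p - q \<in> polys_in V" using pq by (auto simp: polys_in_def)
  have "Poly_Mapping.keys (p * q) \<subseteq> {a + b | a b. a \<in> Poly_Mapping.keys p \<and> b \<in> Poly_Mapping.keys q}"
    by (rule keys_mult)
  then show "p * q \<in> polys_in V" using pq by (fastforce simp: polys_in_def lookup_add)
qed

lemma polys_in_insert_as_univariate:
  assumes "p \<in> polys_in (insert i V)"
  obtains U where "U \<in> polys_over (polys_in V)" "p = poly U (variable i)"
proof
  let ?rest = "\<lambda>a. a - Poly_Mapping.single i (Poly_Mapping.lookup a i)"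
  let ?U = "\<Sum>a\<in>Poly_Mapping.keys p. monom (Poly_Mapping.single (?rest a) (Poly_Mapping.lookup p a)) (Poly_Mapping.lookup a i)"
  have rest: "?rest a + Poly_Mapping.single i (Poly_Mapping.lookup a i) = a" for a :: "'a \<Rightarrow>\<^sub>0 nat"
    by (rule poly_mapping_eqI) (simp add: lookup_add lookup_minus lookup_single when_def)
  show "?U \<in> polys_over (polys_in V)"
    unfolding polys_over_def mem_Collect_eq coeff_sum coeff_monom
  proof (intro allI subring_set_closed(9)[OF subring_set_polys_in])
    fix n a assume "a \<in> Poly_Mapping.keys p"
    then have "Poly_Mapping.single (?rest a) (Poly_Mapping.lookup p a) \<in> polys_in V"
      using assms by (auto simp: polys_in_def lookup_minus lookup_single when_def)
    then show "(if Poly_Mapping.lookup a i = n then Poly_Mapping.single (?rest a) (Poly_Mapping.lookup p a) else 0) \<in> polys_in V"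
      using subring_set_closed(2)[OF subring_set_polys_in] by auto
  qed
  \<comment> \<open>Each exponent is split into the exponent of \<open>i\<close> and the rest.\<close>
  have "p = (\<Sum>a\<in>Poly_Mapping.keys p. Poly_Mapping.single a (Poly_Mapping.lookup p a))"
    by (rule poly_mapping_sum_singles)
  also have "\<dots> = poly ?U (variable i)"
    by (simp add: poly_sum poly_monom variable_power mult_single rest)
  finally show "p = poly ?U (variable i)" .
qed

lemma ring_morphism_poly:
  assumes "ring_morphism \<phi>"
  shows "\<phi> (poly U x) = poly (map_poly \<phi> U) (\<phi> x)"
  by (induction U) (simp_all add: map_poly_pCons ring_morphism_simps[OF assms])

lemma eval_poly_cong:
  assumes "p \<in> polys_in V" "\<And>j. j \<in> V \<Longrightarrow> vec_nth u j = vec_nth v j"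
  shows "eval_poly p u = eval_poly p v"
  unfolding eval_poly_def
proof (intro sum.cong refl arg_cong2[of _ _ _ _ "(*)"] prod.cong)
  fix a i assume "a \<in> Poly_Mapping.keys p"
  then show "vec_nth u i ^ Poly_Mapping.lookup a i = vec_nth v i ^ Poly_Mapping.lookup a i"
    using assms by (cases "i \<in> V") (auto simp: polys_in_def)
qed

lemma const_poly_mult: "const_poly c * const_poly d = const_poly (c * d)"
  by (simp add: const_poly_def mult_single)

lemma const_poly_one: "const_poly 1 = 1"
  by (simp add: const_poly_def)

text \<open>
Every ring morphism respects the order of the constants, because the nonnegative reals are the squares.
\<close>

lemma sg_morphism_const_poly:
  fixes \<psi> :: "'n::finite rpoly \<Rightarrow> 'k::real_closed_field"
  assumes \<psi>: "ring_morphism \<psi>"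
  shows "sg (\<psi> (const_poly c)) = sg c"
proof -
  note rm = ring_morphism_simps[OF \<psi>]
  have pos: "0 < \<psi> (const_poly c)" if "0 < c" for c
  proof -
    have "\<psi> (const_poly c) * \<psi> (const_poly (1 / c)) = 1"
      using that by (simp add: const_poly_mult const_poly_one rm(1) flip: rm(3))
    then have "\<psi> (const_poly c) \<noteq> 0" by auto
    moreover have "(const_poly c :: 'n rpoly) = (const_poly (sqrt c))\<^sup>2"
      using that by (simp add: power2_eq_square const_poly_mult)
    then have "\<psi> (const_poly c) = (\<psi> (const_poly (sqrt c)))\<^sup>2" using rm(7)[of _ 2] by metis
    then have "0 \<le> \<psi> (const_poly c)" by simp
    ultimately show ?thesis by simp
  qed
  have minus: "\<psi> (const_poly (- c)) = - \<psi> (const_poly c)" for c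
  proof -
    have "(const_poly (- c) :: 'n rpoly) = - const_poly c" by (simp add: const_poly_def single_uminus)
    then show ?thesis by (simp add: rm)
  qed
  have "\<psi> (const_poly 0) = 0" by (simp add: const_poly_def rm)
  then show ?thesis using pos[of c] pos[of "- c"] minus[of c]
    by (cases c "0::real" rule: linorder_cases) (auto simp: sg_def)
qed

text \<open>
The real point is constructed coordinate by coordinate, by induction on the set of variables that occur:
eliminating a variable reduces the sign conditions to conditions on polynomials in the other variables.
\<close>

lemma Artin_Lang:
  fixes \<psi> :: "'n::finite rpoly \<Rightarrow> 'k::real_closed_field"
  assumes \<psi>: "ring_morphism \<psi>" and "finite S"
  shows "\<exists>u. \<forall>p\<in>S. sg (eval_poly p u) = sg (\<psi> p)"
proof -
  have "\<exists>u. \<forall>p\<in>S. sg (eval_poly p u) = sg (\<psi> p)" if "finite V" "finite S" "S \<subseteq> polys_in V" for V and S :: "'n rpoly set"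
    using that
  proof (induction V arbitrary: S)
    case empty
    have "sg (eval_poly p 0) = sg (\<psi> p)" if "p \<in> S" for p
    proof -
      have "Poly_Mapping.keys p \<subseteq> {0}" using empty.prems(2) that
        by (auto simp: polys_in_def intro!: poly_mapping_eqI)
      then have "p = const_poly (Poly_Mapping.lookup p 0)"
        unfolding const_poly_def
        by (intro poly_mapping_eqI) (auto simp: lookup_single when_def in_keys_iff subset_iff)
      then show ?thesis using sg_morphism_const_poly[OF \<psi>] eval_poly_const by metis
    qed
    then show ?case by blast
  next
    case (insert i V)
    have "\<forall>p\<in>S. \<exists>U. U \<in> polys_over (polys_in V) \<and> p = poly U (variable i)"
    proof
      fix p assume "p \<in> S"
      then have "p \<in> polys_in (insert i V)" using insert.prems(2) by blast
      from polys_in_insert_as_univariate[OF this]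
      show "\<exists>U. U \<in> polys_over (polys_in V) \<and> p = poly U (variable i)" by blast
    qed
    then obtain U where U: "\<And>p. p \<in> S \<Longrightarrow> U p \<in> polys_over (polys_in V) \<and> p = poly (U p) (variable i)"
      by (elim bchoice[THEN exE]) blast
    have US: "finite (U ` S)" "U ` S \<subseteq> polys_over (polys_in V)" using U insert.prems by auto
    obtain S' where S': "finite S'" "S' \<subseteq> polys_in V"
      "\<And>(\<phi> :: 'n rpoly \<Rightarrow> real) (\<psi> :: 'n rpoly \<Rightarrow> 'k) y.
         ring_morphism \<phi> \<Longrightarrow> ring_morphism \<psi> \<Longrightarrow> (\<And>c. c \<in> S' \<Longrightarrow> sg (\<phi> c) = sg (\<psi> c)) \<Longrightarrow>
         \<exists>x. \<forall>p\<in>U ` S. sg (poly (map_poly \<phi> p) x) = sg (poly (map_poly \<psi> p) y)"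
    proof (rule eliminate_variable[where 'k = real and 'l = 'k, OF subring_set_polys_in US], goal_cases)
      case (1 S')
      show ?case by (rule 1(1)) (fact 1)+
    qed
    obtain u where u: "\<forall>p\<in>S'. sg (eval_poly p u) = sg (\<psi> p)" using insert.IH[OF S'(1,2)] by blast
    obtain x where x: "\<forall>p\<in>U ` S. sg (poly (map_poly (\<lambda>q. eval_poly q u) p) x) =
        sg (poly (map_poly \<psi> p) (\<psi> (variable i)))"
      using S'(3)[OF ring_morphism_eval_poly \<psi>, of u "\<psi> (variable i)"] u by blast
    define v where "v = (\<chi> j. if j = i then x else vec_nth u j)"
    have "sg (eval_poly p v) = sg (\<psi> p)" if "p \<in> S" for p
    proof -
      have vi: "eval_poly (variable i) v = x"
        by (simp add: variable_def eval_poly_single monomial_value_def v_def lookup_single when_def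
            if_distrib[of "\<lambda>k. _ ^ k"] prod.delta cong: if_cong)
      have "map_poly (\<lambda>q. eval_poly q v) (U p) = map_poly (\<lambda>q. eval_poly q u) (U p)"
      proof (rule poly_eqI)
        fix n
        have "coeff (U p) n \<in> polys_in V" using U[OF that] by (auto simp: polys_over_def)
        then have "eval_poly (coeff (U p) n) v = eval_poly (coeff (U p) n) u"
          by (rule eval_poly_cong) (use insert.hyps in \<open>auto simp: v_def\<close>)
        then show "coeff (map_poly (\<lambda>q. eval_poly q v) (U p)) n = coeff (map_poly (\<lambda>q. eval_poly q u) (U p)) n"
          by (simp add: coeff_map_poly eval_poly_zero)
      qed
      then have "eval_poly p v = poly (map_poly (\<lambda>q. eval_poly q u) (U p)) x"
        using ring_morphism_poly[OF ring_morphism_eval_poly[of v], of "U p" "variable i"] U[OF that] vi by simp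
      moreover have "\<psi> p = poly (map_poly \<psi> (U p)) (\<psi> (variable i))"
        using ring_morphism_poly[OF \<psi>, of "U p" "variable i"] U[OF that] by simp
      ultimately show ?thesis using x that by simp
    qed
    then show ?case by blast
  qed
  from this[of UNIV S] show ?thesis using \<open>finite S\<close> by (simp add: polys_in_def)
qed

lemma residue_embedding_in_closure_field:
  "residue_embedding p \<in> differences (closure_cone :: 'n::finite residue fract alg_closure set)"
proof -
  \<comment> \<open>Every \<open>p\<close> is a difference of two squares, so its residue lies in the field spanned by the cone.\<close>
  let ?h = "const_poly (1/2) :: 'n rpoly"
  have h: "?h + ?h = 1" by (simp add: const_poly_def flip: single_add)
  have "?h * ?h + ?h * ?h = ?h * (?h + ?h)" by (rule distrib_left[symmetric])
  then have hh: "?h * ?h + ?h * ?h = ?h" unfolding h by simp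
  have "(?h * (p + 1))\<^sup>2 - (?h * (p - 1))\<^sup>2 = (?h * ?h + ?h * ?h) * p + (?h * ?h + ?h * ?h) * p"
    by (simp add: power2_eq_square algebra_simps)
  also have "\<dots> = (?h + ?h) * p" unfolding hh by (rule distrib_right[symmetric])
  finally have "p = (?h * (p + 1))\<^sup>2 - (?h * (p - 1))\<^sup>2" unfolding h by simp
  then have "residue_embedding p = residue_embedding ((?h * (p + 1))\<^sup>2) - residue_embedding ((?h * (p - 1))\<^sup>2)"
    using ring_morphism_simps(6)[OF ring_morphism_residue_embedding] by metis
  then show ?thesis unfolding differences_def
    using closure_cone(2) sums_of_squares_square by blast
qed

text \<open>
The images of the variables are the coordinates of a point over the real closed field, and \<open>generic_point p\<close> is
the value of \<open>p\<close> there. By construction it is zero exactly for the members of the chosen ideal.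
\<close>

definition generic_point :: "'n::finite rpoly \<Rightarrow> 'n real_closure" where
  "generic_point p = Abs_real_closure (residue_embedding p)"

lemma Rep_generic_point: "Rep_real_closure (generic_point p) = residue_embedding p"
  by (simp add: generic_point_def Abs_real_closure_inverse residue_embedding_in_closure_field)

lemma ring_morphism_generic_point: "ring_morphism generic_point"
  unfolding ring_morphism_def
  by (simp add: one_real_closure.rep_eq plus_real_closure.rep_eq times_real_closure.rep_eq Rep_generic_point
      ring_morphism_simps[OF ring_morphism_residue_embedding] flip: Rep_real_closure_inject)

lemma generic_point_eq_0_iff: "generic_point p = 0 \<longleftrightarrow> p \<in> chosen_ideal"
  using Rep_generic_point[of p] Rep_real_closure_eq_0_iff[of "generic_point p"] residue_embedding_eq_0_iff by metis

text \<open>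
Otherwise \<open>I\<close>, and hence the chosen ideal, would be unrealised. But the generic point of the chosen ideal, moved to a
real point by the theorem of Artin and Lang, refutes this.
\<close>

theorem real_prime_ideal_contains_vanishing:
  fixes I :: "'n::finite rpoly set"
  assumes "real_prime_ideal I" "finite F" "F \<subseteq> I" "\<And>u. (\<forall>p\<in>F. eval_poly p u = 0) \<Longrightarrow> eval_poly q u = 0"
  shows "q \<in> I"
proof (rule ccontr)
  assume "q \<notin> I"
  then have "unrealised I" using assms unfolding unrealised_def by blast
  then have "unrealised (chosen_ideal :: 'n rpoly set)" using chosen_ideal(2) by blast
  then obtain G r where G: "finite G" "G \<subseteq> chosen_ideal" "(r :: 'n rpoly) \<notin> chosen_ideal"
    "\<And>u. (\<forall>p\<in>G. eval_poly p u = 0) \<Longrightarrow> eval_poly r u = 0"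
    unfolding unrealised_def by blast
  obtain u where u: "\<forall>p\<in>insert r G. sg (eval_poly p u) = sg (generic_point p)"
    using Artin_Lang[OF ring_morphism_generic_point, of "insert r G"] G(1) by auto
  have "eval_poly p u = 0" if "p \<in> G" for p
  proof -
    have "generic_point p = 0" using that G(2) generic_point_eq_0_iff by blast
    moreover have "sg (eval_poly p u) = sg (generic_point p)" using u that by blast
    ultimately show ?thesis by simp
  qed
  then have "eval_poly r u = 0" using G(4) by blast
  moreover have "generic_point r \<noteq> 0" using G(3) generic_point_eq_0_iff by blast
  ultimately show False using u by simp
qed

section \<open>The real Nullstellensatz\<close>

definition ideal_set :: "'a::comm_ring_1 set \<Rightarrow> bool" where
  "ideal_set I \<longleftrightarrow> 0 \<in> I \<and> (\<forall>x\<in>I. \<forall>y\<in>I. x + y \<in> I) \<and> (\<forall>x\<in>I. \<forall>a. a * x \<in> I)"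

lemma ideal_set_adjoin:
  assumes "ideal_set I"
  shows "ideal_set {i + a * x | i a. i \<in> I}" "I \<subseteq> {i + a * x | i a. i \<in> I}" "x \<in> {i + a * x | i a. i \<in> I}"
proof -
  let ?J = "{i + a * x | i a. i \<in> I}"
  have mem: "i + a * x \<in> ?J" if "i \<in> I" for i a using that by blast
  have 0: "0 \<in> I" using assms by (simp add: ideal_set_def)
  show IJ: "I \<subseteq> ?J" using mem[of _ 0] by auto
  show "x \<in> ?J" using mem[OF 0, of 1] by simp
  show "ideal_set ?J" unfolding ideal_set_def
  proof (intro conjI ballI allI)
    show "0 \<in> ?J" using IJ 0 by blast
    fix y assume "y \<in> ?J"
    then obtain i a where y: "i \<in> I" "y = i + a * x" by blast
    have "c * i \<in> I" for c using assms y(1) by (simp add: ideal_set_def)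
    then show "c * y \<in> ?J" for c using mem[of "c * i" "c * a"] y(2) by (simp add: algebra_simps)
    fix z assume "z \<in> ?J"
    then obtain j b where z: "j \<in> I" "z = j + b * x" by blast
    have "i + j \<in> I" using assms y(1) z(1) by (simp add: ideal_set_def)
    then show "y + z \<in> ?J" using mem[of "i + j" "a + b"] y(2) z(2) by (simp add: algebra_simps)
  qed
qed

lemma maximal_avoiding_ideal_exists:
  assumes "ideal_set J" "J \<inter> M = {}"
  obtains I where "ideal_set I" "J \<subseteq> I" "I \<inter> M = {}"
    "\<And>I'. ideal_set I' \<Longrightarrow> I \<subseteq> I' \<Longrightarrow> I' \<inter> M = {} \<Longrightarrow> I' = I"
proof -
  define \<A> where "\<A> = {I. ideal_set I \<and> J \<subseteq> I \<and> I \<inter> M = {}}"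
  have "\<exists>I\<in>\<A>. \<forall>N\<in>\<A>. I \<subseteq> N \<longrightarrow> N = I"
  proof (rule subset_Zorn_nonempty)
    show "\<A> \<noteq> {}" using assms by (auto simp: \<A>_def)
    fix C assume C: "C \<noteq> {}" "subset.chain \<A> C"
    have ideal: "ideal_set T" "J \<subseteq> T" "T \<inter> M = {}" if "T \<in> C" for T
      using C(2) that by (auto simp: subset.chain_def \<A>_def)
    obtain T where T: "T \<in> C" using C(1) by blast
    have "ideal_set (\<Union>C)"
      unfolding ideal_set_def
    proof (intro conjI ballI allI)
      show "0 \<in> \<Union>C" using T ideal unfolding ideal_set_def by blast
      fix x assume x: "x \<in> \<Union>C"
      then show "a * x \<in> \<Union>C" for a using ideal unfolding ideal_set_def by blast
      fix y assume "y \<in> \<Union>C"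
      with x obtain A B where AB: "A \<in> C" "B \<in> C" "x \<in> A" "y \<in> B" by blast
      moreover have "A \<subseteq> B \<or> B \<subseteq> A" using C(2) AB by (auto simp: subset.chain_def)
      ultimately obtain N where "N \<in> C" "x \<in> N" "y \<in> N" by blast
      then show "x + y \<in> \<Union>C" using ideal(1) unfolding ideal_set_def by blast
    qed
    moreover have "J \<subseteq> \<Union>C" "\<Union>C \<inter> M = {}" using T ideal(2,3) by blast+
    ultimately show "\<Union>C \<in> \<A>" by (simp add: \<A>_def)
  qed
  then obtain I where I: "I \<in> \<A>" "\<And>N. N \<in> \<A> \<Longrightarrow> I \<subseteq> N \<Longrightarrow> N = I" by blast
  show ?thesis
  proof (rule that)
    show "ideal_set I" "J \<subseteq> I" "I \<inter> M = {}" using I(1) by (auto simp: \<A>_def)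
    show "I' = I" if "ideal_set I'" "I \<subseteq> I'" "I' \<inter> M = {}" for I'
      using I that by (auto simp: \<A>_def)
  qed
qed

text \<open>
Primality is the usual consequence of maximality. Reality follows in the same way: if \<open>x\<^sup>2 + s \<in> I\<close> and
\<open>m = i + a x \<in> M\<close> with \<open>i \<in> I\<close>, then \<open>m\<^sup>2 + a\<^sup>2 s\<close> lies both in \<open>M\<close> and in \<open>I\<close>.
\<close>

lemma real_prime_ideal_avoiding:
  fixes J :: "'a::comm_ring_1 set"
  assumes J: "ideal_set J" "J \<inter> M = {}"
    and M: "1 \<in> M" "\<And>x y. x \<in> M \<Longrightarrow> y \<in> M \<Longrightarrow> x * y \<in> M" "\<And>x s. x \<in> M \<Longrightarrow> s \<in> sums_of_squares \<Longrightarrow> x + s \<in> M"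
  obtains I where "real_prime_ideal I" "J \<subseteq> I" "I \<inter> M = {}"
proof -
  obtain I where I: "ideal_set I" "J \<subseteq> I" "I \<inter> M = {}"
    and max: "\<And>I'. ideal_set I' \<Longrightarrow> I \<subseteq> I' \<Longrightarrow> I' \<inter> M = {} \<Longrightarrow> I' = I"
    using maximal_avoiding_ideal_exists[OF J] by blast
  have add: "x + y \<in> I" if "x \<in> I" "y \<in> I" for x y using I(1) that by (simp add: ideal_set_def)
  have mult: "a * x \<in> I" if "x \<in> I" for a x using I(1) that by (simp add: ideal_set_def)
  have meets: "\<exists>i\<in>I. \<exists>a. i + a * x \<in> M" if "x \<notin> I" for x
  proof (rule ccontr)
    assume "\<not> ?thesis"
    then have "{i + a * x | i a. i \<in> I} \<inter> M = {}" by blast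
    from max[OF ideal_set_adjoin(1,2)[OF I(1)] this] show False
      using ideal_set_adjoin(3)[OF I(1), of x] that by simp
  qed
  have "real_prime_ideal I"
    unfolding real_prime_ideal_def
  proof (intro conjI ballI allI impI)
    show "0 \<in> I" using I(1) by (simp add: ideal_set_def)
    show "1 \<notin> I" using I(3) M(1) by blast
    show "x + y \<in> I" if "x \<in> I" "y \<in> I" for x y by (rule add[OF that])
    show "a * x \<in> I" if "x \<in> I" for a x by (rule mult[OF that])
    show "x \<in> I \<or> y \<in> I" if xy: "x * y \<in> I" for x y
    proof (rule ccontr)
      assume "\<not> ?thesis"
      then obtain i a j b where m: "i \<in> I" "i + a * x \<in> M" "j \<in> I" "j + b * y \<in> M" using meets by metis
      have "(i + a * x) * (j + b * y) = (j + b * y) * i + ((a * x) * j + (a * b) * (x * y))"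
        by (simp add: algebra_simps)
      then have "(i + a * x) * (j + b * y) \<in> I" using add mult m(1,3) xy by simp
      then show False using M(2)[OF m(2,4)] I(3) by blast
    qed
    show "x \<in> I" if s: "s \<in> sums_of_squares" and xs: "x\<^sup>2 + s \<in> I" for x s
    proof (rule ccontr)
      assume "x \<notin> I"
      then obtain i a where m: "i \<in> I" "i + a * x \<in> M" using meets by blast
      have "(i + a * x) * (i + a * x) + a\<^sup>2 * s = (i + 2 * a * x) * i + a\<^sup>2 * (x\<^sup>2 + s)"
        by (simp add: algebra_simps power2_eq_square)
      then have "(i + a * x) * (i + a * x) + a\<^sup>2 * s \<in> I" using add mult m(1) xs by simp
      moreover have "(i + a * x) * (i + a * x) + a\<^sup>2 * s \<in> M"
        by (intro M(2,3) m(2) sums_of_squares_square_mult s)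
      ultimately show False using I(3) by blast
    qed
  qed
  then show ?thesis using that I by blast
qed

text \<open>
The previous lemma applies to the multiplicative set of all \<open>q\<^sup>2\<^sup>l + s\<close>. The real prime ideal that it
yields would contain \<open>h\<close> but not \<open>q\<close>, although \<open>q\<close> vanishes at the common zeros of \<open>h\<close>.
\<close>

theorem real_nullstellensatz:
  fixes h :: "'n::finite rpoly list"
  assumes "\<And>u. u \<in> real_variety h \<Longrightarrow> eval_poly q u = 0"
  shows "\<exists>l s \<phi>. s \<in> sums_of_squares \<and> q ^ (2 * l) + s = (\<Sum>i<length h. \<phi> i * h ! i)"
proof (rule ccontr)
  assume contra: "\<not> ?thesis"
  define J where "J = {(\<Sum>i<length h. \<phi> i * h ! i) | \<phi>. True}"
  define M where "M = {q ^ (2 * l) + s | l s. s \<in> sums_of_squares}"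
  have Jmem: "(\<Sum>i<length h. \<phi> i * h ! i) \<in> J" for \<phi> unfolding J_def by blast
  have Mmem: "q ^ (2 * l) + s \<in> M" if "s \<in> sums_of_squares" for l s using that unfolding M_def by blast
  have "ideal_set J" unfolding ideal_set_def
  proof (intro conjI ballI allI)
    show "0 \<in> J" using Jmem[of "\<lambda>_. 0"] by simp
    fix x assume "x \<in> J"
    then obtain \<phi> where x: "x = (\<Sum>i<length h. \<phi> i * h ! i)" unfolding J_def by blast
    show "a * x \<in> J" for a using Jmem[of "\<lambda>i. a * \<phi> i"] by (simp add: x sum_distrib_left mult.assoc)
    fix y assume "y \<in> J"
    then obtain \<psi> where y: "y = (\<Sum>i<length h. \<psi> i * h ! i)" unfolding J_def by blast
    show "x + y \<in> J" using Jmem[of "\<lambda>i. \<phi> i + \<psi> i"] by (simp add: x y distrib_right sum.distrib)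
  qed
  moreover have "J \<inter> M = {}"
  proof (rule equals0I)
    fix x assume x: "x \<in> J \<inter> M"
    obtain \<phi> where \<phi>: "x = (\<Sum>i<length h. \<phi> i * h ! i)" using x unfolding J_def by blast
    obtain l s where s: "x = q ^ (2 * l) + s" "s \<in> sums_of_squares" using x unfolding M_def by blast
    have "q ^ (2 * l) + s = (\<Sum>i<length h. \<phi> i * h ! i)" using \<phi> s(1) by simp
    then show False using contra s(2) by blast
  qed
  moreover have "1 \<in> M" using Mmem[OF sums_of_squares_zero, of 0] by simp
  moreover have "x * y \<in> M" if xy: "x \<in> M" "y \<in> M" for x y
  proof -
    obtain l s k t where "s \<in> sums_of_squares" "x = q ^ (2 * l) + s" "t \<in> sums_of_squares" "y = q ^ (2 * k) + t"
      using xy unfolding M_def by blast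
    moreover have "(q ^ l)\<^sup>2 * t + ((q ^ k)\<^sup>2 * s + s * t) \<in> sums_of_squares"
      by (intro sums_of_squares_add sums_of_squares_square_mult sums_of_squares_mult calculation)
    moreover have "(q ^ (2 * l) + s) * (q ^ (2 * k) + t) =
        q ^ (2 * (l + k)) + ((q ^ l)\<^sup>2 * t + ((q ^ k)\<^sup>2 * s + s * t))"
      by (simp add: algebra_simps power_add power_mult[symmetric] flip: power_even_eq)
    ultimately show ?thesis using Mmem by metis
  qed
  moreover have "x + s \<in> M" if xs: "x \<in> M" "s \<in> sums_of_squares" for x s
  proof -
    obtain l t where t: "t \<in> sums_of_squares" "x = q ^ (2 * l) + t" using xs(1) unfolding M_def by blast
    then show ?thesis using Mmem[OF sums_of_squares_add[OF t(1) xs(2)], of l] by (simp add: add.assoc)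
  qed
  ultimately obtain I where I: "real_prime_ideal I" "J \<subseteq> I" "I \<inter> M = {}"
    by (rule real_prime_ideal_avoiding)
  have "set h \<subseteq> I"
  proof
    fix p assume "p \<in> set h"
    then obtain k where k: "k < length h" "p = h ! k" by (metis in_set_conv_nth)
    have "p = (\<Sum>i<length h. (if i = k then 1 else 0) * h ! i)"
      using k by (simp add: if_distrib[of "\<lambda>c. c * _"] cong: if_cong)
    then show "p \<in> I" using Jmem[of "\<lambda>i. if i = k then 1 else 0"] I(2) by auto
  qed
  moreover have "eval_poly q u = 0" if "\<forall>p\<in>set h. eval_poly p u = 0" for u
    by (rule assms) (use that in \<open>auto simp: real_variety_def\<close>)
  ultimately have "q \<in> I" using real_prime_ideal_contains_vanishing[OF I(1), of "set h" q] by blast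
  then have "q\<^sup>2 \<in> I" using real_prime_ideal_closed(4)[OF I(1)] by (simp add: power2_eq_square)
  moreover have "q\<^sup>2 \<in> M" using Mmem[OF sums_of_squares_zero, of 1] by simp
  ultimately show False using I(3) by blast
qed

section \<open>Uniform degree bounds\<close>

lemma total_degree_le_iff:
  "total_degree p \<le> d \<longleftrightarrow> (\<forall>a\<in>Poly_Mapping.keys p. (\<Sum>i\<in>UNIV. Poly_Mapping.lookup a i) \<le> d)"
  by (simp add: total_degree_def)

lemma total_degree_add: "total_degree p \<le> d \<Longrightarrow> total_degree q \<le> d \<Longrightarrow> total_degree (p + q) \<le> d"
  unfolding total_degree_le_iff using Poly_Mapping.keys_add[of p q] by blast

lemma total_degree_zero [simp]: "total_degree 0 = 0"
  by (simp add: total_degree_def)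

lemma lookup_const_poly_mult: "Poly_Mapping.lookup (const_poly c * p) a = c * Poly_Mapping.lookup p a"
  unfolding const_poly_def mult_map_scale_conv_mult[symmetric]
  by (simp add: Poly_Mapping.map.rep_eq when_def)

lemma total_degree_const_mult: "total_degree p \<le> d \<Longrightarrow> total_degree (const_poly c * p) \<le> d"
  unfolding total_degree_le_iff by (auto simp: in_keys_iff lookup_const_poly_mult)

lemma total_degree_const [simp]: "total_degree (const_poly c) = 0"
  unfolding const_poly_def by (simp add: total_degree_def keys_single)

lemma const_poly_add: "const_poly (c + d) = const_poly c + const_poly d"
  by (simp add: const_poly_def single_add)

lemma const_poly_diff: "const_poly (c - d) = const_poly c - const_poly d"
  by (simp add: const_poly_def single_diff)

lemma const_poly_uminus: "const_poly (- c) = - const_poly c"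
  by (simp add: const_poly_def single_uminus)

lemma const_mult_sums_of_squares:
  assumes "0 \<le> c" "s \<in> sums_of_squares"
  shows "const_poly c * s \<in> sums_of_squares"
proof -
  have "const_poly c = (const_poly (sqrt c))\<^sup>2"
    using assms(1) by (simp add: power2_eq_square const_poly_mult)
  then show ?thesis using sums_of_squares_square_mult[OF assms(2)] by metis
qed

lemma perturbed_linear_is_square:
  assumes "0 < (\<epsilon>::real)"
  shows "const_poly \<epsilon> + const_poly b * y + const_poly (b\<^sup>2 / (4 * \<epsilon>)) * y\<^sup>2 =
    (const_poly (sqrt \<epsilon>) + const_poly (b / (2 * sqrt \<epsilon>)) * y)\<^sup>2"
proof -
  have 1: "sqrt \<epsilon> * sqrt \<epsilon> = \<epsilon>" using assms by simp
  have 2: "sqrt \<epsilon> * (b / (2 * sqrt \<epsilon>)) + sqrt \<epsilon> * (b / (2 * sqrt \<epsilon>)) = b" using assms by simp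
  have 3: "(b / (2 * sqrt \<epsilon>)) * (b / (2 * sqrt \<epsilon>)) = b\<^sup>2 / (4 * \<epsilon>)"
    using assms by (simp add: power2_eq_square)
  have expand: "(\<alpha> + \<beta> * y)\<^sup>2 = \<alpha> * \<alpha> + (\<alpha> * \<beta> + \<alpha> * \<beta>) * y + (\<beta> * \<beta>) * y\<^sup>2" for \<alpha> \<beta>
    by (simp add: power2_eq_square algebra_simps)
  show ?thesis unfolding expand const_poly_mult const_poly_add[symmetric] 1 2 3 ..
qed

text \<open>
By \<open>perturbed_linear_is_square\<close>, half of \<open>\<epsilon>\<close> turns a linear term in \<open>y\<close> into a square, at the cost of a
multiple of \<open>y\<^sup>2\<close>. Applied to \<open>y = t\<close>, \<open>t\<^sup>2\<close>, \<open>t\<^sup>4\<close> and so on, this pushes the cost into arbitrarily high powers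
of \<open>t\<close>, while \<open>c\<close> and \<open>\<epsilon>\<close> enter only through coefficients and not through degrees.
\<close>

lemma perturbed_linear_sum_of_squares:
  fixes t :: "'n::finite rpoly"
  shows "\<exists>d. \<forall>c \<epsilon>. 0 < \<epsilon> \<longrightarrow> (\<exists>M\<ge>0. \<exists>\<sigma>\<in>sums_of_squares. total_degree \<sigma> \<le> d \<and>
    const_poly \<epsilon> + const_poly c * t + const_poly M * t ^ (2 ^ Suc m) = \<sigma>)"
proof (induction m)
  case 0
  show ?case
  proof (intro exI[of _ "max (total_degree t) (total_degree (t\<^sup>2))"] allI impI)
    fix c \<epsilon> :: real assume \<epsilon>: "0 < \<epsilon>"
    let ?\<sigma> = "const_poly \<epsilon> + const_poly c * t + const_poly (c\<^sup>2 / (4 * \<epsilon>)) * t\<^sup>2"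
    have "?\<sigma> \<in> sums_of_squares"
      unfolding perturbed_linear_is_square[OF \<epsilon>] by (rule sums_of_squares_square)
    moreover have "total_degree ?\<sigma> \<le> max (total_degree t) (total_degree (t\<^sup>2))"
      by (intro total_degree_add total_degree_const_mult) auto
    moreover have "0 \<le> c\<^sup>2 / (4 * \<epsilon>)" using \<epsilon> by simp
    ultimately show "\<exists>M\<ge>0. \<exists>\<sigma>\<in>sums_of_squares. total_degree \<sigma> \<le> max (total_degree t) (total_degree (t\<^sup>2)) \<and>
      const_poly \<epsilon> + const_poly c * t + const_poly M * t ^ (2 ^ Suc 0) = \<sigma>" by auto
  qed
next
  case (Suc m)
  define y where "y = t ^ (2 ^ Suc m)"
  have y2: "t ^ (2 ^ Suc (Suc m)) = y\<^sup>2" by (simp add: y_def flip: power_mult)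
  obtain d where d: "\<And>c \<epsilon>. 0 < \<epsilon> \<Longrightarrow> \<exists>M\<ge>0. \<exists>\<sigma>\<in>sums_of_squares. total_degree \<sigma> \<le> d \<and>
    const_poly \<epsilon> + const_poly c * t + const_poly M * y = \<sigma>"
    using Suc unfolding y_def by blast
  define d' where "d' = max d (max (total_degree y) (total_degree (y\<^sup>2)))"
  show ?case unfolding y2
  proof (intro exI[of _ d'] allI impI)
    fix c \<epsilon> :: real assume \<epsilon>: "0 < \<epsilon>"
    then have \<epsilon>2: "0 < \<epsilon> / 2" by simp
    from d[OF \<epsilon>2, of c] obtain M \<sigma> where \<sigma>: "\<sigma> \<in> sums_of_squares" "total_degree \<sigma> \<le> d"
      "const_poly (\<epsilon> / 2) + const_poly c * t + const_poly M * y = \<sigma>" by blast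
    let ?M = "(- M)\<^sup>2 / (4 * (\<epsilon> / 2))"
    let ?\<tau> = "const_poly (\<epsilon> / 2) + const_poly (- M) * y + const_poly ?M * y\<^sup>2"
    have "?\<tau> \<in> sums_of_squares"
      unfolding perturbed_linear_is_square[OF \<epsilon>2] by (rule sums_of_squares_square)
    then have "\<sigma> + ?\<tau> \<in> sums_of_squares" by (rule sums_of_squares_add[OF \<sigma>(1)])
    moreover have "total_degree (\<sigma> + ?\<tau>) \<le> d'"
      by (intro total_degree_add total_degree_const_mult) (use \<sigma>(2) in \<open>auto simp: d'_def\<close>)
    moreover have "const_poly \<epsilon> + const_poly c * t + const_poly ?M * y\<^sup>2 = \<sigma> + ?\<tau>"
    proof -
      have "const_poly \<epsilon> = const_poly (\<epsilon> / 2) + (const_poly (\<epsilon> / 2) :: 'n rpoly)"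
        by (simp flip: const_poly_add)
      then show ?thesis unfolding \<sigma>(3)[symmetric] const_poly_uminus by (simp add: algebra_simps)
    qed
    moreover have "0 \<le> ?M" using \<epsilon> by simp
    ultimately show "\<exists>M\<ge>0. \<exists>\<sigma>\<in>sums_of_squares. total_degree \<sigma> \<le> d' \<and>
      const_poly \<epsilon> + const_poly c * t + const_poly M * y\<^sup>2 = \<sigma>" by blast
  qed
qed

lemma truncated_ideal_mono: "k \<le> l \<Longrightarrow> truncated_ideal h k \<subseteq> truncated_ideal h l"
  unfolding truncated_ideal_def by (smt (verit) Collect_mono mult_le_mono2 order_trans)

lemma truncated_ideal_add:
  assumes "p \<in> truncated_ideal h k" "q \<in> truncated_ideal h k"
  shows "p + q \<in> truncated_ideal h k"
proof -
  obtain \<phi> \<psi> where \<phi>: "p = (\<Sum>i<length h. \<phi> i * h ! i)" "\<forall>i<length h. total_degree (\<phi> i * h ! i) \<le> 2 * k"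
    and \<psi>: "q = (\<Sum>i<length h. \<psi> i * h ! i)" "\<forall>i<length h. total_degree (\<psi> i * h ! i) \<le> 2 * k"
    using assms unfolding truncated_ideal_def by blast
  have "p + q = (\<Sum>i<length h. (\<phi> i + \<psi> i) * h ! i)" by (simp add: \<phi> \<psi> distrib_right sum.distrib)
  moreover have "\<forall>i<length h. total_degree ((\<phi> i + \<psi> i) * h ! i) \<le> 2 * k"
    using \<phi>(2) \<psi>(2) by (simp add: distrib_right total_degree_add)
  ultimately show ?thesis unfolding truncated_ideal_def by (intro CollectI exI[of _ "\<lambda>i. \<phi> i + \<psi> i"]) blast
qed

definition ideal_plus_squares :: "'n::finite rpoly list \<Rightarrow> nat \<Rightarrow> 'n rpoly set" where
  "ideal_plus_squares h k = {p + \<sigma> | p \<sigma>. p \<in> truncated_ideal h k \<and> \<sigma> \<in> sums_of_squares \<and> total_degree \<sigma> \<le> 2 * k}"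

lemma ideal_plus_squares_add:
  assumes "p \<in> ideal_plus_squares h k" "q \<in> ideal_plus_squares h k"
  shows "p + q \<in> ideal_plus_squares h k"
proof -
  obtain p1 p2 q1 q2 where p: "p = p1 + p2" "p1 \<in> truncated_ideal h k" "p2 \<in> sums_of_squares" "total_degree p2 \<le> 2 * k"
    and q: "q = q1 + q2" "q1 \<in> truncated_ideal h k" "q2 \<in> sums_of_squares" "total_degree q2 \<le> 2 * k"
    using assms unfolding ideal_plus_squares_def by blast
  have "p + q = (p1 + q1) + (p2 + q2)" by (simp add: p q)
  then show ?thesis unfolding ideal_plus_squares_def
    using truncated_ideal_add[OF p(2) q(2)] sums_of_squares_add[OF p(3) q(3)] total_degree_add[OF p(4) q(4)] by blast
qed

lemma ideal_plus_squares_mono: "k \<le> l \<Longrightarrow> ideal_plus_squares h k \<subseteq> ideal_plus_squares h l"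
  unfolding ideal_plus_squares_def using truncated_ideal_mono[of k l h] by fastforce

text \<open>
The Nullstellensatz relation for \<open>b\<close> is multiplied by an even power of \<open>b\<close> to reach an exponent that is a power of two,
and then \<open>M\<close> times this relation is subtracted from \<open>\<epsilon> + c b + M b\<^sup>N\<close>.
\<close>

lemma multiples_in_ideal_plus_squares:
  fixes h :: "'n::finite rpoly list"
  assumes vanish: "\<And>u. u \<in> real_variety h \<Longrightarrow> eval_poly b u = 0"
  shows "\<exists>k. \<forall>c \<epsilon>. 0 < \<epsilon> \<longrightarrow> const_poly c * b + const_poly \<epsilon> \<in> ideal_plus_squares h k"
proof -
  obtain l s \<phi> where s: "s \<in> sums_of_squares" "b ^ (2 * l) + s = (\<Sum>i<length h. \<phi> i * h ! i)"
    using real_nullstellensatz[OF vanish] by blast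
  \<comment> \<open>\<open>2 l + 2 e = 2 ^ Suc l\<close>\<close>
  define e where "e = 2 ^ l - l"
  have le: "l \<le> 2 ^ l" by (simp add: less_imp_le)
  define s' where "s' = (b ^ e)\<^sup>2 * s"
  define \<psi> where "\<psi> i = (b ^ e)\<^sup>2 * \<phi> i" for i
  have s': "s' \<in> sums_of_squares" unfolding s'_def by (rule sums_of_squares_square_mult[OF s(1)])
  have "b ^ (2 ^ Suc l) = (b ^ e)\<^sup>2 * b ^ (2 * l)"
  proof -
    have "2 ^ l = e + l" using le by (simp add: e_def)
    then have "2 ^ Suc l = e * 2 + 2 * l" by simp
    then show ?thesis by (simp only: power_add power_mult)
  qed
  then have eq: "b ^ (2 ^ Suc l) + s' = (\<Sum>i<length h. \<psi> i * h ! i)"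
    unfolding \<psi>_def s'_def mult.assoc sum_distrib_left[symmetric] s(2)[symmetric] by (simp only: distrib_left)
  obtain d where d: "\<And>c \<epsilon>. 0 < \<epsilon> \<Longrightarrow> \<exists>M\<ge>0. \<exists>\<sigma>\<in>sums_of_squares. total_degree \<sigma> \<le> d \<and>
    const_poly \<epsilon> + const_poly c * b + const_poly M * b ^ (2 ^ Suc l) = \<sigma>"
    using perturbed_linear_sum_of_squares[of b l] by blast
  define k where "k = d + total_degree s' + (\<Sum>i<length h. total_degree (\<psi> i * h ! i))"
  have k: "total_degree (\<psi> i * h ! i) \<le> 2 * k" if "i < length h" for i
    using member_le_sum[of i "{..<length h}" "\<lambda>i. total_degree (\<psi> i * h ! i)"] that by (simp add: k_def)
  show ?thesis
  proof (intro exI[of _ k] allI impI)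
    fix c \<epsilon> :: real assume "0 < \<epsilon>"
    from d[OF this, of c] obtain M \<sigma> where M: "0 \<le> M" and \<sigma>: "\<sigma> \<in> sums_of_squares" "total_degree \<sigma> \<le> d"
      "const_poly \<epsilon> + const_poly c * b + const_poly M * b ^ (2 ^ Suc l) = \<sigma>" by blast
    let ?p = "\<Sum>i<length h. (const_poly (- M) * \<psi> i) * h ! i"
    have "?p = const_poly (- M) * (b ^ (2 ^ Suc l) + s')"
      unfolding eq by (simp add: sum_distrib_left mult.assoc)
    then have "const_poly c * b + const_poly \<epsilon> = ?p + (\<sigma> + const_poly M * s')"
      unfolding \<sigma>(3)[symmetric] const_poly_uminus by (simp add: algebra_simps)
    moreover have "?p \<in> truncated_ideal h k"
      unfolding truncated_ideal_def
      by (intro CollectI exI[of _ "\<lambda>i. const_poly (- M) * \<psi> i"])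
        (simp add: mult.assoc total_degree_const_mult k)
    moreover have "\<sigma> + const_poly M * s' \<in> sums_of_squares"
      by (intro sums_of_squares_add \<sigma>(1) const_mult_sums_of_squares M s')
    moreover have "total_degree (\<sigma> + const_poly M * s') \<le> 2 * k"
      by (intro total_degree_add total_degree_const_mult) (use \<sigma>(2) in \<open>auto simp: k_def\<close>)
    ultimately show "const_poly c * b + const_poly \<epsilon> \<in> ideal_plus_squares h k"
      unfolding ideal_plus_squares_def by blast
  qed
qed

text \<open>
The induction on the set of exponents chooses a basis of the space of vanishing polynomials in echelon form. Each basis
element uses up half of the remaining \<open>\<epsilon>\<close>.
\<close>

lemma vanishing_in_ideal_plus_squares:
  fixes h :: "'n::finite rpoly list"
  assumes "finite E"
  shows "\<exists>k. \<forall>p \<epsilon>. Poly_Mapping.keys p \<subseteq> E \<longrightarrow> (\<forall>u\<in>real_variety h. eval_poly p u = 0) \<longrightarrow> 0 < \<epsilon> \<longrightarrow>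
    p + const_poly \<epsilon> \<in> ideal_plus_squares h k"
  using assms
proof (induction E)
  case empty
  obtain k where k: "\<And>c \<epsilon>. 0 < \<epsilon> \<Longrightarrow> const_poly c * 0 + const_poly \<epsilon> \<in> ideal_plus_squares h k"
    using multiples_in_ideal_plus_squares[of h 0] eval_poly_zero by blast
  then show ?case by (intro exI[of _ k]) auto
next
  case (insert a E)
  then obtain k where k: "\<And>p \<epsilon>. Poly_Mapping.keys p \<subseteq> E \<Longrightarrow> (\<forall>u\<in>real_variety h. eval_poly p u = 0) \<Longrightarrow> 0 < \<epsilon> \<Longrightarrow>
    p + const_poly \<epsilon> \<in> ideal_plus_squares h k" by blast
  show ?case
  proof (cases "\<exists>b. Poly_Mapping.keys b \<subseteq> insert a E \<and> (\<forall>u\<in>real_variety h. eval_poly b u = 0) \<and> Poly_Mapping.lookup b a \<noteq> 0")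
    case False
    show ?thesis
    proof (intro exI[of _ k] allI impI)
      fix p and \<epsilon> :: real
      assume p: "Poly_Mapping.keys p \<subseteq> insert a E" "\<forall>u\<in>real_variety h. eval_poly p u = 0" and "0 < \<epsilon>"
      then have "Poly_Mapping.lookup p a = 0" using False by blast
      then have "Poly_Mapping.keys p \<subseteq> E" using p(1) by (auto simp: in_keys_iff)
      then show "p + const_poly \<epsilon> \<in> ideal_plus_squares h k" using k p(2) \<open>0 < \<epsilon>\<close> by blast
    qed
  next
    case True
    then obtain b where b: "Poly_Mapping.keys b \<subseteq> insert a E" "\<forall>u\<in>real_variety h. eval_poly b u = 0"
      "Poly_Mapping.lookup b a \<noteq> 0" by blast
    obtain l where l: "\<And>c \<epsilon>. 0 < \<epsilon> \<Longrightarrow> const_poly c * b + const_poly \<epsilon> \<in> ideal_plus_squares h l"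
      using multiples_in_ideal_plus_squares[of h b] b(2) by blast
    show ?thesis
    proof (intro exI[of _ "max k l"] allI impI)
      fix p and \<epsilon> :: real
      assume p: "Poly_Mapping.keys p \<subseteq> insert a E" "\<forall>u\<in>real_variety h. eval_poly p u = 0" and \<epsilon>: "0 < \<epsilon>"
      \<comment> \<open>Subtracting \<open>c b\<close> removes the exponent \<open>a\<close> from \<open>p\<close>.\<close>
      define c where "c = Poly_Mapping.lookup p a / Poly_Mapping.lookup b a"
      define q where "q = p - const_poly c * b"
      have lq: "Poly_Mapping.lookup q e = Poly_Mapping.lookup p e - c * Poly_Mapping.lookup b e" for e
        by (simp add: q_def lookup_minus lookup_const_poly_mult)
      have qa: "Poly_Mapping.lookup q a = 0" using b(3) by (simp add: lq c_def)
      have "Poly_Mapping.keys q \<subseteq> E"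
      proof
        fix t assume t: "t \<in> Poly_Mapping.keys q"
        then have "t \<noteq> a" using qa by (auto simp: in_keys_iff)
        moreover have "Poly_Mapping.lookup p t \<noteq> 0 \<or> Poly_Mapping.lookup b t \<noteq> 0"
          using t by (auto simp: in_keys_iff lq)
        then have "t \<in> insert a E" using p(1) b(1) by (auto simp flip: in_keys_iff)
        ultimately show "t \<in> E" by simp
      qed
      moreover have "\<forall>u\<in>real_variety h. eval_poly q u = 0"
        using p(2) b(2) by (simp add: q_def eval_poly_mult ring_morphism_simps(6)[OF ring_morphism_eval_poly])
      ultimately have "q + const_poly (\<epsilon> / 2) \<in> ideal_plus_squares h k" using k \<epsilon> by simp
      then have 1: "q + const_poly (\<epsilon> / 2) \<in> ideal_plus_squares h (max k l)"
        using ideal_plus_squares_mono[of k "max k l" h] by auto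
      have "const_poly c * b + const_poly (\<epsilon> / 2) \<in> ideal_plus_squares h l" using l \<epsilon> by simp
      then have 2: "const_poly c * b + const_poly (\<epsilon> / 2) \<in> ideal_plus_squares h (max k l)"
        using ideal_plus_squares_mono[of l "max k l" h] by auto
      have "const_poly \<epsilon> = const_poly (\<epsilon> / 2) + (const_poly (\<epsilon> / 2) :: 'n rpoly)"
        by (simp flip: const_poly_add)
      then have "p + const_poly \<epsilon> = (q + const_poly (\<epsilon> / 2)) + (const_poly c * b + const_poly (\<epsilon> / 2))"
        by (simp add: q_def)
      then show "p + const_poly \<epsilon> \<in> ideal_plus_squares h (max k l)"
        using ideal_plus_squares_add[OF 1 2] by simp
    qed
  qed
qed

section \<open>Comparison of the two hierarchies\<close>

lemma sos_polys_eq: "sos_polys = sums_of_squares"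
  by (simp add: sos_polys_def sums_of_squares_def)

lemma eval_poly_sums_of_squares_nonneg:
  assumes "s \<in> sums_of_squares" shows "0 \<le> eval_poly s u"
  using assms by (induction s rule: sums_of_squares_induct)
    (auto simp: eval_poly_zero eval_poly_add power2_eq_square eval_poly_mult)

lemma eval_poly_truncated_ideal:
  assumes "p \<in> truncated_ideal h k" "u \<in> real_variety h"
  shows "eval_poly p u = 0"
  using assms
  by (auto simp: truncated_ideal_def real_variety_def eval_poly_mult
      ring_morphism_simps(9)[OF ring_morphism_eval_poly])

lemma eval_poly_truncated_quadratic_module:
  assumes "p \<in> truncated_quadratic_module g k" "\<forall>j<length g. 0 \<le> eval_poly (g ! j) u"
  shows "0 \<le> eval_poly p u"
proof -
  obtain \<sigma> where \<sigma>: "p = (\<Sum>j\<le>length g. \<sigma> j * (1 # g) ! j)" "\<forall>j\<le>length g. \<sigma> j \<in> sums_of_squares"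
    using assms(1) unfolding truncated_quadratic_module_def sos_polys_eq by blast
  have "0 \<le> eval_poly (\<sigma> j) u * eval_poly ((1 # g) ! j) u" if "j \<le> length g" for j
  proof (rule mult_nonneg_nonneg)
    show "0 \<le> eval_poly (\<sigma> j) u" using \<sigma>(2) that by (intro eval_poly_sums_of_squares_nonneg) simp
    show "0 \<le> eval_poly ((1 # g) ! j) u" using assms(2) that by (cases j) (auto simp: eval_poly_one)
  qed
  then show ?thesis
    unfolding \<sigma>(1) by (auto simp: ring_morphism_simps(9)[OF ring_morphism_eval_poly] eval_poly_mult intro!: sum_nonneg)
qed

lemma truncated_ideal_total_degree:
  assumes "p \<in> truncated_ideal h k" shows "total_degree p \<le> 2 * k"
proof -
  have sum: "total_degree (sum f A) \<le> d" if "\<And>i. i \<in> A \<Longrightarrow> total_degree (f i) \<le> d" for f :: "nat \<Rightarrow> 'a rpoly" and A d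
    using that by (induction A rule: infinite_finite_induct) (auto intro: total_degree_add)
  show ?thesis using assms unfolding truncated_ideal_def by (auto intro: sum)
qed

lemma truncated_quadratic_module_mono:
  "k \<le> l \<Longrightarrow> truncated_quadratic_module g k \<subseteq> truncated_quadratic_module g l"
proof
  fix p assume "k \<le> l" "p \<in> truncated_quadratic_module g k"
  then obtain \<sigma> where "p = (\<Sum>j\<le>length g. \<sigma> j * (1 # g) ! j)"
    "\<forall>j\<le>length g. \<sigma> j \<in> sos_polys \<and> total_degree (\<sigma> j * (1 # g) ! j) \<le> 2 * k"
    unfolding truncated_quadratic_module_def by blast
  moreover from this \<open>k \<le> l\<close> have "\<forall>j\<le>length g. \<sigma> j \<in> sos_polys \<and> total_degree (\<sigma> j * (1 # g) ! j) \<le> 2 * l"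
    by (meson mult_le_mono2 order_trans)
  ultimately show "p \<in> truncated_quadratic_module g l" unfolding truncated_quadratic_module_def by blast
qed

lemma truncated_quadratic_module_add_square:
  assumes "p \<in> truncated_quadratic_module g k" "\<tau> \<in> sums_of_squares" "total_degree \<tau> \<le> 2 * k"
  shows "\<tau> + p \<in> truncated_quadratic_module g k"
proof -
  obtain \<sigma> where \<sigma>: "p = (\<Sum>j\<le>length g. \<sigma> j * (1 # g) ! j)"
    "\<forall>j\<le>length g. \<sigma> j \<in> sums_of_squares \<and> total_degree (\<sigma> j * (1 # g) ! j) \<le> 2 * k"
    using assms(1) unfolding truncated_quadratic_module_def sos_polys_eq by blast
  define \<sigma>' where "\<sigma>' j = (if j = 0 then \<tau> else 0) + \<sigma> j" for j
  have "(\<Sum>j\<le>length g. (if j = 0 then \<tau> else 0) * (1 # g) ! j) = \<tau>"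
    by (simp add: if_distrib[of "\<lambda>c. c * _"] cong: if_cong)
  then have "\<tau> + p = (\<Sum>j\<le>length g. \<sigma>' j * (1 # g) ! j)"
    unfolding \<sigma>'_def distrib_right sum.distrib \<sigma>(1) by simp
  moreover have "\<forall>j\<le>length g. \<sigma>' j \<in> sums_of_squares \<and> total_degree (\<sigma>' j * (1 # g) ! j) \<le> 2 * k"
    using \<sigma>(2) assms(2,3)
    by (auto simp: \<sigma>'_def distrib_right intro!: sums_of_squares_add total_degree_add)
  ultimately show ?thesis unfolding truncated_quadratic_module_def sos_polys_eq by blast
qed

lemma finite_exponents_of_bounded_degree:
  "finite {a :: 'n::finite \<Rightarrow>\<^sub>0 nat. (\<Sum>i\<in>UNIV. Poly_Mapping.lookup a i) \<le> d}" (is "finite ?E")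
proof (rule finite_imageD)
  show "inj_on Poly_Mapping.lookup ?E" by (auto intro: inj_onI poly_mapping_eqI)
  have "Poly_Mapping.lookup a i \<le> d" if "(\<Sum>i\<in>UNIV. Poly_Mapping.lookup a i) \<le> d" for a :: "'n \<Rightarrow>\<^sub>0 nat" and i
    using member_le_sum[of i UNIV "Poly_Mapping.lookup a"] that by simp
  then have "Poly_Mapping.lookup ` ?E \<subseteq> PiE UNIV (\<lambda>_. {..d})" by auto
  then show "finite (Poly_Mapping.lookup ` ?E)" by (rule finite_subset) (auto intro: finite_PiE)
qed

lemma sos_relaxation_le_min_value: "sos_relaxation_value f h g k \<le> min_value f h g"
  unfolding sos_relaxation_value_def min_value_def
proof (rule SUP_least, rule INF_greatest)
  fix \<gamma> x
  assume "\<gamma> \<in> {\<gamma>. f - const_poly \<gamma> \<in> truncated_ideal h k + truncated_quadratic_module g k}"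
    and x: "x \<in> feasible_set h g"
  then obtain p u where pu: "f - const_poly \<gamma> = p + u" "p \<in> truncated_ideal h k" "u \<in> truncated_quadratic_module g k"
    by (auto elim: set_plus_elim)
  have "eval_poly (f - const_poly \<gamma>) x = eval_poly f x - \<gamma>"
    by (simp add: ring_morphism_simps(6)[OF ring_morphism_eval_poly] eval_poly_const)
  moreover have "0 \<le> eval_poly (f - const_poly \<gamma>) x"
    unfolding pu(1) eval_poly_add
    using eval_poly_truncated_ideal[OF pu(2)] eval_poly_truncated_quadratic_module[OF pu(3)] x
    by (simp add: feasible_set_def)
  ultimately show "ereal \<gamma> \<le> ereal (eval_poly f x)" by simp
qed

text \<open>
The order \<open>m\<close> is the same for all \<open>\<epsilon>\<close>, so the loss of \<open>\<epsilon>\<close> disappears in the supremum.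
\<close>

lemma sos_relaxation_dominates:
  fixes h h' g :: "'n::finite rpoly list"
  assumes V: "real_variety h = real_variety h'"
  shows "\<exists>l. sos_relaxation_value f h g k \<le> sos_relaxation_value f h' g l"
proof -
  let ?E = "{a :: 'n \<Rightarrow>\<^sub>0 nat. (\<Sum>i\<in>UNIV. Poly_Mapping.lookup a i) \<le> 2 * k}"
  obtain l where l: "\<And>p \<epsilon>. Poly_Mapping.keys p \<subseteq> ?E \<Longrightarrow> \<forall>u\<in>real_variety h'. eval_poly p u = 0 \<Longrightarrow> 0 < \<epsilon> \<Longrightarrow>
      p + const_poly \<epsilon> \<in> ideal_plus_squares h' l"
    using vanishing_in_ideal_plus_squares[OF finite_exponents_of_bounded_degree, of "2 * k" h'] by blast
  define m where "m = max k l"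
  have shifted: "f - const_poly (\<gamma> - \<epsilon>) \<in> truncated_ideal h' m + truncated_quadratic_module g m"
    if \<gamma>: "f - const_poly \<gamma> \<in> truncated_ideal h k + truncated_quadratic_module g k" and "0 < \<epsilon>" for \<gamma> \<epsilon>
  proof -
    obtain p u where pu: "f - const_poly \<gamma> = p + u" "p \<in> truncated_ideal h k" "u \<in> truncated_quadratic_module g k"
      using \<gamma> by (auto elim: set_plus_elim)
    have "Poly_Mapping.keys p \<subseteq> ?E"
      using truncated_ideal_total_degree[OF pu(2)] by (auto simp: total_degree_le_iff)
    moreover have "\<forall>v\<in>real_variety h'. eval_poly p v = 0"
      using eval_poly_truncated_ideal[OF pu(2)] V by simp
    ultimately have "p + const_poly \<epsilon> \<in> ideal_plus_squares h' m"
      using l \<open>0 < \<epsilon>\<close> ideal_plus_squares_mono[of l m h'] by (auto simp: m_def)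
    then obtain p' \<tau> where p': "p + const_poly \<epsilon> = p' + \<tau>" "p' \<in> truncated_ideal h' m"
      "\<tau> \<in> sums_of_squares" "total_degree \<tau> \<le> 2 * m" unfolding ideal_plus_squares_def by blast
    have "u \<in> truncated_quadratic_module g m"
      using truncated_quadratic_module_mono[of k m g] pu(3) by (auto simp: m_def)
    then have "\<tau> + u \<in> truncated_quadratic_module g m"
      by (rule truncated_quadratic_module_add_square[OF _ p'(3,4)])
    moreover have "f - const_poly (\<gamma> - \<epsilon>) = p' + (\<tau> + u)"
    proof -
      have "f - const_poly (\<gamma> - \<epsilon>) = (f - const_poly \<gamma>) + const_poly \<epsilon>" by (simp add: const_poly_diff)
      also have "\<dots> = (p + const_poly \<epsilon>) + u" unfolding pu(1) by simp
      finally show ?thesis unfolding p'(1) by (simp add: add.assoc)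
    qed
    ultimately show ?thesis using p'(2) by (metis set_plus_intro)
  qed
  have "sos_relaxation_value f h g k \<le> sos_relaxation_value f h' g m"
    unfolding sos_relaxation_value_def[of f h]
  proof (rule SUP_least, rule ereal_le_epsilon2)
    fix \<gamma> \<epsilon> :: real
    assume "\<gamma> \<in> {\<gamma>. f - const_poly \<gamma> \<in> truncated_ideal h k + truncated_quadratic_module g k}" "0 < \<epsilon>"
    then have "ereal (\<gamma> - \<epsilon>) \<le> sos_relaxation_value f h' g m"
      unfolding sos_relaxation_value_def by (intro SUP_upper) (simp add: shifted)
    then have "ereal (\<gamma> - \<epsilon>) + ereal \<epsilon> \<le> sos_relaxation_value f h' g m + ereal \<epsilon>" by (rule add_right_mono)
    then show "ereal \<gamma> \<le> sos_relaxation_value f h' g m + ereal \<epsilon>" by simp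
  qed
  then show ?thesis ..
qed

lemma finite_convergence_transfer:
  assumes V: "real_variety h = real_variety h'"
    and conv: "finite_convergence (sos_relaxation_value f h g) (min_value f h g)"
  shows "finite_convergence (sos_relaxation_value f h' g) (min_value f h g)"
proof -
  obtain k where k: "sos_relaxation_value f h g k = min_value f h g"
    using conv unfolding finite_convergence_def by blast
  obtain l where "sos_relaxation_value f h g k \<le> sos_relaxation_value f h' g l"
    using sos_relaxation_dominates[OF V] by blast
  moreover have "sos_relaxation_value f h' g l \<le> min_value f h g"
    using sos_relaxation_le_min_value[of f h' g l] V by (simp add: min_value_def feasible_set_def)
  ultimately show ?thesis unfolding finite_convergence_def using k by (intro exI[of _ l]) simp
qed

theorem theorem1p2:
  fixes f :: "'n::finite rpoly"
    and h g h' :: "'n rpoly list"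
  assumes "real_variety h = real_variety h'"
    and "vanishing_ideal (feasible_set h g) = vanishing_ideal (real_variety h)"
  shows "finite_convergence (sos_relaxation_value f h g) (min_value f h g) \<longleftrightarrow>
         finite_convergence (sos_relaxation_value f h' g) (min_value f h g)"
proof
  have same_min: "min_value f h g = min_value f h' g"
    using assms(1) by (simp add: min_value_def feasible_set_def)
  show "finite_convergence (sos_relaxation_value f h' g) (min_value f h g)"
    if "finite_convergence (sos_relaxation_value f h g) (min_value f h g)"
    by (rule finite_convergence_transfer[OF assms(1) that])
  show "finite_convergence (sos_relaxation_value f h g) (min_value f h g)"
    if "finite_convergence (sos_relaxation_value f h' g) (min_value f h g)"
    using finite_convergence_transfer[OF assms(1)[symmetric]] that unfolding same_min by blast
qed

end
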